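(* A one-mode Gaussian quantum channel is singular if and only if its kernel $J(x_f,x_i;r_f,r_i)$ in the position space representation has one of the following functional forms: \begin{enumerate} \item $\displaystyle \frac{b_3}{2\pi}\exp\Big[\mathrm{i}\big(b_1x_fr_f+b_3x_ir_f+b_4x_ir_i+c_1x_f+c_2x_i\big)-a_1x_f^2-a_2x_fx_i-a_3x_i^2\Big]$; \item $\displaystyle |\beta|\sqrt{\frac{e_1}{\pi}}\;\delta(\alpha x_f-\beta x_i)\exp\Big[-a_2x_fx_i-a_1x_f^2-a_3x_i^2+\mathrm{i}\big(b_2x_fr_i+b_3r_fx_i+b_1r_fx_f+b_4r_ix_i+c_1x_f+c_2x_i\big)-e_1r_f^2-e_2r_fr_i-\frac{e_2^2r_i^2}{4e_1}\Big]$, with $e_2\alpha=0$; \end{enumerate} where all coefficients are real and, in form 2, $\beta\neq0$ and $e_1>0$.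
   Context: One-mode continuous-variable system with canonical observables $\hat q,\hat p$ and $\hbar=1$. A Gaussian state is a state with Gaussian Wigner function; it is determined by its covariance matrix $\sigma$ ($2\times2$) and mean vector $\vec d=(\langle\hat q\rangle,\langle\hat p\rangle)^{\mathrm T}$. A Gaussian quantum channel is a quantum channel (linear, completely positive, trace-preserving) that maps Gaussian states to Gaussian states; it is described by a tuple $(\mathbf T,\mathbf N,\vec\tau)$ with $\mathbf T,\mathbf N$ real $2\times2$ matrices, $\mathbf N=\mathbf N^{\mathrm T}$, acting on Gaussian states by $\sigma\mapsto\mathbf T\sigma\mathbf T^{\mathrm T}+\mathbf N$, $\vec d\mapsto\mathbf T\vec d+\vec\tau$. The channel is singular if it is not invertible, equivalently if $\mathbf T$ is not invertible. Position space representation: with $x=q_2-q_1$ and $r=(q_1+q_2)/2$, set $\rho(x,r)=\langle r-\tfrac x2|\hat\rho|r+\tfrac x2\rangle$; the kernel $J$ of a channel mapping $\hat\rho_i$ to $\hat\rho_f$ is the (possibly distributional) kernel with $$\rho_f(x_f,r_f)=\int_{\mathbb{R}^2}dx_i\,dr_i\,J(x_f,x_i;r_f,r_i)\,\rho_i(x_i,r_i).$$ $\delta$ denotes the Dirac delta.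
   Formalization: The prefactor of form 1 is |b_3|/(2π) instead of b_3/(2π), and in the real Gaussian factor of form 2 r_f is replaced by r_f − d with d real (d = 0 if τ_1 = 0), since the forms as written miss singular channels with b_3 < 0 or with a displacement τ_1 ≠ 0. *)

theory Defs
  imports "HOL-Probability.Probability"
begin

(* An operator on L2(R) is represented by its position kernel K q q' = <q|K|q'>; trace-class
   operators correspond to kernels up to equality almost everywhere. *)
type_synonym opker = "real \<Rightarrow> real \<Rightarrow> complex"

definition ker_eq :: "opker \<Rightarrow> opker \<Rightarrow> bool" where
  "ker_eq K L \<longleftrightarrow> (AE (q, q') in lborel. K q q' = L q q')"

definition L2_fun :: "(real \<Rightarrow> complex) \<Rightarrow> bool" where
  "L2_fun \<psi> \<longleftrightarrow> \<psi> \<in> borel_measurable borel \<and> integrable lborel (\<lambda>q. (cmod (\<psi> q))\<^sup>2)"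

definition L2_norm :: "(real \<Rightarrow> complex) \<Rightarrow> real" where
  "L2_norm \<psi> = sqrt (LINT q|lborel. (cmod (\<psi> q))\<^sup>2)"

(* Trace class as nuclearity: K = sum_n |psi_n><phi_n| with sum_n ||psi_n|| ||phi_n|| finite,
   and tr K = sum_n <phi_n|psi_n>, which does not depend on the decomposition. *)
definition has_trace :: "opker \<Rightarrow> complex \<Rightarrow> bool" where
  "has_trace K t \<longleftrightarrow>
     (\<lambda>(q, q'). K q q') \<in> borel_measurable borel \<and>
     (\<exists>\<psi> \<phi> :: nat \<Rightarrow> real \<Rightarrow> complex.
        (\<forall>n. L2_fun (\<psi> n) \<and> L2_fun (\<phi> n)) \<and>
        summable (\<lambda>n. L2_norm (\<psi> n) * L2_norm (\<phi> n)) \<and>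
        (AE (q, q') in lborel. (\<lambda>n. \<psi> n q * cnj (\<phi> n q')) sums K q q') \<and>
        (\<lambda>n. LINT q|lborel. cnj (\<phi> n q) * \<psi> n q) sums t)"

definition trace_class :: "opker \<Rightarrow> bool" where
  "trace_class K \<longleftrightarrow> (\<exists>t. has_trace K t)"

(* Positivity of the operator (K j k), j, k < n, on L2(R) \<otimes> C^n. *)
definition block_positive :: "nat \<Rightarrow> (nat \<Rightarrow> nat \<Rightarrow> opker) \<Rightarrow> bool" where
  "block_positive n K \<longleftrightarrow>
     (\<forall>\<psi>. (\<forall>j<n. L2_fun (\<psi> j)) \<longrightarrow>
        (\<Sum>j<n. \<Sum>k<n. LINT (q, q')|lborel. cnj (\<psi> j q) * K j k q q' * \<psi> k q')
          \<in> \<real>\<^sub>\<ge>\<^sub>0)"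

definition density_operator :: "opker \<Rightarrow> bool" where
  "density_operator K \<longleftrightarrow> has_trace K 1 \<and> block_positive 1 (\<lambda>_ _. K)"

definition completely_positive :: "(opker \<Rightarrow> opker) \<Rightarrow> bool" where
  "completely_positive \<Phi> \<longleftrightarrow>
     (\<forall>n K. (\<forall>j<n. \<forall>k<n. trace_class (K j k)) \<and> block_positive n K \<longrightarrow>
        block_positive n (\<lambda>j k. \<Phi> (K j k)))"

definition trace_preserving :: "(opker \<Rightarrow> opker) \<Rightarrow> bool" where
  "trace_preserving \<Phi> \<longleftrightarrow> (\<forall>K t. has_trace K t \<longrightarrow> has_trace (\<Phi> K) t)"

(* Linear map of trace-class operators, hence compatible with ker_eq and linear up to it. *)
definition linear_on_trace_class :: "(opker \<Rightarrow> opker) \<Rightarrow> bool" where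
  "linear_on_trace_class \<Phi> \<longleftrightarrow>
     (\<forall>K. trace_class K \<longrightarrow> trace_class (\<Phi> K)) \<and>
     (\<forall>K L. trace_class K \<and> trace_class L \<and> ker_eq K L \<longrightarrow> ker_eq (\<Phi> K) (\<Phi> L)) \<and>
     (\<forall>K L. trace_class K \<and> trace_class L \<longrightarrow>
        ker_eq (\<Phi> (\<lambda>q q'. K q q' + L q q')) (\<lambda>q q'. \<Phi> K q q' + \<Phi> L q q')) \<and>
     (\<forall>c K. trace_class K \<longrightarrow>
        ker_eq (\<Phi> (\<lambda>q q'. c * K q q')) (\<lambda>q q'. c * \<Phi> K q q'))"

definition quantum_channel :: "(opker \<Rightarrow> opker) \<Rightarrow> bool" where
  "quantum_channel \<Phi> \<longleftrightarrow>
     linear_on_trace_class \<Phi> \<and> completely_positive \<Phi> \<and> trace_preserving \<Phi>"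

(* rho(x, r) = <r - x/2| rho |r + x/2> *)
definition pos_rep :: "opker \<Rightarrow> real \<Rightarrow> real \<Rightarrow> complex" where
  "pos_rep K x r = K (r - x / 2) (r + x / 2)"

definition wigner :: "opker \<Rightarrow> real \<Rightarrow> real \<Rightarrow> complex" where
  "wigner K q p =
     1 / (2 * of_real pi) * (LINT x|lborel. pos_rep K x q * exp (\<i> * of_real (p * x)))"

(* Since K is only determined almost everywhere, its Wigner function is prescribed for almost
   every q. The matrix \<sigma> is the covariance matrix in the normalisation in which the vacuum
   has \<sigma> = 1/2. *)
definition gaussian_state_with :: "opker \<Rightarrow> real^2^2 \<Rightarrow> real^2 \<Rightarrow> bool" where
  "gaussian_state_with K \<sigma> d \<longleftrightarrow>
     density_operator K \<and>
     transpose \<sigma> = \<sigma> \<and> (\<forall>v. v \<noteq> 0 \<longrightarrow> v \<bullet> (\<sigma> *v v) > 0) \<and>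
     (AE q in lborel. integrable lborel (\<lambda>x. pos_rep K x q) \<and>
        (\<forall>p. wigner K q p =
           (let z = vector [q, p] - d
            in of_real (exp (- (z \<bullet> (matrix_inv \<sigma> *v z)) / 2) / (2 * pi * sqrt (det \<sigma>))))))"

definition gaussian_state :: "opker \<Rightarrow> bool" where
  "gaussian_state K \<longleftrightarrow> (\<exists>\<sigma> d. gaussian_state_with K \<sigma> d)"

definition gaussian_channel :: "(opker \<Rightarrow> opker) \<Rightarrow> bool" where
  "gaussian_channel \<Phi> \<longleftrightarrow>
     quantum_channel \<Phi> \<and> (\<forall>K. gaussian_state K \<longrightarrow> gaussian_state (\<Phi> K))"

definition described_by :: "(opker \<Rightarrow> opker) \<Rightarrow> real^2^2 \<Rightarrow> real^2^2 \<Rightarrow> real^2 \<Rightarrow> bool" where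
  "described_by \<Phi> T N \<tau> \<longleftrightarrow>
     transpose N = N \<and>
     (\<forall>K \<sigma> d. gaussian_state_with K \<sigma> d \<longrightarrow>
        gaussian_state_with (\<Phi> K) (T ** \<sigma> ** transpose T + N) (T *v d + \<tau>))"

(* Schwartz functions of two variables; D m n is the partial derivative of order m in the
   first and n in the second variable. *)
definition schwartz :: "(real \<Rightarrow> real \<Rightarrow> complex) \<Rightarrow> bool" where
  "schwartz f \<longleftrightarrow>
     (\<exists>D :: nat \<Rightarrow> nat \<Rightarrow> real \<Rightarrow> real \<Rightarrow> complex.
        D 0 0 = f \<and>
        (\<forall>m n x r. ((\<lambda>u. D m n u r) has_vector_derivative D (Suc m) n x r) (at x) \<and>
                   ((\<lambda>u. D m n x u) has_vector_derivative D m (Suc n) x r) (at r)) \<and>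
        (\<forall>m n k l. bounded (range (\<lambda>(x, r). of_real (x ^ k * r ^ l) * D m n x r))))"

(* The measure delta(a - b x) dx for b \<noteq> 0: by the substitution rule, mass 1/|b| at a/b. *)
definition delta_affine :: "real \<Rightarrow> real \<Rightarrow> real measure" where
  "delta_affine a b = density (return borel (a / b)) (\<lambda>_. ennreal (1 / \<bar>b\<bar>))"

lemma integral_delta_affine:
  fixes f :: "real \<Rightarrow> complex"
  assumes "f \<in> borel_measurable borel"
  shows "(LINT x|delta_affine a b. f x) = f (a / b) / of_real \<bar>b\<bar>"
  using assms unfolding delta_affine_def
  by (subst integral_density) (auto simp: integral_return scaleR_conv_of_real field_simps)

(* The distributional kernel J(xf, xi; rf, ri) M(xf)(dxi) dri, with J a function and M xf a
   measure in the variable xi. As for any distribution, the defining relation is imposed on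
   Schwartz functions rho_i (such kernels are automatically trace class); the output is a
   trace-class operator, so its position kernel is determined almost everywhere. *)
definition has_kernel ::
  "(opker \<Rightarrow> opker) \<Rightarrow> (real \<Rightarrow> real measure) \<Rightarrow>
   (real \<Rightarrow> real \<Rightarrow> real \<Rightarrow> real \<Rightarrow> complex) \<Rightarrow> bool" where
  "has_kernel \<Phi> M J \<longleftrightarrow>
     (\<forall>K. trace_class K \<and> schwartz (pos_rep K) \<longrightarrow>
        (AE (xf, rf) in lborel.
           integrable (M xf \<Otimes>\<^sub>M lborel) (\<lambda>(xi, ri). J xf xi rf ri * pos_rep K xi ri) \<and>
           pos_rep (\<Phi> K) xf rf =
             (LINT (xi, ri)|(M xf \<Otimes>\<^sub>M lborel). J xf xi rf ri * pos_rep K xi ri)))"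

end

(* On characteristic functions a Gaussian channel acts by
     chi_out(w) = chi_in(T^T w) exp(- w.N w / 2 - i w.tau),
   but this is given only for Gaussian inputs. The map is bounded in trace norm because it is
   positive and trace preserving, so for a test vector f the defect of the formula is a bounded
   sesquilinear form in (psi, phi) for the inputs |psi><phi|. It vanishes for psi = phi coherent;
   u |-> defect(e_(u+iv), e_(conj u+iv)) is entire and zero on the reals, hence it vanishes on all
   pairs e_(ia), e_(ib), which are total in L2, hence everywhere. Boundedness of the right-hand side
   uses that N is positive semidefinite with N_11 > 0: when T has rank one, squeezed inputs make
   T sigma T^T arbitrarily small, so N inherits det >= 1/4 from the uncertainty principle.
   Transforming back to position space, if T_12 is nonzero one substitutes x_i = T_12 k + T_22 x_f
   (form 1); if T_12 = 0 the k-integral is Gaussian and x_i = T_22 x_f (form 2, with beta = 1).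
   Conversely, a kernel of either form sees the characteristic function of the input only along a
   line, so it cannot separate a coherent state from a suitable displacement d of it, and T d = 0. *)

theory Submission
  imports Defs "HOL-Complex_Analysis.Conformal_Mappings"
begin

text \<open>Trace class is encoded through an arbitrary nuclear decomposition, so neither an
  orthonormal basis nor a spectral or Jordan decomposition is at hand. The trace-norm bound is built
  directly on such families: the diagonal values of a positive operator are bounded by its trace,
  and every trace-class kernel is a combination of four positive ones by polarisation. The bound
  makes matrix elements of the output countably additive along a decomposition and continuous in
  each vector. The candidate output computed from a characteristic function is a bounded kernel not
  known beforehand to be trace class; hence test vectors lie in L1 as well as in L2. For singular T
  the input characteristic function is read only on the range of the transpose of T, at most a line
  and hence a null set. Equality almost everywhere is therefore too weak on the input side; for
  Schwartz inputs continuity in the difference variable gives it pointwise.\<close>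

section \<open>Measurability and the Gaussian integral with a complex linear term\<close>

lemma borel_measurable_cis [measurable (raw)]:
  assumes [measurable]: "f \<in> borel_measurable M"
  shows "(\<lambda>x. cis (f x)) \<in> borel_measurable M"
  unfolding cis_conv_exp by measurable

lemma borel_measurable_cnj [measurable (raw)]:
  assumes "f \<in> borel_measurable M"
  shows "(\<lambda>x. cnj (f x)) \<in> borel_measurable M"
  by (rule measurable_compose[OF assms borel_measurable_continuous_onI]) (intro continuous_intros)

text \<open>Completing the square only in the real part of b keeps the substitution k = \<mu> + c x
  real. What is left is the characteristic function of the standard normal law at w = Im b * c, so
  no contour has to be moved.\<close>

lemma has_bochner_integral_gaussian:
  fixes a :: real and b :: complex
  assumes a: "a > 0"
  shows "has_bochner_integral lborel (\<lambda>k. exp (- of_real (a * k\<^sup>2) + b * of_real k))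
           (of_real (sqrt (pi / a)) * exp (b\<^sup>2 / (4 * of_real a)))"
proof -
  define u v c where "u = Re b" and "v = Im b" and "c = 1 / sqrt (2 * a)"
  have b: "b = of_real u + \<i> * of_real v" by (simp add: u_def v_def complex_eq)
  have c: "c > 0" "c\<^sup>2 = 1 / (2 * a)" using a by (auto simp: c_def power_divide)
  define \<mu> where "\<mu> = u / (2 * a)"
  define w where "w = v * c"
  have 1: "has_bochner_integral lborel
      (\<lambda>x. std_normal_density x *\<^sub>R iexp (w * x)) (of_real (exp (- w\<^sup>2 / 2)))"
    unfolding has_bochner_integral_iff
  proof
    show "integrable lborel (\<lambda>x. std_normal_density x *\<^sub>R iexp (w * x))"
      by (rule Bochner_Integration.integrable_bound[OF integrable_std_normal_moment[of 0]]) auto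
    show "(LINT x|lborel. std_normal_density x *\<^sub>R iexp (w * x)) = of_real (exp (- w\<^sup>2 / 2))"
      using fun_cong[OF char_std_normal_distribution, of w]
      by (simp add: char_def integral_density)
  qed
  have "has_bochner_integral lborel
      (\<lambda>k. exp (- of_real (a * k\<^sup>2) + b * of_real k))
      (of_real c * (of_real (sqrt (2 * pi)) * exp (of_real (a * \<mu>\<^sup>2) + \<i> * of_real (v * \<mu>)) * of_real (exp (- w\<^sup>2 / 2))))"
  proof (subst lborel_has_bochner_integral_real_affine_iff[of c _ _ \<mu>])
    show "c \<noteq> 0" using c by simp
    let ?C = "of_real (sqrt (2 * pi)) * exp (of_real (a * \<mu>\<^sup>2) + \<i> * of_real (v * \<mu>))"
    have eq: "exp (- complex_of_real (a * (\<mu> + c * x)\<^sup>2) + b * of_real (\<mu> + c * x))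
       = ?C * (std_normal_density x *\<^sub>R iexp (w * x))" for x
    proof -
      have "- (a * (\<mu> + c * x)\<^sup>2) + u * (\<mu> + c * x) = a * \<mu>\<^sup>2 - (a * c\<^sup>2) * x\<^sup>2"
        using a by (simp add: \<mu>_def power2_eq_square field_simps)
      also have "\<dots> = a * \<mu>\<^sup>2 - x\<^sup>2 / 2" using a c by simp
      finally have r: "- (a * (\<mu> + c * x)\<^sup>2) + u * (\<mu> + c * x) = a * \<mu>\<^sup>2 - x\<^sup>2 / 2" .
      have "- complex_of_real (a * (\<mu> + c * x)\<^sup>2) + b * of_real (\<mu> + c * x) =
        of_real (- (a * (\<mu> + c * x)\<^sup>2) + u * (\<mu> + c * x)) + \<i> * of_real (v * \<mu> + w * x)"
        by (simp add: b w_def algebra_simps)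
      also have "\<dots> = (of_real (a * \<mu>\<^sup>2) + \<i> * of_real (v * \<mu>)) + of_real (- x\<^sup>2 / 2) + \<i> * of_real (w * x)"
        unfolding r by (simp add: algebra_simps)
      finally have e: "- complex_of_real (a * (\<mu> + c * x)\<^sup>2) + b * of_real (\<mu> + c * x) =
        (of_real (a * \<mu>\<^sup>2) + \<i> * of_real (v * \<mu>)) + of_real (- x\<^sup>2 / 2) + \<i> * of_real (w * x)" .
      show ?thesis
        unfolding e exp_add by (simp add: std_normal_density_def scaleR_conv_of_real flip: exp_of_real)
    qed
    have val: "of_real c * (?C * of_real (exp (- w\<^sup>2 / 2))) /\<^sub>R \<bar>c\<bar> = ?C * of_real (exp (- w\<^sup>2 / 2))"
      using c by (simp add: scaleR_conv_of_real)
    show "has_bochner_integral lborel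
       (\<lambda>x. exp (- complex_of_real (a * (\<mu> + c * x)\<^sup>2) + b * of_real (\<mu> + c * x)))
       (of_real c * (?C * of_real (exp (- w\<^sup>2 / 2))) /\<^sub>R \<bar>c\<bar>)"
      unfolding eq val by (rule has_bochner_integral_mult_right) (rule 1)
  qed
  also have "of_real c * (of_real (sqrt (2 * pi)) * exp (of_real (a * \<mu>\<^sup>2) + \<i> * of_real (v * \<mu>)) * of_real (exp (- w\<^sup>2 / 2)))
     = of_real (c * sqrt (2 * pi)) * exp (of_real (a * \<mu>\<^sup>2 - w\<^sup>2 / 2) + \<i> * of_real (v * \<mu>))"
  proof -
    have e: "of_real (a * \<mu>\<^sup>2 - w\<^sup>2 / 2) + \<i> * of_real (v * \<mu>)
        = (of_real (a * \<mu>\<^sup>2) + \<i> * of_real (v * \<mu>)) + complex_of_real (- w\<^sup>2 / 2)"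
      by simp
    show ?thesis unfolding e exp_add by (simp flip: exp_of_real)
  qed
  also have "c * sqrt (2 * pi) = sqrt (pi / a)"
    using a by (simp add: c_def real_sqrt_mult real_sqrt_divide field_simps)
  also have "of_real (a * \<mu>\<^sup>2 - w\<^sup>2 / 2) + \<i> * of_real (v * \<mu>) = b\<^sup>2 / (4 * of_real a)"
  proof -
    have "w\<^sup>2 = v\<^sup>2 / (2 * a)" by (simp add: w_def power_mult_distrib c)
    then show ?thesis
      using a by (simp add: b \<mu>_def power2_eq_square field_simps)
  qed
  finally show ?thesis .
qed

lemmas integrable_gaussian = has_bochner_integral_gaussian[THEN integrable.intros]
lemmas integral_gaussian = has_bochner_integral_gaussian[THEN has_bochner_integral_integral_eq]

lemma integrable_gaussian_real:
  assumes "(a :: real) > 0"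
  shows "integrable lborel (\<lambda>k. exp (b * k - a * k\<^sup>2))"
  using integrable_norm[OF integrable_gaussian[OF assms, of "of_real b"]]
  by (simp add: algebra_simps)

section \<open>A functional monotone class generated by the characters\<close>

text \<open>Closure under linear combinations and bounded pointwise limits, together with all
  characters, already forces every bounded Borel function into P. The property is abstract because
  it serves twice: for injectivity of the Fourier transform and for totality of the Gaussian
  exponentials in L2.\<close>

locale bounded_monotone_class =
  fixes P :: "(real \<Rightarrow> complex) \<Rightarrow> bool"
  assumes add: "P f \<Longrightarrow> P g \<Longrightarrow> P (\<lambda>x. f x + g x)"
    and scale: "P f \<Longrightarrow> P (\<lambda>x. c * f x)"
    and lim: "(\<And>n. u n \<in> borel_measurable borel) \<Longrightarrow> (\<And>n x. cmod (u n x) \<le> B) \<Longrightarrow>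
      (\<And>x. (\<lambda>n. u n x) \<longlonglongrightarrow> h x) \<Longrightarrow> (\<And>n. P (u n)) \<Longrightarrow> P h"
    and cis: "P (\<lambda>x. cis (v * x))"
begin

lemma cong: "P f \<Longrightarrow> (\<And>x. f x = g x) \<Longrightarrow> P g"
  by (metis ext)

lemma one: "P (\<lambda>x. 1)"
  using cis[of 0] by simp

lemma zero: "P (\<lambda>x. 0)"
  using scale[OF one, of 0] by simp

lemma sum: "(\<And>i. i \<in> A \<Longrightarrow> P (f i)) \<Longrightarrow> P (\<lambda>x. \<Sum>i\<in>A. f i x)"
  by (induction A rule: infinite_finite_induct) (auto intro!: add simp: zero)

text \<open>A factor sin(w x) is a difference of two characters and moves the frequency v to v + w
  and v - w, which is why v stays arbitrary in the induction. The products of generators demanded by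
  a monotone class argument are thus again combinations of generators.\<close>

lemma cis_sin_power: "P (\<lambda>x. cis (v * x) * of_real (sin (w * x)) ^ n)"
proof (induction n arbitrary: v)
  case 0
  then show ?case using cis by simp
next
  case (Suc n)
  let ?f = "\<lambda>x. (1 / (2 * \<i>)) * (cis ((v + w) * x) * of_real (sin (w * x)) ^ n) +
    (- 1 / (2 * \<i>)) * (cis ((v - w) * x) * of_real (sin (w * x)) ^ n)"
  have "P ?f" by (intro add scale Suc)
  moreover have "?f x = cis (v * x) * of_real (sin (w * x)) ^ Suc n" for x
  proof -
    have s: "of_real (sin (w * x)) = (1 / (2 * \<i>)) * (cis (w * x) - cis (- (w * x)))"
      by (simp add: complex_eq_iff)
    have "?f x = (1 / (2 * \<i>)) * (cis (v * x) * cis (w * x) - cis (v * x) * cis (- (w * x))) * of_real (sin (w * x)) ^ n"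
      by (simp add: cis_mult algebra_simps)
    also have "\<dots> = cis (v * x) * of_real (sin (w * x)) * of_real (sin (w * x)) ^ n"
      unfolding s by (simp add: algebra_simps)
    finally show ?thesis by simp
  qed
  ultimately show ?case by (rule cong)
qed

text \<open>The sine maps the line into [-1, 1], where c is a uniform limit of polynomials;
  polynomials in sin(w x) are covered by \<open>cis_sin_power\<close>.\<close>

lemma continuous_sin:
  fixes c :: "real \<Rightarrow> real"
  assumes c: "continuous_on {-1..1} c"
  shows "P (\<lambda>x. of_real (c (sin (w * x))))"
proof -
  have "\<exists>g. real_polynomial_function g \<and> (\<forall>y\<in>{-1..1}. \<bar>c y - g y\<bar> < 1 / Suc n)" for n
    by (rule Stone_Weierstrass_real_polynomial_function[OF _ c, of "1 / Suc n"]) auto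
  then obtain g where g: "\<And>n. real_polynomial_function (g n)"
    "\<And>n y. y \<in> {-1..1} \<Longrightarrow> \<bar>c y - g n y\<bar> < 1 / Suc n" by metis
  have "bounded (c ` {-1..1})"
    by (intro compact_imp_bounded compact_continuous_image c) auto
  then obtain B where B: "\<And>y. y \<in> {-1..1} \<Longrightarrow> \<bar>c y\<bar> \<le> B"
    by (fastforce simp: bounded_iff)
  have s: "sin (w * x) \<in> {-1..1}" for x by auto
  show ?thesis
  proof (rule lim[where u = "\<lambda>n x. of_real (g n (sin (w * x)))" and B = "B + 1"])
    fix n
    have "continuous_on UNIV (g n)"
      using g(1)[of n] by (metis continuous_on_eq_continuous_at continuous_real_polymonial_function open_UNIV)
    then have [measurable]: "g n \<in> borel_measurable borel"
      by (rule borel_measurable_continuous_onI)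
    show "(\<lambda>x. complex_of_real (g n (sin (w * x)))) \<in> borel_measurable borel" by measurable
    obtain a m where "g n = (\<lambda>x. \<Sum>i\<le>m. a i * x ^ i)"
      using g(1)[of n] by (auto simp: real_polynomial_function_iff_sum)
    moreover have "P (\<lambda>x. \<Sum>i\<le>m. of_real (a i) * (cis (0 * x) * of_real (sin (w * x)) ^ i))"
      by (intro sum scale cis_sin_power)
    ultimately show "P (\<lambda>x. of_real (g n (sin (w * x))))" by simp
  next
    fix n x
    have "1 / Suc n \<le> (1 :: real)" by simp
    then show "cmod (of_real (g n (sin (w * x)))) \<le> B + 1"
      using g(2)[OF s[of x], of n] B[OF s[of x]] unfolding norm_of_real by linarith
  next
    fix x
    have "(\<lambda>n. g n (sin (w * x)) - c (sin (w * x))) \<longlonglongrightarrow> 0"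
    proof (rule Lim_null_comparison)
      show "\<forall>\<^sub>F n in sequentially. norm (g n (sin (w * x)) - c (sin (w * x))) \<le> 1 / Suc n"
        using g(2)[OF s[of x]] by (intro always_eventually) (auto simp: abs_minus_commute intro: less_imp_le)
      show "(\<lambda>n. 1 / real (Suc n)) \<longlonglongrightarrow> 0"
        using LIMSEQ_Suc[OF lim_1_over_n] by simp
    qed
    then show "(\<lambda>n. complex_of_real (g n (sin (w * x)))) \<longlonglongrightarrow> of_real (c (sin (w * x)))"
      by (intro tendsto_of_real) (simp add: LIM_zero_iff)
  qed
qed

text \<open>Two nested limits. The inner one uses m sin(x / m) \<rightarrow> x to pass from
  functions of a sine to functions of x itself; the outer one steepens a ramp that equals 1 up to b
  and falls to 0 behind it.\<close>

lemma indicator_atMost: "P (\<lambda>x. indicator {..b} x)"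
proof (rule lim[where u = "\<lambda>n x. of_real (max 0 (min 1 (1 + real n * (b - x))))" and B = 1])
  fix n :: nat
  show "(\<lambda>x. complex_of_real (max 0 (min 1 (1 + real n * (b - x))))) \<in> borel_measurable borel"
    by measurable
  let ?c = "\<lambda>y. max 0 (min 1 (1 + real n * (b - y)))"
  show "P (\<lambda>x. of_real (?c x))"
  proof (rule lim[where u = "\<lambda>m x. of_real (?c (real (Suc m) * sin (1 / Suc m * x)))" and B = 1])
    fix m
    show "(\<lambda>x. complex_of_real (?c (real (Suc m) * sin (1 / Suc m * x)))) \<in> borel_measurable borel"
      by measurable
    show "P (\<lambda>x. of_real (?c (real (Suc m) * sin (1 / Suc m * x))))"
      by (rule continuous_sin[of "\<lambda>y. ?c (real (Suc m) * y)"]) (intro continuous_intros)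
  next
    fix x :: real
    have "(\<lambda>m. real (Suc m) * sin (1 / Suc m * x)) \<longlonglongrightarrow> x"
      by real_asymp
    then have "(\<lambda>m. ?c (real (Suc m) * sin (1 / Suc m * x))) \<longlonglongrightarrow> ?c x"
      by (intro tendsto_intros)
    then show "(\<lambda>m. complex_of_real (?c (real (Suc m) * sin (1 / Suc m * x)))) \<longlonglongrightarrow> of_real (?c x)"
      by (rule tendsto_of_real)
  qed simp
next
  fix x :: real
  have "(\<lambda>n. max 0 (min 1 (1 + real n * (b - x)))) \<longlonglongrightarrow> indicator {..b} x"
  proof (cases "x \<le> b")
    case True
    then have "max 0 (min 1 (1 + real n * (b - x))) = 1" for n by simp
    then show ?thesis using True by simp
  next
    case False
    then have "b - x < 0" by simp
    then have "\<forall>\<^sub>F n in sequentially. 1 + real n * (b - x) < 0" by real_asymp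
    then have "\<forall>\<^sub>F n in sequentially. max 0 (min 1 (1 + real n * (b - x))) = 0"
      by eventually_elim simp
    then show ?thesis using False by (simp add: tendsto_eventually)
  qed
  moreover have "of_real (indicator {..b} x) = (indicator {..b} x :: complex)"
    by (simp add: indicator_def)
  ultimately
  show "(\<lambda>n. complex_of_real (max 0 (min 1 (1 + real n * (b - x))))) \<longlonglongrightarrow> indicator {..b} x"
    by (metis tendsto_of_real)
qed simp

lemma indicator_borel:
  assumes "A \<in> sets borel"
  shows "P (indicator A)"
proof -
  have "A \<in> sigma_sets UNIV (range atMost)"
    using assms by (simp add: borel_eq_atMost)
  then show ?thesis
  proof (rule sigma_sets_induct_disjoint[rotated 2])
    show "Int_stable (range (atMost :: real \<Rightarrow> _))"
      by (auto simp: Int_stable_def)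
    fix A :: "real set" assume "A \<in> range atMost"
    then show "P (indicator A)" using indicator_atMost by auto
  next
    show "P (indicator {})" by (rule cong[OF zero]) simp
  next
    fix A assume "P (indicator A)"
    then have "P (\<lambda>x. 1 + (-1) * indicator A x)" by (intro add one scale)
    then show "P (indicator (UNIV - A))"
      by (rule cong) (auto simp: indicator_def)
  next
    fix A :: "nat \<Rightarrow> real set"
    assume A: "disjoint_family A" "range A \<subseteq> sigma_sets UNIV (range atMost)" "\<And>i. P (indicator (A i))"
    have [measurable]: "A i \<in> sets borel" for i using A(2) by (auto simp: borel_eq_atMost)
    have sum_eq: "(\<Sum>i<n. indicator (A i) x) = (indicator (\<Union>i<n. A i) x :: complex)" for n x
      by (rule indicator_UN_disjoint[symmetric]) (use A(1) in \<open>auto simp: disjoint_family_on_def\<close>)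
    show "P (indicator (\<Union> (range A)))"
    proof (rule lim[where u = "\<lambda>n. indicator (\<Union>i<n. A i)" and B = 1])
      show "P (indicator (\<Union>i<n. A i))" for n
        using sum[of "{..<n}" "\<lambda>i. indicator (A i)"] A(3) by (simp add: sum_eq)
      show "(\<lambda>n. indicator (\<Union>i<n. A i) x) \<longlonglongrightarrow> (indicator (\<Union> (range A)) x :: complex)" for x
        by (rule LIMSEQ_indicator_UN)
    qed (auto simp: indicator_def)
  qed auto
qed

lemma bounded_measurable:
  assumes h: "h \<in> borel_measurable borel" and B: "\<And>x. cmod (h x) \<le> B"
  shows "P h"
proof -
  obtain F where F: "\<And>i. simple_function borel (F i)" "\<And>x. (\<lambda>i. F i x) \<longlonglongrightarrow> h x"
     "\<And>i x. dist (F i x) 0 \<le> 2 * dist (h x) 0"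
    using borel_measurable_implies_sequence_metric[OF h, of 0] by auto
  show ?thesis
  proof (rule lim[of F "2 * B"])
    show "F n \<in> borel_measurable borel" for n
      using F(1) by (rule borel_measurable_simple_function)
    show "cmod (F n x) \<le> 2 * B" for n x
      using F(3)[of n x] B[of x] by simp
    show "P (F n)" for n
    proof (rule cong)
      show "P (\<lambda>x. \<Sum>y\<in>range (F n). y * indicator (F n -` {y}) x)"
        using simple_functionD(2)[OF F(1)] by (intro sum scale indicator_borel) simp
      show "(\<Sum>y\<in>range (F n). y * indicator (F n -` {y}) x) = F n x" for x
      proof -
        have fin: "finite (range (F n))" using simple_functionD(1)[OF F(1)[of n]] by simp
        have "(\<Sum>y\<in>range (F n). y * indicator (F n -` {y}) x) = (\<Sum>y\<in>range (F n). if y = F n x then y else 0)"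
          by (intro sum.cong) (auto simp: indicator_def)
        then show ?thesis using fin by simp
      qed
    qed
  qed (rule F(2))
qed

end

section \<open>Injectivity of the Fourier transform on integrable functions\<close>

lemma AE_zero_of_fourier_zero:
  fixes f :: "real \<Rightarrow> complex"
  assumes f: "integrable lborel f" and z: "\<And>v. (LINT x|lborel. f x * cis (v * x)) = 0"
  shows "AE x in lborel. f x = 0"
proof -
  have fm [measurable]: "f \<in> borel_measurable borel" using f by auto
  have int: "integrable lborel (\<lambda>x. f x * h x)"
    if [measurable]: "h \<in> borel_measurable borel" and "\<And>x. cmod (h x) \<le> B" for h :: "real \<Rightarrow> complex" and B
    by (rule Bochner_Integration.integrable_bound[OF integrable_mult_left[OF integrable_norm[OF f], of B]])
       (use that in \<open>auto simp: norm_mult intro!: AE_I2 mult_left_mono intro: order_trans[OF _ abs_ge_self]\<close>)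
  define Q where "Q h \<longleftrightarrow> integrable lborel (\<lambda>x. f x * h x) \<and> (LINT x|lborel. f x * h x) = 0" for h :: "real \<Rightarrow> complex"
  interpret bounded_monotone_class Q
  proof
    fix u h B
    assume u: "\<And>n. u n \<in> borel_measurable borel" "\<And>n x. cmod (u n x) \<le> B"
      "\<And>x. (\<lambda>n. u n x) \<longlonglongrightarrow> h x" "\<And>n. Q (u n)"
    have hm[measurable]: "h \<in> borel_measurable borel" using u(3,1) by (rule borel_measurable_LIMSEQ_metric[rotated])
    note u(1)[measurable]
    have hB: "cmod (h x) \<le> B" for x
      using u(2,3) by (intro LIMSEQ_le_const2[OF tendsto_norm[OF u(3)]]) auto
    have "(\<lambda>n. LINT x|lborel. f x * u n x) \<longlonglongrightarrow> (LINT x|lborel. f x * h x)"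
      by (rule integral_dominated_convergence[where w = "\<lambda>x. norm (f x) * B"])
         (use f u in \<open>auto simp: norm_mult intro!: mult_left_mono tendsto_intros\<close>)
    then show "Q h" using u(4) int[OF hm hB] by (simp add: Q_def LIMSEQ_const_iff)
  qed (use int[of "\<lambda>x. cis (_ * x)" 1] z in \<open>auto simp: Q_def algebra_simps\<close>)
  \<comment> \<open>A bounded multiple of the conjugate of f, so that f times it is nonnegative and
    vanishes exactly where f does. Dividing by 1 + |f| avoids any assumption that f is square
    integrable.\<close>
  let ?h = "\<lambda>x. cnj (f x) / of_real (1 + cmod (f x))"
  have b: "cmod (?h x) \<le> 1" for x
    unfolding norm_divide norm_of_real complex_mod_cnj by (subst divide_le_eq_1_pos) (auto intro: add_pos_nonneg)
  have "Q ?h" by (rule bounded_measurable[OF _ b]) measurable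
  moreover have e: "f x * ?h x = of_real ((cmod (f x))\<^sup>2 / (1 + cmod (f x)))" for x
    using complex_norm_square[of "f x"] by simp
  ultimately have "integrable lborel (\<lambda>x. (cmod (f x))\<^sup>2 / (1 + cmod (f x)))"
    "(LINT x|lborel. (cmod (f x))\<^sup>2 / (1 + cmod (f x))) = 0"
    unfolding Q_def e by (simp_all add: complex_of_real_integrable_eq del: of_real_divide of_real_power)
  then have "AE x in lborel. (cmod (f x))\<^sup>2 / (1 + cmod (f x)) = 0"
    by (subst (asm) integral_nonneg_eq_0_iff_AE) (auto intro!: divide_nonneg_nonneg)
  then show ?thesis
  proof eventually_elim
    case (elim x)
    have "1 + cmod (f x) > 0" by (simp add: add_pos_nonneg)
    then show ?case using elim by simp
  qed
qed

lemma fourier_unique: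
  fixes f g :: "real \<Rightarrow> complex"
  assumes f: "integrable lborel f" and g: "integrable lborel g"
    and eq: "\<And>v. (LINT x|lborel. f x * cis (v * x)) = (LINT x|lborel. g x * cis (v * x))"
  shows "AE x in lborel. f x = g x"
proof -
  have "integrable lborel (\<lambda>x. h x * cis (v * x))" if "integrable lborel h" for h :: "real \<Rightarrow> complex" and v
    by (rule Bochner_Integration.integrable_bound[OF that]) (use that in \<open>auto simp: norm_mult\<close>)
  with AE_zero_of_fourier_zero[of "\<lambda>x. f x - g x"] assms show ?thesis
    by (simp add: left_diff_distrib)
qed

section \<open>Square-integrable functions, inner product and norm\<close>

definition ip :: "(real \<Rightarrow> complex) \<Rightarrow> (real \<Rightarrow> complex) \<Rightarrow> complex" where
  "ip f g = (LINT q|lborel. cnj (f q) * g q)"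

lemma L2_fun_measurable [measurable_dest]: "L2_fun f \<Longrightarrow> f \<in> borel_measurable borel"
  by (simp add: L2_fun_def)

lemma L2_fun_integrable: "L2_fun f \<Longrightarrow> integrable lborel (\<lambda>q. (cmod (f q))\<^sup>2)"
  by (simp add: L2_fun_def)

lemma L2_norm_nonneg [simp]: "0 \<le> L2_norm f"
  by (simp add: L2_norm_def)

lemma L2_norm_power2: "(L2_norm f)\<^sup>2 = (LINT q|lborel. (cmod (f q))\<^sup>2)"
  by (simp add: L2_norm_def)

lemma L2_fun_bound:
  assumes "L2_fun f" and [measurable]: "g \<in> borel_measurable borel" and "\<And>q. cmod (g q) \<le> cmod (f q)"
  shows "L2_fun g"
  unfolding L2_fun_def
proof
  show "integrable lborel (\<lambda>q. (cmod (g q))\<^sup>2)"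
    by (rule Bochner_Integration.integrable_bound[OF L2_fun_integrable[OF assms(1)]])
       (use assms in \<open>auto intro: power_mono\<close>)
qed fact

lemma L2_fun_zero [simp]: "L2_fun (\<lambda>q. 0)"
  by (simp add: L2_fun_def)

lemma L2_norm_zero [simp]: "L2_norm (\<lambda>q. 0) = 0"
  by (simp add: L2_norm_def)

lemma L2_fun_cmult: "L2_fun f \<Longrightarrow> L2_fun (\<lambda>q. c * f q)"
  by (auto simp: L2_fun_def norm_mult power_mult_distrib)

lemma L2_norm_cmult: "L2_norm (\<lambda>q. c * f q) = cmod c * L2_norm f"
  by (simp add: L2_norm_def norm_mult power_mult_distrib real_sqrt_mult)

lemma L2_fun_cnj: "L2_fun f \<Longrightarrow> L2_fun (\<lambda>q. cnj (f q))"
  by (auto simp: L2_fun_def)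

lemma L2_norm_cnj [simp]: "L2_norm (\<lambda>q. cnj (f q)) = L2_norm f"
  by (simp add: L2_norm_def)

lemma L2_mult_integrable:
  assumes "L2_fun f" "L2_fun g"
  shows "integrable lborel (\<lambda>q. f q * g q)"
proof (rule Bochner_Integration.integrable_bound)
  note assms[measurable]
  show "integrable lborel (\<lambda>q. (cmod (f q))\<^sup>2 + (cmod (g q))\<^sup>2)"
    by (intro Bochner_Integration.integrable_add L2_fun_integrable assms)
  show "(\<lambda>q. f q * g q) \<in> borel_measurable lborel" by measurable
  have "a * b \<le> a\<^sup>2 + b\<^sup>2" for a b :: real
  proof -
    have "a\<^sup>2 + b\<^sup>2 - a * b = ((a - b)\<^sup>2 + a\<^sup>2 + b\<^sup>2) / 2"
      by (simp add: power2_eq_square algebra_simps)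
    also have "\<dots> \<ge> 0" by simp
    finally show ?thesis by simp
  qed
  then show "AE q in lborel. cmod (f q * g q) \<le> norm ((cmod (f q))\<^sup>2 + (cmod (g q))\<^sup>2)"
    by (auto simp: norm_mult)
qed

lemma L2_fun_add:
  assumes "L2_fun f" "L2_fun g"
  shows "L2_fun (\<lambda>q. f q + g q)"
  unfolding L2_fun_def
proof
  note assms[measurable]
  show "(\<lambda>q. f q + g q) \<in> borel_measurable borel" by measurable
  show "integrable lborel (\<lambda>q. (cmod (f q + g q))\<^sup>2)"
  proof (rule Bochner_Integration.integrable_bound)
    show "integrable lborel (\<lambda>q. 2 * (cmod (f q))\<^sup>2 + 2 * (cmod (g q))\<^sup>2)"
      by (intro Bochner_Integration.integrable_add integrable_mult_right L2_fun_integrable assms)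
    show "AE q in lborel. norm ((cmod (f q + g q))\<^sup>2) \<le> norm (2 * (cmod (f q))\<^sup>2 + 2 * (cmod (g q))\<^sup>2)"
    proof (rule AE_I2)
      fix q
      have "(cmod (f q + g q))\<^sup>2 \<le> (cmod (f q) + cmod (g q))\<^sup>2"
        by (intro power_mono norm_triangle_ineq) auto
      also have "\<dots> \<le> 2 * (cmod (f q))\<^sup>2 + 2 * (cmod (g q))\<^sup>2"
        using zero_le_power2[of "cmod (f q) - cmod (g q)"] by (simp add: power2_diff power2_sum)
      finally show "norm ((cmod (f q + g q))\<^sup>2) \<le> norm (2 * (cmod (f q))\<^sup>2 + 2 * (cmod (g q))\<^sup>2)" by simp
    qed
  qed measurable
qed

lemma L2_fun_diff: "L2_fun f \<Longrightarrow> L2_fun g \<Longrightarrow> L2_fun (\<lambda>q. f q - g q)"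
  using L2_fun_add[of f "\<lambda>q. - 1 * g q"] L2_fun_cmult[of g "-1"] by simp

lemma L2_fun_bounded_mult:
  assumes "L2_fun f" and [measurable]: "h \<in> borel_measurable borel" and "\<And>q. cmod (h q) \<le> B"
  shows "L2_fun (\<lambda>q. h q * f q)"
proof (rule L2_fun_bound[OF L2_fun_cmult[OF assms(1), of "of_real B"]])
  note assms(1)[measurable]
  show "(\<lambda>q. h q * f q) \<in> borel_measurable borel" by measurable
  show "cmod (h q * f q) \<le> cmod (of_real B * f q)" for q
    using assms(3)[of q] by (auto simp: norm_mult intro!: mult_right_mono)
qed

lemma L2_norm_zero_AE:
  assumes "L2_fun f" "L2_norm f = 0"
  shows "AE q in lborel. f q = 0"
  using assms integral_nonneg_eq_0_iff_AE[OF L2_fun_integrable[OF assms(1)]]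
  by (simp add: L2_norm_def)

lemma Cauchy_Schwarz_L2:
  assumes f: "L2_fun f" and g: "L2_fun g"
  shows "(LINT q|lborel. cmod (f q) * cmod (g q)) \<le> L2_norm f * L2_norm g"
proof -
  have z: "(LINT q|lborel. cmod (f q) * cmod (g q)) = 0"
    if "L2_norm f = 0 \<or> L2_norm g = 0"
  proof -
    from that have "AE q in lborel. cmod (f q) * cmod (g q) = 0"
      using L2_norm_zero_AE f g by fastforce
    then show ?thesis by (rule integral_eq_zero_AE)
  qed
  show ?thesis
  proof (cases "L2_norm f = 0 \<or> L2_norm g = 0")
    case True
    then show ?thesis using z by auto
  next
    case False
    then have pos: "L2_norm f > 0" "L2_norm g > 0"
      using L2_norm_nonneg[of f] L2_norm_nonneg[of g] by linarith+
    \<comment> \<open>The weight for which the arithmetic-geometric mean bound t |f|^2 / 2 + |g|^2 /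
      (2 t) integrates to exactly the product of the norms.\<close>
    define t where "t = L2_norm g / L2_norm f"
    have t: "t > 0" using pos by (simp add: t_def)
    have "(LINT q|lborel. cmod (f q) * cmod (g q)) \<le>
        (LINT q|lborel. (t / 2) * (cmod (f q))\<^sup>2 + (1 / (2 * t)) * (cmod (g q))\<^sup>2)"
    proof (rule integral_mono)
      show "integrable lborel (\<lambda>q. cmod (f q) * cmod (g q))"
        using integrable_norm[OF L2_mult_integrable[OF f g]] by (simp add: norm_mult)
      fix q
      have "0 \<le> (t * cmod (f q) - cmod (g q))\<^sup>2 / (2 * t)" using t by simp
      also have "\<dots> = (t / 2) * (cmod (f q))\<^sup>2 + (1 / (2 * t)) * (cmod (g q))\<^sup>2 - cmod (f q) * cmod (g q)"
        using t by (simp add: power2_diff field_simps power2_eq_square)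
      finally show "cmod (f q) * cmod (g q) \<le> (t / 2) * (cmod (f q))\<^sup>2 + (1 / (2 * t)) * (cmod (g q))\<^sup>2"
        by simp
    qed (intro Bochner_Integration.integrable_add integrable_mult_right L2_fun_integrable f g)
    also have "\<dots> = (t / 2) * (L2_norm f)\<^sup>2 + (1 / (2 * t)) * (L2_norm g)\<^sup>2"
      by (subst Bochner_Integration.integral_add)
         (auto intro!: integrable_mult_right L2_fun_integrable f g simp: L2_norm_power2)
    also have "\<dots> = L2_norm f * L2_norm g"
      using pos by (simp add: t_def power2_eq_square)
    finally show ?thesis .
  qed
qed

lemma ip_integrable: "L2_fun f \<Longrightarrow> L2_fun g \<Longrightarrow> integrable lborel (\<lambda>q. cnj (f q) * g q)"
  by (intro L2_mult_integrable L2_fun_cnj)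

lemma norm_ip_le:
  assumes "L2_fun f" "L2_fun g"
  shows "cmod (ip f g) \<le> L2_norm f * L2_norm g"
proof -
  have "cmod (ip f g) \<le> (LINT q|lborel. cmod (f q) * cmod (g q))"
    using integral_norm_bound[of lborel "\<lambda>q. cnj (f q) * g q"] by (simp add: ip_def norm_mult)
  also have "\<dots> \<le> L2_norm f * L2_norm g" by (rule Cauchy_Schwarz_L2[OF assms])
  finally show ?thesis .
qed

lemma ip_add_right: "L2_fun f \<Longrightarrow> L2_fun g \<Longrightarrow> L2_fun h \<Longrightarrow> ip f (\<lambda>q. g q + h q) = ip f g + ip f h"
  by (simp add: ip_def distrib_left ip_integrable)

lemma ip_add_left: "L2_fun f \<Longrightarrow> L2_fun g \<Longrightarrow> L2_fun h \<Longrightarrow> ip (\<lambda>q. g q + h q) f = ip g f + ip h f"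
  by (simp add: ip_def distrib_right ip_integrable)

lemma ip_diff_right: "L2_fun f \<Longrightarrow> L2_fun g \<Longrightarrow> L2_fun h \<Longrightarrow> ip f (\<lambda>q. g q - h q) = ip f g - ip f h"
  by (simp add: ip_def right_diff_distrib ip_integrable)

lemma ip_diff_left: "L2_fun f \<Longrightarrow> L2_fun g \<Longrightarrow> L2_fun h \<Longrightarrow> ip (\<lambda>q. g q - h q) f = ip g f - ip h f"
  by (simp add: ip_def left_diff_distrib ip_integrable)

lemma ip_cmult_right: "ip f (\<lambda>q. c * g q) = c * ip f g"
  by (simp add: ip_def mult.left_commute)

lemma ip_cmult_left: "ip (\<lambda>q. c * f q) g = cnj c * ip f g"
  by (simp add: ip_def mult.assoc)

lemma cnj_ip: "cnj (ip f g) = ip g f"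
  by (simp add: ip_def mult.commute flip: Bochner_Integration.integral_cnj)

lemma ip_self: "ip f f = of_real ((L2_norm f)\<^sup>2)"
proof -
  have "cnj (f q) * f q = of_real ((cmod (f q))\<^sup>2)" for q
    by (metis complex_norm_square mult.commute)
  then show ?thesis by (simp add: ip_def L2_norm_power2 del: of_real_power)
qed

lemma L2_norm_add_le:
  assumes "L2_fun f" "L2_fun g"
  shows "L2_norm (\<lambda>q. f q + g q) \<le> L2_norm f + L2_norm g"
proof (rule power2_le_imp_le)
  have "of_real ((L2_norm (\<lambda>q. f q + g q))\<^sup>2) = ip f f + ip f g + ip g f + ip g g"
    using assms by (simp add: ip_self[symmetric] ip_add_left ip_add_right L2_fun_add del: of_real_power)
  then have "(L2_norm (\<lambda>q. f q + g q))\<^sup>2 = Re (ip f f + ip f g + ip g f + ip g g)"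
    by (metis Re_complex_of_real)
  also have "\<dots> = (L2_norm f)\<^sup>2 + Re (ip f g) + Re (ip g f) + (L2_norm g)\<^sup>2"
    by (simp add: ip_self del: of_real_power)
  also have "\<dots> \<le> (L2_norm f)\<^sup>2 + L2_norm f * L2_norm g + L2_norm g * L2_norm f + (L2_norm g)\<^sup>2"
    by (intro add_mono order_trans[OF complex_Re_le_cmod norm_ip_le] assms order_refl)
  finally show "(L2_norm (\<lambda>q. f q + g q))\<^sup>2 \<le> (L2_norm f + L2_norm g)\<^sup>2"
    by (simp add: power2_sum)
qed simp

lemma L2_norm_dominated:
  assumes u [measurable]: "\<And>n. u n \<in> borel_measurable borel" "f \<in> borel_measurable borel"
    and w: "L2_fun w" and le: "\<And>n q. cmod (u n q) \<le> cmod (w q)" and lim: "\<And>q. (\<lambda>n. u n q) \<longlonglongrightarrow> f q"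
  shows "(\<lambda>n. L2_norm (\<lambda>q. u n q - f q)) \<longlonglongrightarrow> 0"
proof -
  have fw: "cmod (f q) \<le> cmod (w q)" for q
    using le by (intro LIMSEQ_le_const2[OF tendsto_norm[OF lim]]) auto
  have "(\<lambda>n. LINT q|lborel. (cmod (u n q - f q))\<^sup>2) \<longlonglongrightarrow> (LINT q::real|lborel. (0::real))"
  proof (rule integral_dominated_convergence[where w = "\<lambda>q. 4 * (cmod (w q))\<^sup>2"])
    show "integrable lborel (\<lambda>q. 4 * (cmod (w q))\<^sup>2)"
      by (intro integrable_mult_right L2_fun_integrable w)
    show "AE q in lborel. (\<lambda>n. (cmod (u n q - f q))\<^sup>2) \<longlonglongrightarrow> 0"
    proof (rule AE_I2)
      fix q
      have "(\<lambda>n. (cmod (u n q - f q))\<^sup>2) \<longlonglongrightarrow> (cmod (f q - f q))\<^sup>2"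
        by (intro tendsto_intros lim)
      then show "(\<lambda>n. (cmod (u n q - f q))\<^sup>2) \<longlonglongrightarrow> 0" by simp
    qed
    show "AE q in lborel. norm ((cmod (u n q - f q))\<^sup>2) \<le> 4 * (cmod (w q))\<^sup>2" for n
    proof (rule AE_I2)
      fix q
      have "(cmod (u n q - f q))\<^sup>2 \<le> (2 * cmod (w q))\<^sup>2"
        using norm_triangle_ineq4[of "u n q" "f q"] le[of n q] fw[of q] by (intro power_mono) auto
      then show "norm ((cmod (u n q - f q))\<^sup>2) \<le> 4 * (cmod (w q))\<^sup>2"
        by (simp add: power_mult_distrib)
    qed
  qed measurable
  from tendsto_real_sqrt[OF this] show ?thesis by (simp add: L2_norm_def)
qed

section \<open>Gaussian exponentials and their totality in L2\<close>

text \<open>The wave function of a coherent state with mean position Re s and mean momentum Im s. It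
  is left unnormalised because the normalising factor depends on Re s alone and would destroy
  holomorphy in s.\<close>

definition gexp :: "complex \<Rightarrow> real \<Rightarrow> complex" where
  "gexp s q = exp (s * of_real q - of_real (q\<^sup>2 / 2))"

lemma borel_measurable_gexp [measurable (raw)]:
  assumes [measurable]: "f \<in> borel_measurable M" "g \<in> borel_measurable M"
  shows "(\<lambda>x. gexp (f x) (g x)) \<in> borel_measurable M"
  unfolding gexp_def by measurable

lemma norm_gexp: "cmod (gexp s q) = exp (Re s * q - q\<^sup>2 / 2)"
  by (simp add: gexp_def)

lemma L2_fun_gexp: "L2_fun (gexp s)"
  unfolding L2_fun_def
proof
  show "gexp s \<in> borel_measurable borel" by measurable
  have "(cmod (gexp s q))\<^sup>2 = exp (2 * Re s * q - 1 * q\<^sup>2)" for q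
    by (simp add: norm_gexp power2_eq_square field_simps flip: exp_add)
  then show "integrable lborel (\<lambda>q. (cmod (gexp s q))\<^sup>2)"
    using integrable_gaussian_real[of 1 "2 * Re s"] by simp
qed

text \<open>Multiplying by the fixed Gaussian \<open>gexp 0\<close> turns characters into
  \<open>gexp (\<i> * of_real v)\<close> and bounded pointwise convergence into L2 convergence.
  Hence the monotone class argument reaches h * \<open>gexp 0\<close> for every bounded Borel h, and
  such products are dense. Totality is phrased as an induction rule, which needs no notion of closed
  span.\<close>

lemma L2_gexp_induct:
  assumes add: "\<And>f g. L2_fun f \<Longrightarrow> L2_fun g \<Longrightarrow> S f \<Longrightarrow> S g \<Longrightarrow> S (\<lambda>x. f x + g x)"
    and scale: "\<And>c f. L2_fun f \<Longrightarrow> S f \<Longrightarrow> S (\<lambda>x. c * f x)"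
    and L2lim: "\<And>u f. (\<And>n. L2_fun (u n)) \<Longrightarrow> L2_fun f \<Longrightarrow> (\<And>n. S (u n)) \<Longrightarrow>
      (\<lambda>n. L2_norm (\<lambda>x. u n x - f x)) \<longlonglongrightarrow> 0 \<Longrightarrow> S f"
    and gen: "\<And>v. S (gexp (\<i> * of_real v))"
    and f: "L2_fun f"
  shows "S f"
proof -
  define Q where "Q h \<longleftrightarrow> L2_fun (\<lambda>q. h q * gexp 0 q) \<and> S (\<lambda>q. h q * gexp 0 q)" for h :: "real \<Rightarrow> complex"
  interpret bounded_monotone_class Q
  proof
    fix f g assume "Q f" "Q g"
    then show "Q (\<lambda>x. f x + g x)"
      using add[of "\<lambda>q. f q * gexp 0 q" "\<lambda>q. g q * gexp 0 q"] L2_fun_add[of "\<lambda>q. f q * gexp 0 q" "\<lambda>q. g q * gexp 0 q"]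
      by (simp add: Q_def distrib_right)
  next
    fix f c assume "Q f"
    then show "Q (\<lambda>x. c * f x)"
      using scale[of "\<lambda>q. f q * gexp 0 q" c] L2_fun_cmult[of "\<lambda>q. f q * gexp 0 q" c]
      by (simp add: Q_def mult.assoc)
  next
    fix v
    have "cis (v * q) * gexp 0 q = gexp (\<i> * of_real v) q" for q
      by (simp add: gexp_def cis_conv_exp algebra_simps flip: exp_add)
    then show "Q (\<lambda>x. cis (v * x))" by (simp add: Q_def gen L2_fun_gexp)
  next
    fix u h B
    assume u: "\<And>n. u n \<in> borel_measurable borel" "\<And>n x. cmod (u n x) \<le> B"
      "\<And>x. (\<lambda>n. u n x) \<longlonglongrightarrow> h x" "\<And>n. Q (u n)"
    have hm[measurable]: "h \<in> borel_measurable borel" using u(3,1) by (rule borel_measurable_LIMSEQ_metric[rotated])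
    note u(1)[measurable]
    have hB: "cmod (h x) \<le> B" for x
      using u(2,3) by (intro LIMSEQ_le_const2[OF tendsto_norm[OF u(3)]]) auto
    have L: "L2_fun (\<lambda>q. h q * gexp 0 q)"
      by (rule L2_fun_bounded_mult[OF L2_fun_gexp hm hB])
    moreover have "S (\<lambda>q. h q * gexp 0 q)"
    proof (rule L2lim[OF _ L])
      show "(\<lambda>n. L2_norm (\<lambda>x. u n x * gexp 0 x - h x * gexp 0 x)) \<longlonglongrightarrow> 0"
      proof (rule L2_norm_dominated[OF _ _ L2_fun_cmult[OF L2_fun_gexp, of "of_real B" 0]])
        show "cmod (u n q * gexp 0 q) \<le> cmod (of_real B * gexp 0 q)" for n q
          using u(2)[of n q] by (auto simp: norm_mult intro!: mult_right_mono)
        show "(\<lambda>n. u n q * gexp 0 q) \<longlonglongrightarrow> h q * gexp 0 q" for q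
          by (intro tendsto_intros u)
      qed measurable
    qed (use u(4) in \<open>auto simp: Q_def\<close>)
    ultimately show "Q h" by (simp add: Q_def)
  qed
  note f[measurable]
  \<comment> \<open>Truncating the quotient f / \<open>gexp 0\<close>, not f, makes each h n
    bounded, while h n * \<open>gexp 0\<close> stays dominated by |f| and equals f pointwise from
    some n on.\<close>
  define h where "h n q = (if cmod (f q / gexp 0 q) \<le> real n then f q / gexp 0 q else 0)" for n q
  have [measurable]: "h n \<in> borel_measurable borel" for n unfolding h_def by measurable
  have nz: "gexp 0 q \<noteq> 0" for q by (simp add: gexp_def)
  have Qh: "Q (h n)" for n
    by (rule bounded_measurable[of _ "real n"]) (auto simp: h_def)
  show "S f"
  proof (rule L2lim[of "\<lambda>n q. h n q * gexp 0 q", OF _ f])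
    show "(\<lambda>n. L2_norm (\<lambda>x. h n x * gexp 0 x - f x)) \<longlonglongrightarrow> 0"
    proof (rule L2_norm_dominated[OF _ _ f])
      show "cmod (h n q * gexp 0 q) \<le> cmod (f q)" for n q
        using nz[of q] by (auto simp: h_def norm_mult norm_divide)
      show "(\<lambda>n. h n q * gexp 0 q) \<longlonglongrightarrow> f q" for q
      proof (rule tendsto_eventually)
        obtain m :: nat where "cmod (f q / gexp 0 q) \<le> real m" using real_arch_simple by blast
        then have "\<forall>n\<ge>m. h n q * gexp 0 q = f q" using nz[of q] by (auto simp: h_def)
        then show "\<forall>\<^sub>F n in sequentially. h n q * gexp 0 q = f q"
          by (auto simp: eventually_sequentially)
      qed
    qed measurable
  qed (use Qh in \<open>auto simp: Q_def\<close>)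
qed

subsection \<open>Nuclear families\<close>

lemma borel_measurable_fst [measurable]: "fst \<in> borel_measurable (borel :: (real \<times> real) measure)"
  and borel_measurable_snd [measurable]: "snd \<in> borel_measurable (borel :: (real \<times> real) measure)"
  by (intro borel_measurable_continuous_onI continuous_intros)+

lemma
  fixes f g :: "real \<Rightarrow> 'a :: {real_normed_field, banach, second_countable_topology}"
  assumes f: "integrable lborel f" and g: "integrable lborel g"
  shows integrable_lborel_prod: "integrable lborel (\<lambda>(x, y). f x * g y)"
    and integral_lborel_prod: "(LINT (x, y)|lborel. f x * g y) = (LINT x|lborel. f x) * (LINT y|lborel. g y)"
proof -
  have [measurable]: "f \<in> borel_measurable borel" "g \<in> borel_measurable borel" using f g by auto
  have *: "integrable (lborel \<Otimes>\<^sub>M lborel) (\<lambda>p. f (fst p) * g (snd p))"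
  proof (rule lborel_pair.Fubini_integrable)
    show "integrable lborel (\<lambda>x. LINT y|lborel. norm (f (fst (x, y)) * g (snd (x, y))))"
      using f by (simp add: norm_mult integrable_mult_left)
    show "AE x in lborel. integrable lborel (\<lambda>y. f (fst (x, y)) * g (snd (x, y)))"
      using g by simp
  qed measurable
  then show "integrable lborel (\<lambda>(x, y). f x * g y)"
    by (simp add: lborel_prod case_prod_unfold)
  show "(LINT (x, y)|lborel. f x * g y) = (LINT x|lborel. f x) * (LINT y|lborel. g y)"
    using lborel_pair.integral_fst'[OF *] by (simp add: lborel_prod case_prod_unfold)
qed

lemma AE_summable_integral:
  fixes f :: "nat \<Rightarrow> 'a \<Rightarrow> real"
  assumes int: "\<And>n. integrable M (f n)" and nonneg: "\<And>n x. 0 \<le> f n x"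
    and sm: "summable (\<lambda>n. LINT x|M. f n x)"
  shows "AE x in M. summable (\<lambda>n. f n x)"
proof -
  have [measurable]: "f n \<in> borel_measurable M" for n using int by auto
  have "(\<integral>\<^sup>+x. (\<Sum>n. ennreal (f n x)) \<partial>M) = (\<Sum>n. ennreal (LINT x|M. f n x))"
    by (subst nn_integral_suminf) (auto simp: nn_integral_eq_integral int nonneg)
  also have "\<dots> \<noteq> \<top>"
    by (intro ennreal_suminf_neq_top sm integral_nonneg_AE) (auto simp: nonneg)
  finally have "AE x in M. (\<Sum>n. ennreal (f n x)) \<noteq> \<top>"
    by (intro nn_integral_PInf_AE[unfolded infinity_ennreal_def]) auto
  then show "AE x in M. summable (\<lambda>n. f n x)"
    by eventually_elim (auto intro: summable_suminf_not_top nonneg)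
qed

text \<open>\<open>has_trace\<close> is split into a condition on the vectors alone and
  \<open>ker_sums\<close>, which ties them to a kernel: families are compressed, shifted and
  polarised without reference to a kernel.\<close>

definition nuclear :: "(nat \<Rightarrow> real \<Rightarrow> complex) \<Rightarrow> (nat \<Rightarrow> real \<Rightarrow> complex) \<Rightarrow> bool" where
  "nuclear \<psi> \<phi> \<longleftrightarrow> (\<forall>n. L2_fun (\<psi> n) \<and> L2_fun (\<phi> n)) \<and> summable (\<lambda>n. L2_norm (\<psi> n) * L2_norm (\<phi> n))"

definition ker_sums :: "(nat \<Rightarrow> real \<Rightarrow> complex) \<Rightarrow> (nat \<Rightarrow> real \<Rightarrow> complex) \<Rightarrow> opker \<Rightarrow> bool" where
  "ker_sums \<psi> \<phi> K \<longleftrightarrow> (\<lambda>(q, q'). K q q') \<in> borel_measurable borel \<and>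
     (AE (q, q') in lborel. (\<lambda>n. \<psi> n q * cnj (\<phi> n q')) sums K q q')"

lemma has_trace_iff: "has_trace K t \<longleftrightarrow> (\<exists>\<psi> \<phi>. nuclear \<psi> \<phi> \<and> ker_sums \<psi> \<phi> K \<and> (\<lambda>n. ip (\<phi> n) (\<psi> n)) sums t)"
  by (auto simp: has_trace_def nuclear_def ker_sums_def ip_def)

lemma nuclear_L2: "nuclear \<psi> \<phi> \<Longrightarrow> L2_fun (\<psi> n)" "nuclear \<psi> \<phi> \<Longrightarrow> L2_fun (\<phi> n)"
  by (auto simp: nuclear_def)

lemma nuclear_summable_ip:
  assumes "nuclear \<psi> \<phi>" "L2_fun f" "L2_fun g"
  shows "summable (\<lambda>n. cmod (ip f (\<psi> n) * ip (\<phi> n) g))"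
proof (rule summable_comparison_test')
  show "summable (\<lambda>n. (L2_norm f * L2_norm g) * (L2_norm (\<psi> n) * L2_norm (\<phi> n)))"
    using assms by (intro summable_mult) (auto simp: nuclear_def)
  show "norm (cmod (ip f (\<psi> n) * ip (\<phi> n) g)) \<le> (L2_norm f * L2_norm g) * (L2_norm (\<psi> n) * L2_norm (\<phi> n))" for n
  proof -
    have "cmod (ip f (\<psi> n)) * cmod (ip (\<phi> n) g) \<le> (L2_norm f * L2_norm (\<psi> n)) * (L2_norm (\<phi> n) * L2_norm g)"
      using assms by (intro mult_mono norm_ip_le) (auto simp: nuclear_def)
    then show ?thesis by (simp add: norm_mult mult_ac)
  qed
qed

lemma nuclear_summable_trace:
  assumes "nuclear \<psi> \<phi>"
  shows "summable (\<lambda>n. cmod (ip (\<phi> n) (\<psi> n)))"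
proof (rule summable_comparison_test')
  show "summable (\<lambda>n. L2_norm (\<psi> n) * L2_norm (\<phi> n))" using assms by (simp add: nuclear_def)
  show "norm (cmod (ip (\<phi> n) (\<psi> n))) \<le> L2_norm (\<psi> n) * L2_norm (\<phi> n)" for n
    using norm_ip_le[of "\<phi> n" "\<psi> n"] nuclear_L2[OF assms] by (simp add: mult.commute)
qed

definition qf :: "(real \<Rightarrow> complex) \<Rightarrow> opker \<Rightarrow> (real \<Rightarrow> complex) \<Rightarrow> complex" where
  "qf f K g = (LINT (q, q')|lborel. cnj (f q) * K q q' * g q')"

text \<open>One term of the series tested against f and g, grouped by variable so that its integral
  over the plane factors into two inner products. Unlike the bare dyad it is integrable.\<close>

definition weighted_dyad ::
  "(real \<Rightarrow> complex) \<Rightarrow> (real \<Rightarrow> complex) \<Rightarrow> (real \<Rightarrow> complex) \<Rightarrow> (real \<Rightarrow> complex) \<Rightarrow> real \<times> real \<Rightarrow> complex" where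
  "weighted_dyad f g \<psi> \<phi> p = (cnj (f (fst p)) * \<psi> (fst p)) * (cnj (\<phi> (snd p)) * g (snd p))"

lemma
  assumes nuc: "nuclear \<psi> \<phi>" and f: "L2_fun f" and g: "L2_fun g"
  shows weighted_dyad_integrable: "integrable lborel (weighted_dyad f g (\<psi> n) (\<phi> n))"
    and weighted_dyad_integral: "(LINT p|lborel. weighted_dyad f g (\<psi> n) (\<phi> n) p) = ip f (\<psi> n) * ip (\<phi> n) g"
    and weighted_dyad_summable: "summable (\<lambda>n. LINT p|lborel. norm (weighted_dyad f g (\<psi> n) (\<phi> n) p))"
    and weighted_dyad_AE_summable: "AE p in lborel. summable (\<lambda>n. norm (weighted_dyad f g (\<psi> n) (\<phi> n) p))"
proof -
  note [measurable] = nuclear_L2[OF nuc, THEN L2_fun_measurable] f[THEN L2_fun_measurable] g[THEN L2_fun_measurable]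
  let ?F = "\<lambda>n p. (cnj (f (fst p)) * \<psi> n (fst p)) * (cnj (\<phi> n (snd p)) * g (snd p))"
  have Fi: "integrable lborel (?F n)" for n
    using integrable_lborel_prod[OF ip_integrable[OF f nuclear_L2(1)[OF nuc, of n]] ip_integrable[OF nuclear_L2(2)[OF nuc, of n] g]]
    by (simp add: case_prod_unfold)
  have FL: "(LINT p|lborel. ?F n p) = ip f (\<psi> n) * ip (\<phi> n) g" for n
    using integral_lborel_prod[OF ip_integrable[OF f nuclear_L2(1)[OF nuc, of n]] ip_integrable[OF nuclear_L2(2)[OF nuc, of n] g]]
    by (simp add: case_prod_unfold ip_def)
  have nFL: "(LINT p|lborel. norm (?F n p)) \<le> (L2_norm f * L2_norm g) * (L2_norm (\<psi> n) * L2_norm (\<phi> n))" for n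
  proof -
    have "(LINT p|lborel. norm (?F n p)) = (LINT q|lborel. cmod (f q) * cmod (\<psi> n q)) * (LINT q|lborel. cmod (\<phi> n q) * cmod (g q))"
      using integral_lborel_prod[OF integrable_norm[OF ip_integrable[OF f nuclear_L2(1)[OF nuc, of n]]]
         integrable_norm[OF ip_integrable[OF nuclear_L2(2)[OF nuc, of n] g]]]
      by (simp add: case_prod_unfold norm_mult)
    also have "\<dots> \<le> (L2_norm f * L2_norm (\<psi> n)) * (L2_norm (\<phi> n) * L2_norm g)"
      by (intro mult_mono Cauchy_Schwarz_L2 f g nuclear_L2[OF nuc]) (auto intro!: integral_nonneg_AE)
    finally show ?thesis by (simp add: mult_ac)
  qed
  have sm: "summable (\<lambda>n. LINT p|lborel. norm (?F n p))"
  proof (rule summable_comparison_test')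
    show "summable (\<lambda>n. (L2_norm f * L2_norm g) * (L2_norm (\<psi> n) * L2_norm (\<phi> n)))"
      using nuc by (intro summable_mult) (auto simp: nuclear_def)
    show "norm (LINT p|lborel. norm (?F n p)) \<le> (L2_norm f * L2_norm g) * (L2_norm (\<psi> n) * L2_norm (\<phi> n))" for n
      using nFL[of n] by (subst real_norm_def, subst abs_of_nonneg) (auto intro!: integral_nonneg_AE)
  qed
  have ae: "AE p in lborel. summable (\<lambda>n. norm (?F n p))"
    by (rule AE_summable_integral[OF integrable_norm[OF Fi] _ sm]) simp
  show "integrable lborel (weighted_dyad f g (\<psi> n) (\<phi> n))"
    "(LINT p|lborel. weighted_dyad f g (\<psi> n) (\<phi> n) p) = ip f (\<psi> n) * ip (\<phi> n) g"
    unfolding weighted_dyad_def[abs_def] by (rule Fi, rule FL)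
  show "summable (\<lambda>n. LINT p|lborel. norm (weighted_dyad f g (\<psi> n) (\<phi> n) p))"
    "AE p in lborel. summable (\<lambda>n. norm (weighted_dyad f g (\<psi> n) (\<phi> n) p))"
    unfolding weighted_dyad_def[abs_def] by (rule sm, rule ae)
qed

lemma
  assumes nuc: "nuclear \<psi> \<phi>" and K: "ker_sums \<psi> \<phi> K" and f: "L2_fun f" and g: "L2_fun g"
  shows nuclear_qf_integrable: "integrable lborel (\<lambda>(q, q'). cnj (f q) * K q q' * g q')"
    and nuclear_qf_sums: "(\<lambda>n. ip f (\<psi> n) * ip (\<phi> n) g) sums qf f K g"
proof -
  note [measurable] = nuclear_L2[OF nuc, THEN L2_fun_measurable] f[THEN L2_fun_measurable] g[THEN L2_fun_measurable]
  let ?F = "\<lambda>n. weighted_dyad f g (\<psi> n) (\<phi> n)"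
  note Fi = weighted_dyad_integrable[OF nuc f g] and FL = weighted_dyad_integral[OF nuc f g]
    and sm = weighted_dyad_summable[OF nuc f g] and ae = weighted_dyad_AE_summable[OF nuc f g]
  have si: "integrable lborel (\<lambda>p. \<Sum>n. ?F n p)"
    by (rule integrable_suminf[OF Fi ae sm])
  have ss: "(\<lambda>n. ip f (\<psi> n) * ip (\<phi> n) g) sums (LINT p|lborel. (\<Sum>n. ?F n p))"
    using sums_integral[OF Fi ae sm] by (simp add: FL)
  have [measurable]: "(\<lambda>p. K (fst p) (snd p)) \<in> borel_measurable borel"
    using K by (simp add: ker_sums_def case_prod_unfold)
  have [measurable]: "(\<lambda>p. cnj (f (fst p)) * K (fst p) (snd p) * g (snd p)) \<in> borel_measurable borel"
    by measurable
  have eq: "AE p in lborel. (\<Sum>n. ?F n p) = cnj (f (fst p)) * K (fst p) (snd p) * g (snd p)"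
  proof -
    from K have "AE p in lborel. (\<lambda>n. \<psi> n (fst p) * cnj (\<phi> n (snd p))) sums K (fst p) (snd p)"
      by (simp add: ker_sums_def case_prod_unfold)
    then show ?thesis
    proof eventually_elim
      case (elim p)
      then have "(\<lambda>n. (cnj (f (fst p)) * g (snd p)) * (\<psi> n (fst p) * cnj (\<phi> n (snd p)))) sums
         ((cnj (f (fst p)) * g (snd p)) * K (fst p) (snd p))" by (rule sums_mult)
      then show ?case by (auto simp: weighted_dyad_def sums_iff mult_ac)
    qed
  qed
  have "integrable lborel (\<lambda>p. cnj (f (fst p)) * K (fst p) (snd p) * g (snd p))"
    using si eq by (subst integrable_cong_AE[where g = "\<lambda>p. \<Sum>n. ?F n p"]) auto
  then show "integrable lborel (\<lambda>(q, q'). cnj (f q) * K q q' * g q')"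
    by (simp add: case_prod_unfold)
  have "(LINT p|lborel. (\<Sum>n. ?F n p)) = (LINT p|lborel. cnj (f (fst p)) * K (fst p) (snd p) * g (snd p))"
    using si eq by (intro integral_cong_AE) auto
  with ss show "(\<lambda>n. ip f (\<psi> n) * ip (\<phi> n) g) sums qf f K g"
    by (simp add: qf_def case_prod_unfold)
qed

text \<open>Tested against \<open>gexp 0\<close> in both variables the series converges absolutely
  almost everywhere, and a weight without zeros can be divided out again. So every nuclear family
  defines a kernel; this supplies the tails of a series and the positive parts in the
  polarisation.\<close>

lemma ker_sums_suminf:
  assumes nuc: "nuclear \<psi> \<phi>"
  shows "ker_sums \<psi> \<phi> (\<lambda>q q'. \<Sum>n. \<psi> n q * cnj (\<phi> n q'))"
  unfolding ker_sums_def
proof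
  note [measurable] = nuclear_L2[OF nuc, THEN L2_fun_measurable]
  show "(\<lambda>(q, q'). \<Sum>n. \<psi> n q * cnj (\<phi> n q')) \<in> borel_measurable borel"
    unfolding case_prod_unfold by measurable
  have "AE p in lborel. summable (\<lambda>n. norm (weighted_dyad (gexp 0) (gexp 0) (\<psi> n) (\<phi> n) p))"
    by (rule weighted_dyad_AE_summable[OF nuc L2_fun_gexp L2_fun_gexp])
  then show "AE (q, q') in lborel. (\<lambda>n. \<psi> n q * cnj (\<phi> n q')) sums (\<Sum>n. \<psi> n q * cnj (\<phi> n q'))"
    unfolding case_prod_unfold
  proof eventually_elim
    case (elim p)
    let ?c = "cnj (gexp 0 (fst p)) * gexp 0 (snd p)"
    have "?c \<noteq> 0" by (simp add: gexp_def)
    moreover have "summable (\<lambda>n. ?c * (\<psi> n (fst p) * cnj (\<phi> n (snd p))))"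
      using summable_norm_cancel[OF elim] by (simp add: weighted_dyad_def mult_ac)
    ultimately have "summable (\<lambda>n. \<psi> n (fst p) * cnj (\<phi> n (snd p)))"
      by (simp add: summable_cmult_iff)
    then show ?case by (rule summable_sums)
  qed
qed

section \<open>Positive operators and their trace, computed from an arbitrary nuclear family\<close>

definition pos_family :: "(nat \<Rightarrow> real \<Rightarrow> complex) \<Rightarrow> (nat \<Rightarrow> real \<Rightarrow> complex) \<Rightarrow> bool" where
  "pos_family \<psi> \<phi> \<longleftrightarrow> (\<forall>h. L2_fun h \<longrightarrow> (\<Sum>n. ip h (\<psi> n) * ip (\<phi> n) h) \<in> \<real>\<^sub>\<ge>\<^sub>0)"

text \<open>The operator Q = 1 - |f><f|; it is the orthogonal projection off f once f has norm 1,
  which the following context fixes.\<close>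

definition compl_proj :: "(real \<Rightarrow> complex) \<Rightarrow> (real \<Rightarrow> complex) \<Rightarrow> real \<Rightarrow> complex" where
  "compl_proj f h q = h q - ip f h * f q"

context
  fixes f assumes f: "L2_fun f" and f1: "L2_norm f = 1"
begin

lemma L2_fun_compl_proj: "L2_fun h \<Longrightarrow> L2_fun (compl_proj f h)"
  unfolding compl_proj_def[abs_def] by (intro L2_fun_diff L2_fun_cmult f)

lemma ip_compl_proj_right:
  "L2_fun g \<Longrightarrow> L2_fun h \<Longrightarrow> ip g (compl_proj f h) = ip g h - ip g f * ip f h"
  unfolding compl_proj_def[abs_def] by (simp add: ip_diff_right L2_fun_cmult f ip_cmult_right)

lemma ip_compl_proj_left:
  "L2_fun g \<Longrightarrow> L2_fun h \<Longrightarrow> ip (compl_proj f h) g = ip h g - ip h f * ip f g"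
  unfolding compl_proj_def[abs_def] by (simp add: ip_diff_left L2_fun_cmult f ip_cmult_left cnj_ip)

lemma ip_compl_proj_both:
  "L2_fun g \<Longrightarrow> L2_fun h \<Longrightarrow> ip (compl_proj f g) (compl_proj f h) = ip g h - ip g f * ip f h"
  using f1 by (simp add: ip_compl_proj_left ip_compl_proj_right L2_fun_compl_proj f ip_self)

lemma L2_norm_compl_proj_le:
  assumes h: "L2_fun h"
  shows "L2_norm (compl_proj f h) \<le> L2_norm h"
proof (rule power2_le_imp_le)
  have "of_real ((L2_norm (compl_proj f h))\<^sup>2) = ip h h - cnj (ip f h) * ip f h"
    by (simp add: ip_self[symmetric] ip_compl_proj_both h cnj_ip del: of_real_power)
  also have "\<dots> = of_real ((L2_norm h)\<^sup>2 - (cmod (ip f h))\<^sup>2)"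
    by (metis complex_norm_square mult.commute of_real_diff ip_self)
  finally have "(L2_norm (compl_proj f h))\<^sup>2 = (L2_norm h)\<^sup>2 - (cmod (ip f h))\<^sup>2"
    by (simp only: of_real_eq_iff)
  then show "(L2_norm (compl_proj f h))\<^sup>2 \<le> (L2_norm h)\<^sup>2" by simp
qed simp

lemma nuclear_compl_proj:
  assumes "nuclear \<psi> \<phi>"
  shows "nuclear (\<lambda>n. compl_proj f (\<psi> n)) (\<lambda>n. compl_proj f (\<phi> n))"
  unfolding nuclear_def
proof (intro conjI allI)
  show "summable (\<lambda>n. L2_norm (compl_proj f (\<psi> n)) * L2_norm (compl_proj f (\<phi> n)))"
  proof (rule summable_comparison_test')
    show "summable (\<lambda>n. L2_norm (\<psi> n) * L2_norm (\<phi> n))" using assms by (simp add: nuclear_def)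
    show "norm (L2_norm (compl_proj f (\<psi> n)) * L2_norm (compl_proj f (\<phi> n))) \<le> L2_norm (\<psi> n) * L2_norm (\<phi> n)" for n
      using L2_norm_compl_proj_le[OF nuclear_L2(1)[OF assms, of n]] L2_norm_compl_proj_le[OF nuclear_L2(2)[OF assms, of n]]
      by (auto intro!: mult_mono)
  qed
qed (auto intro: L2_fun_compl_proj nuclear_L2[OF assms])

lemma ip_compl_proj_swap:
  "L2_fun g \<Longrightarrow> L2_fun h \<Longrightarrow> ip g (compl_proj f h) = ip (compl_proj f g) h"
  by (simp add: ip_compl_proj_right ip_compl_proj_left)

lemma pos_family_compl_proj:
  assumes nuc: "nuclear \<psi> \<phi>" and pos: "pos_family \<psi> \<phi>"
  shows "pos_family (\<lambda>n. compl_proj f (\<psi> n)) (\<lambda>n. compl_proj f (\<phi> n))"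
  unfolding pos_family_def
proof (intro allI impI)
  fix h assume h: "L2_fun h"
  have "(\<Sum>n. ip (compl_proj f h) (\<psi> n) * ip (\<phi> n) (compl_proj f h)) \<in> \<real>\<^sub>\<ge>\<^sub>0"
    using pos L2_fun_compl_proj[OF h] by (simp add: pos_family_def)
  then show "(\<Sum>n. ip h (compl_proj f (\<psi> n)) * ip (compl_proj f (\<phi> n)) h) \<in> \<real>\<^sub>\<ge>\<^sub>0"
    by (simp add: ip_compl_proj_swap[OF h nuclear_L2(1)[OF nuc]] ip_compl_proj_swap[OF nuclear_L2(2)[OF nuc] h])
qed

text \<open>Compressing to Q K Q with Q = 1 - |f><f| removes exactly the diagonal value <f|K|f> from
  the trace. The identity is used in two directions: to lower the trace in the induction below, and
  to turn nonnegativity of traces into a bound on diagonal values.\<close>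

lemma trace_compl_proj:
  assumes nuc: "nuclear \<psi> \<phi>"
  shows "(\<Sum>n. ip (compl_proj f (\<phi> n)) (compl_proj f (\<psi> n))) =
    (\<Sum>n. ip (\<phi> n) (\<psi> n)) - (\<Sum>n. ip f (\<psi> n) * ip (\<phi> n) f)"
  using suminf_diff[OF summable_norm_cancel[OF nuclear_summable_trace[OF nuc]]
      summable_norm_cancel[OF nuclear_summable_ip[OF nuc f f]]]
  by (simp add: ip_compl_proj_both nuclear_L2[OF nuc] mult.commute)

end

lemma nuclear_shift: "nuclear \<psi> \<phi> \<Longrightarrow> nuclear (\<lambda>n. \<psi> (Suc n)) (\<lambda>n. \<phi> (Suc n))"
  unfolding nuclear_def using summable_Suc_iff[of "\<lambda>n. L2_norm (\<psi> n) * L2_norm (\<phi> n)"] by auto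

text \<open>Compressing to the orthogonal complement of the first vector kills one term of the family
  without destroying positivity and only lowers the real part of the trace.\<close>

lemma trace_ge_neg_tail:
  assumes "nuclear \<psi> \<phi>" "pos_family \<psi> \<phi>"
  shows "Re (\<Sum>n. ip (\<phi> n) (\<psi> n)) \<ge> - (\<Sum>n. L2_norm (\<psi> (n + N)) * L2_norm (\<phi> (n + N)))"
  using assms
proof (induction N arbitrary: \<psi> \<phi>)
  case 0
  have "\<bar>Re (\<Sum>n. ip (\<phi> n) (\<psi> n))\<bar> \<le> cmod (\<Sum>n. ip (\<phi> n) (\<psi> n))" by (rule abs_Re_le_cmod)
  also have "\<dots> \<le> (\<Sum>n. L2_norm (\<psi> n) * L2_norm (\<phi> n))"
    by (rule norm_suminf_le)
      (use 0 norm_ip_le[OF nuclear_L2(2,1)[OF 0(1)]] in \<open>auto simp: mult.commute nuclear_def\<close>)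
  finally show ?case by simp
next
  case (Suc N)
  note nuc = Suc.prems(1)
  show ?case
  \<comment> \<open>A null vector cannot be normalised, but then the first term contributes nothing
    and the family can be shifted at once.\<close>
  proof (cases "L2_norm (\<psi> 0) = 0")
    case True
    have z: "ip h (\<psi> 0) = 0" if "L2_fun h" for h
      using norm_ip_le[OF that nuclear_L2(1)[OF nuc, of 0]] True by simp
    have "pos_family (\<lambda>n. \<psi> (Suc n)) (\<lambda>n. \<phi> (Suc n))"
      unfolding pos_family_def
    proof (intro allI impI)
      fix h assume h: "L2_fun h"
      have "(\<Sum>n. ip h (\<psi> (Suc n)) * ip (\<phi> (Suc n)) h) = (\<Sum>n. ip h (\<psi> n) * ip (\<phi> n) h)"
        using suminf_split_head[OF summable_norm_cancel[OF nuclear_summable_ip[OF nuc h h]]] z[OF h] by simp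
      also have "\<dots> \<in> \<real>\<^sub>\<ge>\<^sub>0" using Suc.prems(2) h by (simp add: pos_family_def)
      finally show "(\<Sum>n. ip h (\<psi> (Suc n)) * ip (\<phi> (Suc n)) h) \<in> \<real>\<^sub>\<ge>\<^sub>0" .
    qed
    from Suc.IH[OF nuclear_shift[OF nuc] this]
    have "Re (\<Sum>n. ip (\<phi> (Suc n)) (\<psi> (Suc n))) \<ge> - (\<Sum>n. L2_norm (\<psi> (n + Suc N)) * L2_norm (\<phi> (n + Suc N)))"
      by simp
    moreover have "(\<Sum>n. ip (\<phi> (Suc n)) (\<psi> (Suc n))) = (\<Sum>n. ip (\<phi> n) (\<psi> n))"
      using suminf_split_head[OF summable_norm_cancel[OF nuclear_summable_trace[OF nuc]]] z[OF nuclear_L2(2)[OF nuc]]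
      by simp
    ultimately show ?thesis by simp
  next
    case False
    define f where "f = (\<lambda>q. of_real (1 / L2_norm (\<psi> 0)) * \<psi> 0 q)"
    have f: "L2_fun f" unfolding f_def by (intro L2_fun_cmult nuclear_L2[OF nuc])
    have f1: "L2_norm f = 1"
      unfolding f_def L2_norm_cmult norm_of_real using False L2_norm_nonneg[of "\<psi> 0"] by simp
    have "ip f (\<psi> 0) = of_real (L2_norm (\<psi> 0))"
      unfolding f_def ip_cmult_left ip_self using False by (simp add: power2_eq_square)
    then have z: "compl_proj f (\<psi> 0) = (\<lambda>_. 0)"
      using False by (auto simp: compl_proj_def f_def)
    let ?\<psi> = "\<lambda>n. compl_proj f (\<psi> n)" and ?\<phi> = "\<lambda>n. compl_proj f (\<phi> n)"
    have nuc': "nuclear ?\<psi> ?\<phi>" by (rule nuclear_compl_proj[OF f f1 nuc])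
    have pos': "pos_family ?\<psi> ?\<phi>" by (rule pos_family_compl_proj[OF f f1 Suc.prems])
    have z': "ip h (?\<psi> 0) = 0" for h by (simp add: z ip_def)
    have pos'': "pos_family (\<lambda>n. ?\<psi> (Suc n)) (\<lambda>n. ?\<phi> (Suc n))"
      unfolding pos_family_def
    proof (intro allI impI)
      fix h assume h: "L2_fun h"
      have "(\<Sum>n. ip h (?\<psi> (Suc n)) * ip (?\<phi> (Suc n)) h) = (\<Sum>n. ip h (?\<psi> n) * ip (?\<phi> n) h)"
        using suminf_split_head[OF summable_norm_cancel[OF nuclear_summable_ip[OF nuc' h h]]] z'[of h] by simp
      also have "\<dots> \<in> \<real>\<^sub>\<ge>\<^sub>0" using pos' h by (simp add: pos_family_def)
      finally show "(\<Sum>n. ip h (?\<psi> (Suc n)) * ip (?\<phi> (Suc n)) h) \<in> \<real>\<^sub>\<ge>\<^sub>0" .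
    qed
    have nS: "nuclear (\<lambda>n. \<psi> (n + Suc N)) (\<lambda>n. \<phi> (n + Suc N))"
      using nuc summable_iff_shift[of "\<lambda>n. L2_norm (\<psi> n) * L2_norm (\<phi> n)" "Suc N"] by (simp add: nuclear_def)
    have nS': "nuclear (\<lambda>n. ?\<psi> (n + Suc N)) (\<lambda>n. ?\<phi> (n + Suc N))"
      using nuclear_compl_proj[OF f f1 nS] by simp
    have "- (\<Sum>n. L2_norm (\<psi> (n + Suc N)) * L2_norm (\<phi> (n + Suc N))) \<le>
       - (\<Sum>n. L2_norm (?\<psi> (n + Suc N)) * L2_norm (?\<phi> (n + Suc N)))"
      using nS nS'
      by (intro le_imp_neg_le suminf_le mult_mono L2_norm_compl_proj_le[OF f f1] nuclear_L2[OF nuc])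
         (auto simp: nuclear_def)
    also have "\<dots> \<le> Re (\<Sum>n. ip (?\<phi> (Suc n)) (?\<psi> (Suc n)))"
      using Suc.IH[OF nuclear_shift[OF nuc'] pos''] by simp
    also have "(\<Sum>n. ip (?\<phi> (Suc n)) (?\<psi> (Suc n))) = (\<Sum>n. ip (?\<phi> n) (?\<psi> n))"
      using suminf_split_head[OF summable_norm_cancel[OF nuclear_summable_trace[OF nuc']]] z' by simp
    also have "\<dots> = (\<Sum>n. ip (\<phi> n) (\<psi> n)) - (\<Sum>n. ip f (\<psi> n) * ip (\<phi> n) f)"
      by (rule trace_compl_proj[OF f f1 nuc])
    also have "Re \<dots> \<le> Re (\<Sum>n. ip (\<phi> n) (\<psi> n))"
      using Suc.prems(2) f by (auto simp: pos_family_def complex_nonneg_Reals_iff)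
    finally show ?thesis .
  qed
qed

text \<open>After N compressions only the terms from N on remain, and the tails of a summable series
  are arbitrarily small. This replaces evaluating the trace in an orthonormal basis.\<close>

lemma trace_nonneg:
  assumes "nuclear \<psi> \<phi>" "pos_family \<psi> \<phi>"
  shows "Re (\<Sum>n. ip (\<phi> n) (\<psi> n)) \<ge> 0"
proof (rule field_le_epsilon)
  fix e :: real assume "e > 0"
  then obtain N where "norm (\<Sum>n. L2_norm (\<psi> (n + N)) * L2_norm (\<phi> (n + N))) < e"
    using suminf_exist_split[of e "\<lambda>n. L2_norm (\<psi> n) * L2_norm (\<phi> n)"] assms(1) by (auto simp: nuclear_def)
  then show "0 \<le> Re (\<Sum>n. ip (\<phi> n) (\<psi> n)) + e"
    using trace_ge_neg_tail[OF assms, of N] by simp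
qed

text \<open>For a unit vector g the compression by 1 - |g><g| is again positive, so its trace, tr K
  - <g|K|g>, is nonnegative; the general case follows by scaling.\<close>

lemma diag_le_trace:
  assumes nuc: "nuclear \<psi> \<phi>" and pos: "pos_family \<psi> \<phi>" and f: "L2_fun f"
  shows "Re (\<Sum>n. ip f (\<psi> n) * ip (\<phi> n) f) \<le> Re (\<Sum>n. ip (\<phi> n) (\<psi> n)) * (L2_norm f)\<^sup>2"
proof (cases "L2_norm f = 0")
  case True
  have "ip f (\<psi> n) = 0" for n
    using norm_ip_le[OF f nuclear_L2(1)[OF nuc, of n]] True by simp
  then show ?thesis using True by simp
next
  case False
  define r where "r = L2_norm f"
  have r: "r > 0" using False L2_norm_nonneg[of f] unfolding r_def by linarith
  define g where "g = (\<lambda>q. of_real (1 / r) * f q)"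
  have g: "L2_fun g" unfolding g_def by (intro L2_fun_cmult f)
  have g1: "L2_norm g = 1"
    unfolding g_def L2_norm_cmult norm_of_real using r by (simp add: r_def)
  have fg: "f = (\<lambda>q. of_real r * g q)" using r by (simp add: g_def)
  have "0 \<le> Re (\<Sum>n. ip (\<phi> n) (\<psi> n)) - Re (\<Sum>n. ip g (\<psi> n) * ip (\<phi> n) g)"
    using trace_nonneg[OF nuclear_compl_proj[OF g g1 nuc] pos_family_compl_proj[OF g g1 nuc pos]]
    by (simp add: trace_compl_proj[OF g g1 nuc])
  moreover have "(\<Sum>n. ip f (\<psi> n) * ip (\<phi> n) f) = of_real (r\<^sup>2) * (\<Sum>n. ip g (\<psi> n) * ip (\<phi> n) g)"
    unfolding fg ip_cmult_left ip_cmult_right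
    by (subst suminf_mult[symmetric, OF summable_norm_cancel[OF nuclear_summable_ip[OF nuc g g]]])
       (simp add: mult_ac power2_eq_square)
  ultimately show ?thesis
    using r by (simp add: r_def[symmetric] mult.commute[of _ "r\<^sup>2"] mult_left_mono del: of_real_power)
qed

subsection \<open>Trace-class kernels and channels\<close>

lemma block_positive_1: "block_positive 1 (\<lambda>_ _. K) \<longleftrightarrow> (\<forall>f. L2_fun f \<longrightarrow> qf f K f \<in> \<real>\<^sub>\<ge>\<^sub>0)"
proof
  assume *: "block_positive 1 (\<lambda>_ _. K)"
  show "\<forall>f. L2_fun f \<longrightarrow> qf f K f \<in> \<real>\<^sub>\<ge>\<^sub>0"
  proof (intro allI impI)
    fix f assume "L2_fun f"
    then show "qf f K f \<in> \<real>\<^sub>\<ge>\<^sub>0"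
      using *[unfolded block_positive_def, rule_format, of "\<lambda>_. f"] by (simp add: qf_def)
  qed
qed (auto simp: block_positive_def qf_def)

text \<open>The substitute for the inequality between operator norm and trace norm. Positivity makes
  the value real and nonnegative, so bounding its real part bounds its modulus.\<close>

lemma positive_qf_bound:
  assumes tr: "has_trace K t" and pos: "block_positive 1 (\<lambda>_ _. K)" and f: "L2_fun f"
  shows "cmod (qf f K f) \<le> Re t * (L2_norm f)\<^sup>2"
proof -
  obtain \<psi> \<phi> where nuc: "nuclear \<psi> \<phi>" and K: "ker_sums \<psi> \<phi> K" and t: "(\<lambda>n. ip (\<phi> n) (\<psi> n)) sums t"
    using tr by (auto simp: has_trace_iff)
  have e: "(\<Sum>n. ip h (\<psi> n) * ip (\<phi> n) h) = qf h K h" if "L2_fun h" for h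
    using nuclear_qf_sums[OF nuc K that that] by (simp add: sums_iff)
  have "pos_family \<psi> \<phi>" using pos unfolding block_positive_1 by (simp add: pos_family_def e)
  from diag_le_trace[OF nuc this f] have "Re (qf f K f) \<le> Re t * (L2_norm f)\<^sup>2"
    using t by (simp add: e f sums_iff)
  moreover have "qf f K f \<in> \<real>\<^sub>\<ge>\<^sub>0" using pos f unfolding block_positive_1 by simp
  ultimately show ?thesis by (simp add: complex_nonneg_Reals_iff cmod_eq_Re)
qed

lemma ker_measurable: "ker_sums \<psi> \<phi> K \<Longrightarrow> (\<lambda>p. K (fst p) (snd p)) \<in> borel_measurable borel"
  by (simp add: ker_sums_def case_prod_unfold)

lemma trace_class_iff: "trace_class K \<longleftrightarrow> (\<exists>\<psi> \<phi>. nuclear \<psi> \<phi> \<and> ker_sums \<psi> \<phi> K)"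
  unfolding trace_class_def has_trace_iff
  using summable_sums[OF summable_norm_cancel[OF nuclear_summable_trace]] by blast

lemma trace_class_measurable: "trace_class K \<Longrightarrow> (\<lambda>p. K (fst p) (snd p)) \<in> borel_measurable borel"
  using ker_measurable by (auto simp: trace_class_iff)

lemma trace_class_qf_integrable:
  "trace_class K \<Longrightarrow> L2_fun f \<Longrightarrow> L2_fun g \<Longrightarrow> integrable lborel (\<lambda>(q, q'). cnj (f q) * K q q' * g q')"
  using nuclear_qf_integrable by (auto simp: trace_class_iff)

lemma qf_cong:
  assumes "(\<lambda>p. K (fst p) (snd p)) \<in> borel_measurable borel" "(\<lambda>p. L (fst p) (snd p)) \<in> borel_measurable borel"
    and "ker_eq K L" and [measurable]: "f \<in> borel_measurable borel" "g \<in> borel_measurable borel"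
  shows "qf f K g = qf f L g"
  unfolding qf_def case_prod_unfold
proof (rule integral_cong_AE)
  note assms(1,2)[measurable]
  show "(\<lambda>p. cnj (f (fst p)) * K (fst p) (snd p) * g (snd p)) \<in> borel_measurable lborel"
    "(\<lambda>p. cnj (f (fst p)) * L (fst p) (snd p) * g (snd p)) \<in> borel_measurable lborel" by measurable
  show "AE p in lborel. cnj (f (fst p)) * K (fst p) (snd p) * g (snd p) = cnj (f (fst p)) * L (fst p) (snd p) * g (snd p)"
    using assms(3) by (auto simp: ker_eq_def case_prod_unfold elim!: eventually_mono)
qed

lemma qf_add:
  assumes "trace_class K" "trace_class L" "L2_fun f" "L2_fun g"
  shows "qf f (\<lambda>q q'. K q q' + L q q') g = qf f K g + qf f L g"
  using trace_class_qf_integrable[OF assms(1,3,4)] trace_class_qf_integrable[OF assms(2,3,4)]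
  by (simp add: qf_def case_prod_unfold distrib_left distrib_right)

lemma qf_cmult: "qf f (\<lambda>q q'. c * K q q') g = c * qf f K g"
proof -
  have *: "cnj (f q) * (c * K q q') * g q' = c * (cnj (f q) * K q q' * g q')" for q q'
    by (simp add: mult_ac)
  show ?thesis unfolding qf_def case_prod_unfold * by simp
qed

lemma trace_class_cmult:
  assumes "trace_class K"
  shows "trace_class (\<lambda>q q'. c * K q q')"
proof -
  obtain \<psi> \<phi> where nuc: "nuclear \<psi> \<phi>" and K: "ker_sums \<psi> \<phi> K"
    using assms by (auto simp: trace_class_iff)
  have "nuclear (\<lambda>n q. c * \<psi> n q) \<phi>"
    using nuc by (auto simp: nuclear_def L2_norm_cmult L2_fun_cmult mult.assoc)
  moreover have "ker_sums (\<lambda>n q. c * \<psi> n q) \<phi> (\<lambda>q q'. c * K q q')"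
    using K by (auto simp: ker_sums_def case_prod_unfold mult.assoc elim!: eventually_mono intro: sums_mult)
  ultimately show ?thesis by (auto simp: trace_class_iff)
qed

lemma sums_if_complex:
  fixes f g :: "nat \<Rightarrow> complex"
  assumes "g sums x" "f sums y"
  shows "(\<lambda>n. if even n then f (n div 2) else g ((n - 1) div 2)) sums (x + y)"
proof -
  have "(\<lambda>n. if even n then Re (f (n div 2)) else Re (g ((n - 1) div 2))) sums (Re x + Re y)"
    "(\<lambda>n. if even n then Im (f (n div 2)) else Im (g ((n - 1) div 2))) sums (Im x + Im y)"
    using assms by (intro sums_if; simp add: sums_complex_iff)+
  then show ?thesis unfolding sums_complex_iff by (simp add: if_distrib[of Re] if_distrib[of Im])
qed

lemma trace_class_add:
  assumes "trace_class K" "trace_class L"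
  shows "trace_class (\<lambda>q q'. K q q' + L q q')"
proof -
  obtain \<psi> \<phi> where nuc: "nuclear \<psi> \<phi>" and K: "ker_sums \<psi> \<phi> K"
    using assms by (auto simp: trace_class_iff)
  obtain \<psi>' \<phi>' where nuc': "nuclear \<psi>' \<phi>'" and L: "ker_sums \<psi>' \<phi>' L"
    using assms by (auto simp: trace_class_iff)
  \<comment> \<open>The two families are interleaved, K at the even and L at the odd
    positions.\<close>
  let ?\<psi> = "\<lambda>n. if even n then \<psi> (n div 2) else \<psi>' ((n - 1) div 2)"
  let ?\<phi> = "\<lambda>n. if even n then \<phi> (n div 2) else \<phi>' ((n - 1) div 2)"
  have "nuclear ?\<psi> ?\<phi>"
    unfolding nuclear_def
  proof (intro conjI allI)
    have "summable (\<lambda>n. if even n then L2_norm (\<psi> (n div 2)) * L2_norm (\<phi> (n div 2))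
       else L2_norm (\<psi>' ((n - 1) div 2)) * L2_norm (\<phi>' ((n - 1) div 2)))"
      using nuc nuc' by (intro sums_summable[OF sums_if[OF summable_sums summable_sums]]) (auto simp: nuclear_def)
    then show "summable (\<lambda>n. L2_norm (?\<psi> n) * L2_norm (?\<phi> n))"
      by (rule back_subst[of summable]) auto
  qed (use nuc nuc' in \<open>auto simp: nuclear_def\<close>)
  moreover have "ker_sums ?\<psi> ?\<phi> (\<lambda>q q'. K q q' + L q q')"
    unfolding ker_sums_def
  proof
    note [measurable] = ker_measurable[OF K] ker_measurable[OF L]
    show "(\<lambda>(q, q'). K q q' + L q q') \<in> borel_measurable borel"
      unfolding case_prod_unfold by measurable
    show "AE (q, q') in lborel. (\<lambda>n. ?\<psi> n q * cnj (?\<phi> n q')) sums (K q q' + L q q')"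
      using K[unfolded ker_sums_def, THEN conjunct2] L[unfolded ker_sums_def, THEN conjunct2]
      unfolding case_prod_unfold
    proof eventually_elim
      case (elim p)
      have "(\<lambda>n. if even n then \<psi> (n div 2) (fst p) * cnj (\<phi> (n div 2) (snd p))
         else \<psi>' ((n - 1) div 2) (fst p) * cnj (\<phi>' ((n - 1) div 2) (snd p))) sums (L (fst p) (snd p) + K (fst p) (snd p))"
        by (rule sums_if_complex[OF elim(2) elim(1)])
      then show ?case
        by (subst add.commute, elim back_subst[of "\<lambda>f. f sums _"]) auto
    qed
  qed
  ultimately show ?thesis by (auto simp: trace_class_iff)
qed

section \<open>Rank-one kernels and polarisation into positive kernels\<close>

definition dyad :: "(real \<Rightarrow> complex) \<Rightarrow> (real \<Rightarrow> complex) \<Rightarrow> opker" where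
  "dyad \<psi> \<phi> q q' = \<psi> q * cnj (\<phi> q')"

definition single :: "(real \<Rightarrow> complex) \<Rightarrow> nat \<Rightarrow> real \<Rightarrow> complex" where
  "single \<psi> n = (if n = 0 then \<psi> else (\<lambda>_. 0))"

lemma dyad_family:
  assumes "L2_fun \<psi>" "L2_fun \<phi>"
  shows "nuclear (single \<psi>) (single \<phi>)"
    and "ker_sums (single \<psi>) (single \<phi>) (dyad \<psi> \<phi>)"
proof -
  note [measurable] = assms[THEN L2_fun_measurable]
  show "nuclear (single \<psi>) (single \<phi>)"
    using assms by (auto simp: nuclear_def single_def intro!: summable_finite[of "{0}"] split: if_splits)
  show "ker_sums (single \<psi>) (single \<phi>) (dyad \<psi> \<phi>)"
    unfolding ker_sums_def dyad_def case_prod_unfold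
  proof
    have "(\<lambda>n. single \<psi> n x * cnj (single \<phi> n y)) sums (\<psi> x * cnj (\<phi> y))" for x y
      using sums_finite[of "{0}" "\<lambda>n. single \<psi> n x * cnj (single \<phi> n y)"] by (simp add: single_def)
    then show "AE p in lborel. (\<lambda>n. single \<psi> n (fst p) * cnj (single \<phi> n (snd p)))
       sums (\<psi> (fst p) * cnj (\<phi> (snd p)))"
      by (intro AE_I2)
  qed measurable
qed

lemma trace_class_dyad: "L2_fun \<psi> \<Longrightarrow> L2_fun \<phi> \<Longrightarrow> trace_class (dyad \<psi> \<phi>)"
  unfolding trace_class_iff using dyad_family by (metis (no_types))

lemma has_trace_dyad:
  assumes "L2_fun \<psi>" "L2_fun \<phi>" shows "has_trace (dyad \<psi> \<phi>) (ip \<phi> \<psi>)"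
proof -
  have "(\<lambda>n. ip (single \<phi> n) (single \<psi> n)) sums ip \<phi> \<psi>"
    using sums_finite[of "{0}" "\<lambda>n. ip (single \<phi> n) (single \<psi> n)"] by (simp add: single_def ip_def)
  with dyad_family[OF assms] show ?thesis
    unfolding has_trace_iff by (metis (no_types))
qed

lemma qf_dyad:
  assumes "L2_fun \<psi>" "L2_fun \<phi>" "L2_fun f" "L2_fun g"
  shows "qf f (dyad \<psi> \<phi>) g = ip f \<psi> * ip \<phi> g"
proof -
  have "(\<lambda>n. ip f (single \<psi> n) * ip (single \<phi> n) g) sums (ip f \<psi> * ip \<phi> g)"
    using sums_finite[of "{0}" "\<lambda>n. ip f (single \<psi> n) * ip (single \<phi> n) g"] by (simp add: single_def ip_def)
  then show ?thesis
    by (rule sums_unique2[OF nuclear_qf_sums[OF dyad_family[OF assms(1,2)] assms(3,4)]])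
qed

lemma block_positive_dyad:
  assumes "L2_fun \<psi>"
  shows "block_positive 1 (\<lambda>_ _. dyad \<psi> \<psi>)"
  unfolding block_positive_1
proof (intro allI impI)
  fix f assume "L2_fun f"
  then have "qf f (dyad \<psi> \<psi>) f = ip f \<psi> * cnj (ip f \<psi>)"
    using assms by (simp add: qf_dyad cnj_ip)
  then show "qf f (dyad \<psi> \<psi>) f \<in> \<real>\<^sub>\<ge>\<^sub>0"
    by (simp add: complex_nonneg_Reals_iff)
qed

lemma positive_square_family:
  assumes nuc: "nuclear \<eta> \<eta>" and K: "ker_sums \<eta> \<eta> K"
  shows "block_positive 1 (\<lambda>_ _. K)" "has_trace K (of_real (\<Sum>n. (L2_norm (\<eta> n))\<^sup>2))"
proof -
  show "block_positive 1 (\<lambda>_ _. K)"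
    unfolding block_positive_1
  proof (intro allI impI)
    fix f assume f: "L2_fun f"
    have "(\<lambda>n. of_real ((cmod (ip f (\<eta> n)))\<^sup>2)) sums qf f K f"
      using nuclear_qf_sums[OF nuc K f f] by (metis (no_types, lifting) cnj_ip complex_norm_square sums_cong)
    then have "(\<lambda>n. (cmod (ip f (\<eta> n)))\<^sup>2) sums Re (qf f K f)" "Im (qf f K f) = 0"
      by (auto simp: sums_complex_iff sums_iff simp del: of_real_power)
    then show "qf f K f \<in> \<real>\<^sub>\<ge>\<^sub>0"
      using suminf_nonneg[of "\<lambda>n. (cmod (ip f (\<eta> n)))\<^sup>2"] by (auto simp: complex_nonneg_Reals_iff sums_iff)
  qed
  have "summable (\<lambda>n. (L2_norm (\<eta> n))\<^sup>2)"
    using nuc by (simp add: nuclear_def power2_eq_square)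
  then have "(\<lambda>n. ip (\<eta> n) (\<eta> n)) sums of_real (\<Sum>n. (L2_norm (\<eta> n))\<^sup>2)"
    unfolding ip_self by (intro sums_of_real summable_sums)
  then show "has_trace K (of_real (\<Sum>n. (L2_norm (\<eta> n))\<^sup>2))"
    using nuc K by (auto simp: has_trace_iff)
qed

lemma trace_classI: "nuclear \<psi> \<phi> \<Longrightarrow> ker_sums \<psi> \<phi> K \<Longrightarrow> trace_class K"
  unfolding trace_class_iff by (intro exI conjI)

lemma AE_lborel_fst:
  assumes "AE x in (lborel :: real measure). P x"
  shows "AE p in (lborel :: (real \<times> real) measure). P (fst p)"
proof -
  obtain N where N: "{x. \<not> P x} \<subseteq> N" "N \<in> null_sets lborel"
    using assms by (auto simp: eventually_ae_filter)
  then have "N \<times> UNIV \<in> null_sets (lborel \<Otimes>\<^sub>M (lborel :: real measure))"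
    by (intro lborel.times_in_null_sets1) auto
  then show ?thesis
    unfolding lborel_prod by (rule AE_I') (use N in auto)
qed

lemma AE_lborel_snd:
  assumes "AE x in (lborel :: real measure). P x"
  shows "AE p in (lborel :: (real \<times> real) measure). P (snd p)"
proof -
  obtain N where N: "{x. \<not> P x} \<subseteq> N" "N \<in> null_sets lborel"
    using assms by (auto simp: eventually_ae_filter)
  then have "UNIV \<times> N \<in> null_sets ((lborel :: real measure) \<Otimes>\<^sub>M lborel)"
    by (intro lborel.times_in_null_sets2) auto
  then show ?thesis
    unfolding lborel_prod by (rule AE_I') (use N in auto)
qed

text \<open>Only the products of the norms are summable, so before polarising both factors are
  rescaled to the same norm; otherwise the squared norms of their sums would be uncontrolled. If a
  factor is null no rescaling exists, but the dyad vanishes almost everywhere; hence equality only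
  up to null sets.\<close>

lemma balanced_dyad:
  assumes \<psi>: "L2_fun \<psi>" and \<phi>: "L2_fun \<phi>"
  obtains u w where "L2_fun u" "L2_fun w" "L2_norm u = sqrt (L2_norm \<psi> * L2_norm \<phi>)"
    "L2_norm w = sqrt (L2_norm \<psi> * L2_norm \<phi>)" "AE p in lborel. dyad \<psi> \<phi> (fst p) (snd p) = dyad u w (fst p) (snd p)"
proof (cases "L2_norm \<psi> = 0 \<or> L2_norm \<phi> = 0")
  case True
  then have "AE p in lborel. dyad \<psi> \<phi> (fst p) (snd p) = 0"
  proof
    assume "L2_norm \<psi> = 0"
    from AE_lborel_fst[OF L2_norm_zero_AE[OF \<psi> this]] show ?thesis
      by eventually_elim (simp add: dyad_def)
  next
    assume "L2_norm \<phi> = 0"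
    from AE_lborel_snd[OF L2_norm_zero_AE[OF \<phi> this]] show ?thesis
      by eventually_elim (simp add: dyad_def)
  qed
  with True show ?thesis
    by (intro that[of "\<lambda>_. 0" "\<lambda>_. 0"]) (auto simp: dyad_def)
next
  case False
  then have pos: "L2_norm \<psi> > 0" "L2_norm \<phi> > 0"
    using L2_norm_nonneg[of \<psi>] L2_norm_nonneg[of \<phi>] by linarith+
  define a where "a = sqrt (L2_norm \<phi> / L2_norm \<psi>)"
  have a: "a > 0" using pos by (simp add: a_def)
  have a2: "a\<^sup>2 = L2_norm \<phi> / L2_norm \<psi>" using pos by (simp add: a_def)
  then have a3: "a * a = L2_norm \<phi> / L2_norm \<psi>" by (simp add: power2_eq_square)
  have "sqrt (L2_norm \<psi> * L2_norm \<phi>) = a * L2_norm \<psi>"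
    by (rule real_sqrt_unique) (use pos a in \<open>auto simp: power_mult_distrib a2 power2_eq_square[of "L2_norm \<psi>"]\<close>)
  moreover have "sqrt (L2_norm \<psi> * L2_norm \<phi>) = 1 / a * L2_norm \<phi>"
    by (rule real_sqrt_unique) (use pos a in \<open>auto simp: power_divide a2 power2_eq_square[of "L2_norm \<phi>"]\<close>)
  moreover have "dyad \<psi> \<phi> = dyad (\<lambda>q. of_real a * \<psi> q) (\<lambda>q. of_real (1 / a) * \<phi> q)"
    using a by (simp add: dyad_def[abs_def])
  moreover have "L2_norm (\<lambda>q. of_real a * \<psi> q) = a * L2_norm \<psi>"
    "L2_norm (\<lambda>q. of_real (1 / a) * \<phi> q) = 1 / a * L2_norm \<phi>"
    unfolding L2_norm_cmult norm_of_real using a by auto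
  ultimately show ?thesis
    by (intro that[of "\<lambda>q. of_real a * \<psi> q" "\<lambda>q. of_real (1 / a) * \<phi> q"] L2_fun_cmult \<psi> \<phi>)
      (metis, metis, metis (mono_tags, lifting) AE_I2)
qed

text \<open>The factor 1/2 enters each dyad twice and so absorbs the 1/4 of the polarisation
  identity; it also keeps the norm below that of u and w when these are equal.\<close>

definition phase_half_sum :: "nat \<Rightarrow> (real \<Rightarrow> complex) \<Rightarrow> (real \<Rightarrow> complex) \<Rightarrow> real \<Rightarrow> complex" where
  "phase_half_sum k u w q = (1 / 2) * (u q + \<i> ^ k * w q)"

lemma L2_fun_phase_half_sum: "L2_fun u \<Longrightarrow> L2_fun w \<Longrightarrow> L2_fun (phase_half_sum k u w)"
  unfolding phase_half_sum_def[abs_def] by (intro L2_fun_cmult L2_fun_add)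

lemma L2_norm_phase_half_sum:
  assumes "L2_fun u" "L2_fun w"
  shows "L2_norm (phase_half_sum k u w) \<le> (L2_norm u + L2_norm w) / 2"
  using L2_norm_add_le[OF assms(1) L2_fun_cmult[OF assms(2)], of "\<i> ^ k"]
  unfolding phase_half_sum_def[abs_def] L2_norm_cmult by (simp add: L2_norm_cmult norm_power)

lemma polarization:
  "dyad u w q q' = dyad (phase_half_sum 0 u w) (phase_half_sum 0 u w) q q'
     + \<i> * dyad (phase_half_sum 1 u w) (phase_half_sum 1 u w) q q'
     + (-1) * dyad (phase_half_sum 2 u w) (phase_half_sum 2 u w) q q'
     + (-\<i>) * dyad (phase_half_sum 3 u w) (phase_half_sum 3 u w) q q'"
proof -
  have 4: "4 * (A * D) = (A + B) * (C + D) + \<i> * ((A + \<i> * B) * (C - \<i> * D)) - (A - B) * (C - D)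
     - \<i> * ((A - \<i> * B) * (C + \<i> * D))" for A B C D :: complex
    by (simp add: algebra_simps)
  show ?thesis
    using 4[of "u q" "cnj (w q')" "w q" "cnj (u q')"]
    unfolding dyad_def phase_half_sum_def by (simp add: power3_eq_cube field_simps)
qed

text \<open>The coefficients are the powers of \<i>. Signs are written as scalar factors so that
  only additivity and homogeneity of the channel are needed to take the sum apart.\<close>

definition phase_sum :: "(nat \<Rightarrow> opker) \<Rightarrow> opker" where
  "phase_sum P q q' = P 0 q q' + \<i> * P 1 q q' + (-1) * P 2 q q' + (-\<i>) * P 3 q q'"

text \<open>A quantitative stand-in for the decomposition into positive parts: by balancing, each of
  the four positive kernels has trace at most the nuclear sum of the given family.\<close>

lemma nuclear_polarization:
  assumes nuc: "nuclear \<psi> \<phi>" and K: "ker_sums \<psi> \<phi> K"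
  obtains \<eta> P where "\<And>k. nuclear (\<eta> k) (\<eta> k)" "\<And>k. ker_sums (\<eta> k) (\<eta> k) (P k)"
    "\<And>k. (\<Sum>n. (L2_norm (\<eta> k n))\<^sup>2) \<le> (\<Sum>n. L2_norm (\<psi> n) * L2_norm (\<phi> n))"
    "ker_eq K (phase_sum P)"
proof -
  define R where "R n u w \<longleftrightarrow> L2_fun u \<and> L2_fun w \<and> L2_norm u = sqrt (L2_norm (\<psi> n) * L2_norm (\<phi> n)) \<and>
    L2_norm w = sqrt (L2_norm (\<psi> n) * L2_norm (\<phi> n)) \<and>
    (AE p in lborel. dyad (\<psi> n) (\<phi> n) (fst p) (snd p) = dyad u w (fst p) (snd p))" for n u w
  have "\<exists>u w. R n u w" for n
    by (rule balanced_dyad[OF nuclear_L2(1)[OF nuc, of n] nuclear_L2(2)[OF nuc, of n]])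
       (auto simp: R_def)
  then obtain u w where "\<And>n. R n (u n) (w n)" by metis
  then have uw: "L2_fun (u n)" "L2_fun (w n)"
    "L2_norm (u n) = sqrt (L2_norm (\<psi> n) * L2_norm (\<phi> n))"
    "L2_norm (w n) = sqrt (L2_norm (\<psi> n) * L2_norm (\<phi> n))"
    "AE p in lborel. dyad (\<psi> n) (\<phi> n) (fst p) (snd p) = dyad (u n) (w n) (fst p) (snd p)" for n
    unfolding R_def by blast+
  define \<eta> where "\<eta> k n = phase_half_sum k (u n) (w n)" for k n
  define P where "P k q q' = (\<Sum>n. \<eta> k n q * cnj (\<eta> k n q'))" for k q q'
  have L: "L2_fun (\<eta> k n)" for k n unfolding \<eta>_def by (intro L2_fun_phase_half_sum uw)
  have "L2_norm (\<eta> k n) \<le> sqrt (L2_norm (\<psi> n) * L2_norm (\<phi> n))" for k n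
    using L2_norm_phase_half_sum[OF uw(1)[of n] uw(2)[of n]] by (simp add: \<eta>_def uw(3,4))
  then have le: "(L2_norm (\<eta> k n))\<^sup>2 \<le> L2_norm (\<psi> n) * L2_norm (\<phi> n)" for k n
    using power_mono[OF _ L2_norm_nonneg, of "\<eta> k n" "sqrt (L2_norm (\<psi> n) * L2_norm (\<phi> n))" 2] by simp
  have sm: "summable (\<lambda>n. (L2_norm (\<eta> k n))\<^sup>2)" for k
    by (rule summable_comparison_test'[where g = "\<lambda>n. L2_norm (\<psi> n) * L2_norm (\<phi> n)"])
       (use nuc le in \<open>auto simp: nuclear_def\<close>)
  have N: "nuclear (\<eta> k) (\<eta> k)" for k
    using sm[of k] by (auto simp: nuclear_def L power2_eq_square)
  have S: "ker_sums (\<eta> k) (\<eta> k) (P k)" for k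
    unfolding P_def[abs_def] by (rule ker_sums_suminf[OF N])
  show ?thesis
  proof (rule that[OF N S])
    show "(\<Sum>n. (L2_norm (\<eta> k n))\<^sup>2) \<le> (\<Sum>n. L2_norm (\<psi> n) * L2_norm (\<phi> n))" for k
      by (rule suminf_le[OF le sm]) (use nuc in \<open>auto simp: nuclear_def\<close>)
    have "AE p in lborel. \<forall>n. dyad (\<psi> n) (\<phi> n) (fst p) (snd p) = dyad (u n) (w n) (fst p) (snd p)"
      using uw(5) by (simp add: AE_all_countable)
    moreover note K[unfolded ker_sums_def case_prod_unfold, THEN conjunct2]
    moreover have "AE p in lborel. \<forall>k. (\<lambda>n. \<eta> k n (fst p) * cnj (\<eta> k n (snd p))) sums P k (fst p) (snd p)"
      using S by (auto simp: AE_all_countable ker_sums_def case_prod_unfold)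
    ultimately show "ker_eq K (phase_sum P)"
      unfolding ker_eq_def case_prod_unfold phase_sum_def
    proof eventually_elim
      case (elim p)
      have s: "(\<lambda>n. dyad (\<eta> k n) (\<eta> k n) (fst p) (snd p)) sums P k (fst p) (snd p)" for k
        using elim(3) by (simp add: dyad_def)
      have pe: "(\<lambda>n. dyad (u n) (w n) (fst p) (snd p)) = (\<lambda>n. dyad (\<eta> 0 n) (\<eta> 0 n) (fst p) (snd p)
          + \<i> * dyad (\<eta> 1 n) (\<eta> 1 n) (fst p) (snd p) + (-1) * dyad (\<eta> 2 n) (\<eta> 2 n) (fst p) (snd p)
          + (-\<i>) * dyad (\<eta> 3 n) (\<eta> 3 n) (fst p) (snd p))"
        unfolding \<eta>_def by (rule ext) (rule polarization)
      have "(\<lambda>n. dyad (u n) (w n) (fst p) (snd p)) sums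
        (P 0 (fst p) (snd p) + \<i> * P 1 (fst p) (snd p) + (-1) * P 2 (fst p) (snd p) + (-\<i>) * P 3 (fst p) (snd p))"
        unfolding pe by (intro sums_add sums_mult s)
      moreover have "(\<lambda>n. dyad (u n) (w n) (fst p) (snd p)) sums K (fst p) (snd p)"
        using elim(2) by (simp add: elim(1)[rule_format, symmetric]) (simp add: dyad_def)
      ultimately show ?case by (rule sums_unique2[rotated])
    qed
  qed
qed

section \<open>Positive trace-preserving maps: boundedness and countable additivity\<close>

locale channel =
  fixes \<Phi> :: "opker \<Rightarrow> opker"
  assumes channel: "quantum_channel \<Phi>"
begin

lemma
  shows channel_trace_class: "trace_class K \<Longrightarrow> trace_class (\<Phi> K)"
    and channel_cong: "trace_class K \<Longrightarrow> trace_class L \<Longrightarrow> ker_eq K L \<Longrightarrow> ker_eq (\<Phi> K) (\<Phi> L)"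
    and channel_add: "trace_class K \<Longrightarrow> trace_class L \<Longrightarrow>
      ker_eq (\<Phi> (\<lambda>q q'. K q q' + L q q')) (\<lambda>q q'. \<Phi> K q q' + \<Phi> L q q')"
    and channel_cmult: "trace_class K \<Longrightarrow> ker_eq (\<Phi> (\<lambda>q q'. c * K q q')) (\<lambda>q q'. c * \<Phi> K q q')"
  using channel unfolding quantum_channel_def linear_on_trace_class_def by blast+

lemma channel_positive: "trace_class K \<Longrightarrow> block_positive 1 (\<lambda>_ _. K) \<Longrightarrow> block_positive 1 (\<lambda>_ _. \<Phi> K)"
  using channel[unfolded quantum_channel_def completely_positive_def, THEN conjunct2, THEN conjunct1, rule_format,
      of 1 "\<lambda>_ _. K"] by auto

lemma channel_trace: "has_trace K t \<Longrightarrow> has_trace (\<Phi> K) t"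
  using channel unfolding quantum_channel_def trace_preserving_def by blast

text \<open>Only diagonal matrix elements of the output are followed, since these are what
  \<open>positive_qf_bound\<close> controls. Off-diagonal ones are recovered by polarisation in
  \<open>channel_kernel\<close>.\<close>

definition form :: "(real \<Rightarrow> complex) \<Rightarrow> opker \<Rightarrow> complex" where
  "form f K = qf f (\<Phi> K) f"

context
  fixes f assumes f: "L2_fun f"
begin

lemma form_cong: "trace_class K \<Longrightarrow> trace_class L \<Longrightarrow> ker_eq K L \<Longrightarrow> form f K = form f L"
  unfolding form_def
  by (intro qf_cong trace_class_measurable channel_trace_class channel_cong L2_fun_measurable f)

lemma form_add:
  assumes K: "trace_class K" and L: "trace_class L"
  shows "form f (\<lambda>q q'. K q q' + L q q') = form f K + form f L"
proof -
  note tc = channel_trace_class[OF K] channel_trace_class[OF L]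
  show ?thesis
    unfolding form_def qf_add[OF tc f f, symmetric]
    by (intro qf_cong trace_class_measurable channel_trace_class trace_class_add K L tc channel_add L2_fun_measurable f)
qed

lemma form_cmult:
  assumes K: "trace_class K"
  shows "form f (\<lambda>q q'. c * K q q') = c * form f K"
  unfolding form_def qf_cmult[symmetric]
  by (intro qf_cong trace_class_measurable channel_trace_class trace_class_cmult K channel_cmult L2_fun_measurable f)

text \<open>The constant 4 counts the positive parts of K: each is sent to a positive kernel of the
  same trace, and that trace is at most the nuclear sum.\<close>

lemma form_bound:
  assumes nuc: "nuclear \<psi> \<phi>" and K: "ker_sums \<psi> \<phi> K"
  shows "cmod (form f K) \<le> 4 * (\<Sum>n. L2_norm (\<psi> n) * L2_norm (\<phi> n)) * (L2_norm f)\<^sup>2"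
proof -
  let ?c = "\<Sum>n. L2_norm (\<psi> n) * L2_norm (\<phi> n)"
  obtain \<eta> P where N: "\<And>k. nuclear (\<eta> k) (\<eta> k)" and S: "\<And>k. ker_sums (\<eta> k) (\<eta> k) (P k)"
    and le: "\<And>k. (\<Sum>n. (L2_norm (\<eta> k n))\<^sup>2) \<le> ?c"
    and eq: "ker_eq K (phase_sum P)"
    by (rule nuclear_polarization[OF nuc K]) (rule that)
  have tc: "trace_class (P k)" for k by (rule trace_classI[OF N S])
  have b: "cmod (form f (P k)) \<le> ?c * (L2_norm f)\<^sup>2" for k
  proof -
    note ps = positive_square_family[OF N S, of k]
    have "cmod (form f (P k)) \<le> Re (of_real (\<Sum>n. (L2_norm (\<eta> k n))\<^sup>2)) * (L2_norm f)\<^sup>2"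
      unfolding form_def by (rule positive_qf_bound[OF channel_trace[OF ps(2)] channel_positive[OF tc ps(1)] f])
    also have "\<dots> \<le> ?c * (L2_norm f)\<^sup>2" using le by (intro mult_right_mono) auto
    finally show ?thesis .
  qed
  have "form f K = form f (phase_sum P)"
    unfolding phase_sum_def[abs_def] using eq[unfolded phase_sum_def[abs_def]]
    by (intro form_cong trace_class_add trace_class_cmult tc trace_classI[OF nuc K])
  also have "\<dots> = form f (P 0) + \<i> * form f (P 1) + (-1) * form f (P 2) + (-\<i>) * form f (P 3)"
    unfolding phase_sum_def[abs_def] by (simp only: form_add form_cmult trace_class_add trace_class_cmult tc)
  finally have e: "form f K = form f (P 0) + \<i> * form f (P 1) + (-1) * form f (P 2) + (-\<i>) * form f (P 3)" .
  have "cmod (a + b + c + d) \<le> cmod a + cmod b + cmod c + cmod d" for a b c d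
    using norm_triangle_ineq[of "a + b + c" d] norm_triangle_ineq[of "a + b" c] norm_triangle_ineq[of a b] by linarith
  then have "cmod (form f K) \<le> cmod (form f (P 0)) + cmod (\<i> * form f (P 1)) + cmod ((-1) * form f (P 2)) + cmod ((-\<i>) * form f (P 3))"
    unfolding e .
  then show ?thesis
    using b[of 0] b[of 1] b[of 2] b[of 3] by (simp add: norm_mult)
qed

lemma form_dyad_bound:
  assumes "L2_fun \<psi>" "L2_fun \<phi>"
  shows "cmod (form f (dyad \<psi> \<phi>)) \<le> 4 * (L2_norm \<psi> * L2_norm \<phi>) * (L2_norm f)\<^sup>2"
proof -
  have "(\<lambda>n. L2_norm (single \<psi> n) * L2_norm (single \<phi> n)) sums (L2_norm \<psi> * L2_norm \<phi>)"
    using sums_finite[of "{0}" "\<lambda>n. L2_norm (single \<psi> n) * L2_norm (single \<phi> n)"] by (simp add: single_def)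
  with form_bound[OF dyad_family[OF assms]] show ?thesis by (simp add: sums_iff)
qed

text \<open>Finite additivity peels off one dyad at a time, and \<open>form_bound\<close> applies to
  what is left because the tail of the family is again nuclear. Linearity of the channel alone would
  not give the limit along the series.\<close>

lemma form_split:
  assumes "nuclear \<psi> \<phi>" "ker_sums \<psi> \<phi> K"
  shows "cmod (form f K - (\<Sum>n<N. form f (dyad (\<psi> n) (\<phi> n)))) \<le>
    4 * (\<Sum>n. L2_norm (\<psi> (n + N)) * L2_norm (\<phi> (n + N))) * (L2_norm f)\<^sup>2"
  using assms
proof (induction N arbitrary: \<psi> \<phi> K)
  case 0
  then show ?case using form_bound by simp
next
  case (Suc N)
  note nuc' = nuclear_shift[OF Suc.prems(1)]
  let ?K' = "\<lambda>q q'. \<Sum>n. \<psi> (Suc n) q * cnj (\<phi> (Suc n) q')"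
  note K' = ker_sums_suminf[OF nuc']
  have tc: "trace_class K" "trace_class ?K'" "trace_class (dyad (\<psi> 0) (\<phi> 0))"
    by (rule trace_classI[OF Suc.prems], rule trace_classI[OF nuc' K'],
        intro trace_class_dyad nuclear_L2[OF Suc.prems(1)])
  have eq: "ker_eq K (\<lambda>q q'. dyad (\<psi> 0) (\<phi> 0) q q' + ?K' q q')"
    using Suc.prems(2)[unfolded ker_sums_def, THEN conjunct2] K'[unfolded ker_sums_def, THEN conjunct2]
    unfolding ker_eq_def case_prod_unfold
  proof eventually_elim
    case (elim p)
    from sums_unique2[OF elim(1) sums_Suc[OF elim(2)]] show ?case
      by (simp add: dyad_def add.commute)
  qed
  have "form f K = form f (dyad (\<psi> 0) (\<phi> 0)) + form f ?K'"
    using form_cong[OF tc(1) trace_class_add[OF tc(3,2)] eq] form_add[OF tc(3,2)] by simp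
  then have "form f K - (\<Sum>n<Suc N. form f (dyad (\<psi> n) (\<phi> n))) =
      form f ?K' - (\<Sum>n<N. form f (dyad (\<psi> (Suc n)) (\<phi> (Suc n))))"
    by (simp only: sum.lessThan_Suc_shift) simp
  then show ?case using Suc.IH[OF nuc' K'] by simp
qed

lemma form_sums:
  assumes nuc: "nuclear \<psi> \<phi>" and K: "ker_sums \<psi> \<phi> K"
  shows "(\<lambda>n. form f (dyad (\<psi> n) (\<phi> n))) sums form f K"
  unfolding sums_def
proof (rule Lim_transform2[OF tendsto_const])
  have "(\<lambda>N. \<Sum>n. L2_norm (\<psi> (n + N)) * L2_norm (\<phi> (n + N))) \<longlonglongrightarrow> 0"
  proof (rule LIMSEQ_I)
    fix r :: real assume "0 < r"
    then show "\<exists>N. \<forall>n\<ge>N. norm ((\<Sum>i. L2_norm (\<psi> (i + n)) * L2_norm (\<phi> (i + n))) - 0) < r"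
      using suminf_exist_split[of r "\<lambda>n. L2_norm (\<psi> n) * L2_norm (\<phi> n)"] nuc by (simp add: nuclear_def)
  qed
  then have "(\<lambda>N. 4 * (\<Sum>n. L2_norm (\<psi> (n + N)) * L2_norm (\<phi> (n + N))) * (L2_norm f)\<^sup>2) \<longlonglongrightarrow> 4 * 0 * (L2_norm f)\<^sup>2"
    by (intro tendsto_intros)
  then show "(\<lambda>N. form f K - (\<Sum>n<N. form f (dyad (\<psi> n) (\<phi> n)))) \<longlonglongrightarrow> 0"
    by (intro Lim_null_comparison[OF always_eventually[OF allI[OF form_split[OF nuc K]]]]) simp
qed

lemma form_dyad_add_left:
  assumes "L2_fun \<psi>" "L2_fun \<psi>'" "L2_fun \<phi>"
  shows "form f (dyad (\<lambda>q. \<psi> q + \<psi>' q) \<phi>) = form f (dyad \<psi> \<phi>) + form f (dyad \<psi>' \<phi>)"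
proof -
  have "dyad (\<lambda>q. \<psi> q + \<psi>' q) \<phi> = (\<lambda>q q'. dyad \<psi> \<phi> q q' + dyad \<psi>' \<phi> q q')"
    by (simp add: dyad_def[abs_def] distrib_right)
  then show ?thesis using assms by (simp add: form_add trace_class_dyad)
qed

lemma form_dyad_add_right:
  assumes "L2_fun \<psi>" "L2_fun \<phi>" "L2_fun \<phi>'"
  shows "form f (dyad \<psi> (\<lambda>q. \<phi> q + \<phi>' q)) = form f (dyad \<psi> \<phi>) + form f (dyad \<psi> \<phi>')"
proof -
  have "dyad \<psi> (\<lambda>q. \<phi> q + \<phi>' q) = (\<lambda>q q'. dyad \<psi> \<phi> q q' + dyad \<psi> \<phi>' q q')"
    by (simp add: dyad_def[abs_def] distrib_left)
  then show ?thesis using assms by (simp add: form_add trace_class_dyad)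
qed

lemma form_dyad_cmult_left:
  assumes "L2_fun \<psi>" "L2_fun \<phi>"
  shows "form f (dyad (\<lambda>q. c * \<psi> q) \<phi>) = c * form f (dyad \<psi> \<phi>)"
proof -
  have "dyad (\<lambda>q. c * \<psi> q) \<phi> = (\<lambda>q q'. c * dyad \<psi> \<phi> q q')"
    by (simp add: dyad_def[abs_def] mult.assoc)
  then show ?thesis using assms by (simp add: form_cmult trace_class_dyad)
qed

lemma form_dyad_cmult_right:
  assumes "L2_fun \<psi>" "L2_fun \<phi>"
  shows "form f (dyad \<psi> (\<lambda>q. c * \<phi> q)) = cnj c * form f (dyad \<psi> \<phi>)"
proof -
  have "dyad \<psi> (\<lambda>q. c * \<phi> q) = (\<lambda>q q'. cnj c * dyad \<psi> \<phi> q q')"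
    by (simp add: dyad_def[abs_def] mult_ac)
  then show ?thesis using assms by (simp add: form_cmult trace_class_dyad)
qed

end

end

subsection \<open>Centre and difference coordinates\<close>

text \<open>The property P need not be measurable, so its failure set is first covered by a Borel
  null set; the lemmas below then move that set through Fubini statements on sections.\<close>

lemma AE_lborel_fst_snd:
  assumes "AE p in (lborel :: (real \<times> real) measure). P p"
  obtains N where "{p. \<not> P p} \<subseteq> N" "N \<in> sets borel" "AE x in lborel. AE y in lborel. (x, y) \<notin> N"
proof -
  obtain N where N: "{p. \<not> P p} \<subseteq> N" "N \<in> null_sets lborel"
    using assms by (auto simp: eventually_ae_filter)
  have "AE p in lborel. p \<notin> N" using N(2) by (rule AE_not_in)
  then have "AE x in lborel. AE y in lborel. (x, y) \<notin> N"
    unfolding lborel_prod[symmetric] by (rule lborel_pair.AE_pair)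
  then show ?thesis using N that by auto
qed

lemma borel_compl_Collect: "N \<in> sets borel \<Longrightarrow> {p. p \<notin> N} \<in> sets borel"
  unfolding Compl_eq[symmetric] by (rule borel_comp)

lemma AE_lborel_pairI:
  assumes N: "N \<in> sets (borel :: (real \<times> real) measure)" and ae: "AE x in lborel. AE y in lborel. (x, y) \<notin> N"
  shows "AE p in lborel. p \<notin> N"
proof -
  have "{p \<in> space (lborel \<Otimes>\<^sub>M lborel). p \<notin> N} \<in> sets (lborel \<Otimes>\<^sub>M lborel)"
    unfolding lborel_prod using borel_compl_Collect[OF N] by simp
  from lborel_pair.AE_pair_measure[OF this ae] show ?thesis
    unfolding lborel_prod .
qed

lemma AE_pair_swap:
  assumes N: "N \<in> sets (borel :: (real \<times> real) measure)" and ae: "AE x in lborel. AE y in lborel. (x, y) \<notin> N"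
  shows "AE y in lborel. AE x in lborel. (x, y) \<notin> N"
proof -
  have "{p \<in> space (lborel \<Otimes>\<^sub>M lborel). (fst p, snd p) \<notin> N} \<in> sets (lborel \<Otimes>\<^sub>M lborel)"
    unfolding lborel_prod using borel_compl_Collect[OF N] by simp
  from lborel_pair.AE_commute[OF this] ae show ?thesis by blast
qed

lemma borel_set_vimage:
  fixes f :: "real \<times> real \<Rightarrow> real \<times> real"
  assumes "N \<in> sets borel" "continuous_on UNIV f"
  shows "f -` N \<in> sets borel"
  using measurable_sets[OF borel_measurable_continuous_onI[OF assms(2)] assms(1)] by simp

lemma borel_set_section: "N \<in> sets (borel :: (real \<times> real) measure) \<Longrightarrow> Measurable.pred borel (\<lambda>y. (x, y) \<notin> N)"
proof -
  assume "N \<in> sets (borel :: (real \<times> real) measure)"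
  then have "Pair x -` N \<in> sets borel"
    using measurable_sets[OF borel_measurable_continuous_onI[of "Pair x :: real \<Rightarrow> real \<times> real"], of N]
    by (simp add: continuous_intros)
  from borel_compl_Collect[OF this] show ?thesis unfolding pred_def by simp
qed

text \<open>On each vertical line the shear is a translation, which preserves null sets; no change
  of variables in the plane is required.\<close>

lemma AE_shear:
  assumes N: "N \<in> sets (borel :: (real \<times> real) measure)" and ae: "AE x in lborel. AE y in lborel. (x, y) \<notin> N"
  shows "AE x in lborel. AE y in lborel. (x, c * x + y) \<notin> N"
  using ae
proof eventually_elim
  case (elim x)
  from AE_borel_affine[OF _ borel_set_section[OF N] elim, of 1 "c * x"] show ?case by simp
qed

text \<open>The map (x, r) \<mapsto> (r - x/2, r + x/2) is a shear, a swap and another shear,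
  passing through (x, q) and (q, x) with q = r - x/2. The preimages N1, N2, N3 follow these steps
  backwards.\<close>

lemma AE_pos_rep_coords:
  assumes "AE p in lborel. P (fst p) (snd p)"
  shows "AE p in lborel. P (snd p - fst p / 2) (snd p + fst p / 2 :: real)"
proof -
  obtain N where N: "{p. \<not> P (fst p) (snd p)} \<subseteq> N" "N \<in> sets borel" "AE x in lborel. AE y in lborel. (x, y) \<notin> N"
    using AE_lborel_fst_snd[OF assms] by blast
  let ?N1 = "(\<lambda>(q, x). (q, q + x)) -` N"
  have N1: "?N1 \<in> sets borel"
    by (intro borel_set_vimage N) (auto simp: case_prod_unfold intro!: continuous_intros)
  have "AE q in lborel. AE x in lborel. (q, x) \<notin> ?N1"
    using AE_shear[OF N(2,3), of 1] by simp
  from AE_pair_swap[OF N1 this] have 2: "AE x in lborel. AE q in lborel. (q, x) \<notin> ?N1" .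
  let ?N2 = "(\<lambda>(x, q). (q, x)) -` ?N1"
  have N2: "?N2 \<in> sets borel"
    by (intro borel_set_vimage N1) (auto simp: case_prod_unfold intro!: continuous_intros)
  let ?N3 = "(\<lambda>(x, r). (x, - 1 / 2 * x + r)) -` ?N2"
  have N3: "?N3 \<in> sets borel"
    by (intro borel_set_vimage N2) (auto simp: case_prod_unfold intro!: continuous_intros)
  have "AE x in lborel. AE q in lborel. (x, q) \<notin> ?N2" using 2 by simp
  from AE_shear[OF N2 this, of "- 1 / 2"]
  have "AE x in lborel. AE r in lborel. (x, r) \<notin> ?N3" by simp
  from AE_lborel_pairI[OF N3 this] show ?thesis
  proof eventually_elim
    case (elim p)
    then have "(snd p - fst p / 2, snd p + fst p / 2) \<notin> N" by (simp add: case_prod_unfold add.commute)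
    then have "(snd p - fst p / 2, snd p + fst p / 2) \<notin> {p. \<not> P (fst p) (snd p)}" using N(1) by blast
    then show ?case by simp
  qed
qed

text \<open>The inverse coordinate change, again by two shears and a swap, through (q, x) and (x, q)
  with x = q' - q.\<close>

lemma AE_ker_coords:
  assumes "AE p in lborel. P (fst p) (snd p)"
  shows "AE p in lborel. P (snd p - fst p) ((fst p + snd p) / 2 :: real)"
proof -
  obtain N where N: "{p. \<not> P (fst p) (snd p)} \<subseteq> N" "N \<in> sets borel" "AE x in lborel. AE y in lborel. (x, y) \<notin> N"
    using AE_lborel_fst_snd[OF assms] by blast
  let ?N1 = "(\<lambda>(x, q). (x, 1 / 2 * x + q)) -` N"
  have N1: "?N1 \<in> sets borel"
    by (intro borel_set_vimage N) (auto simp: case_prod_unfold intro!: continuous_intros)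
  have "AE x in lborel. AE q in lborel. (x, q) \<notin> ?N1"
    using AE_shear[OF N(2,3), of "1 / 2"] by simp
  from AE_pair_swap[OF N1 this] have 2: "AE q in lborel. AE x in lborel. (x, q) \<notin> ?N1" .
  let ?N2 = "(\<lambda>(q, x). (x, q)) -` ?N1"
  have N2: "?N2 \<in> sets borel"
    by (intro borel_set_vimage N1) (auto simp: case_prod_unfold intro!: continuous_intros)
  let ?N3 = "(\<lambda>(q, q'). (q, - 1 * q + q')) -` ?N2"
  have N3: "?N3 \<in> sets borel"
    by (intro borel_set_vimage N2) (auto simp: case_prod_unfold intro!: continuous_intros)
  have "AE q in lborel. AE x in lborel. (q, x) \<notin> ?N2" using 2 by simp
  from AE_shear[OF N2 this, of "-1"]
  have "AE q in lborel. AE q' in lborel. (q, q') \<notin> ?N3" by simp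
  from AE_lborel_pairI[OF N3 this] show ?thesis
  proof eventually_elim
    case (elim p)
    have "1 / 2 * (- 1 * fst p + snd p) + fst p = (fst p + snd p) / 2" by argo
    moreover have "- 1 * fst p + snd p = snd p - fst p" by simp
    ultimately have "(snd p - fst p, (fst p + snd p) / 2) \<notin> N"
      using elim by (simp only: case_prod_unfold vimage_eq fst_conv snd_conv not_False_eq_True)
    then have "(snd p - fst p, (fst p + snd p) / 2) \<notin> {p. \<not> P (fst p) (snd p)}" using N(1) by blast
    then show ?case by simp
  qed
qed

lemma pos_rep_measurable:
  assumes "(\<lambda>p. K (fst p) (snd p)) \<in> borel_measurable borel"
  shows "(\<lambda>p. pos_rep K (fst p) (snd p)) \<in> borel_measurable borel"
proof -
  have "(\<lambda>p. (snd p - fst p / 2, snd p + fst p / 2)) \<in> borel_measurable (borel :: (real \<times> real) measure)"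
    by (intro borel_measurable_continuous_onI continuous_intros) auto
  from measurable_compose[OF this assms] show ?thesis by (simp add: pos_rep_def)
qed

subsection \<open>Two-by-two covariance matrices\<close>

text \<open>Written with the upper triangle only, so it agrees with the form v . M v for symmetric
  M. Scalar arguments keep the later exponents free of vectors.\<close>

definition quad2 :: "real^2^2 \<Rightarrow> real \<Rightarrow> real \<Rightarrow> real" where
  "quad2 M x y = M $ 1 $ 1 * x\<^sup>2 + 2 * M $ 1 $ 2 * x * y + M $ 2 $ 2 * y\<^sup>2"

lemma symmetric_2: "transpose M = M \<longleftrightarrow> M $ 2 $ 1 = M $ 1 $ (2 :: 2)"
  by (auto simp: transpose_def vec_eq_iff forall_2)

lemma inner_matrix_2:
  assumes "transpose M = (M :: real^2^2)"
  shows "v \<bullet> (M *v v) = quad2 M (v $ 1) (v $ 2)"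
  using assms unfolding symmetric_2
  by (simp add: quad2_def inner_vec_def matrix_vector_mult_def sum_2 power2_eq_square algebra_simps)

lemma pos_def_2:
  assumes "transpose M = (M :: real^2^2)"
  shows "(\<forall>v. v \<noteq> 0 \<longrightarrow> v \<bullet> (M *v v) > 0) \<longleftrightarrow> (\<forall>x y. (x, y) \<noteq> (0, 0) \<longrightarrow> quad2 M x y > 0)"
proof (intro iffI allI impI)
  fix x y :: real assume *: "\<forall>v. v \<noteq> 0 \<longrightarrow> v \<bullet> (M *v v) > 0" and n: "(x, y) \<noteq> (0, 0)"
  have "vector [x, y] \<noteq> (0 :: real^2)"
    using n by (auto simp: vec_eq_iff forall_2)
  with *[rule_format, of "vector [x, y]"] show "quad2 M x y > 0" by (simp add: inner_matrix_2[OF assms])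
next
  fix v :: "real^2" assume *: "\<forall>x y. (x, y) \<noteq> (0, 0) \<longrightarrow> quad2 M x y > 0" and n: "v \<noteq> 0"
  then have "(v $ 1, v $ 2) \<noteq> (0, 0)" by (auto simp: vec_eq_iff forall_2)
  then show "v \<bullet> (M *v v) > 0" using * unfolding inner_matrix_2[OF assms] by blast
qed

lemma pos_def_2D:
  assumes "\<And>x y. (x, y) \<noteq> (0, 0) \<Longrightarrow> quad2 M x y > 0"
  shows "M $ 1 $ 1 > 0" "M $ 1 $ 1 * M $ 2 $ 2 - (M $ 1 $ 2)\<^sup>2 > 0"
proof -
  show 1: "M $ 1 $ 1 > 0" using assms[of 1 0] by (simp add: quad2_def)
  \<comment> \<open>At this vector the form takes the value M11 * det M, which isolates the
    determinant.\<close>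
  have "0 < quad2 M (- M $ 1 $ 2) (M $ 1 $ 1)" using 1 by (intro assms) auto
  also have "\<dots> = M $ 1 $ 1 * (M $ 1 $ 1 * M $ 2 $ 2 - (M $ 1 $ 2)\<^sup>2)"
    by (simp add: quad2_def power2_eq_square algebra_simps)
  finally show "M $ 1 $ 1 * M $ 2 $ 2 - (M $ 1 $ 2)\<^sup>2 > 0"
    using 1 by (simp add: zero_less_mult_iff)
qed

text \<open>Only u with M u = z is used, so the inverse never has to be written out; multiplying z .
  u by the determinant and substituting z leaves a polynomial identity.\<close>

lemma matrix_inv_quad_2:
  fixes M :: "real^2^2" and z :: "real^2"
  assumes sym: "transpose M = M" and det: "det M \<noteq> 0"
  shows "z \<bullet> (matrix_inv M *v z) = (M $ 2 $ 2 * (z $ 1)\<^sup>2 - 2 * M $ 1 $ 2 * z $ 1 * z $ 2 + M $ 1 $ 1 * (z $ 2)\<^sup>2) / det M"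
proof -
  have "invertible M" using det by (simp add: invertible_det_nz)
  then have "M ** matrix_inv M = mat 1"
    unfolding invertible_def matrix_inv_def by (rule someI_ex[THEN conjunct1])
  define u where "u = matrix_inv M *v z"
  have "M *v u = z"
    unfolding u_def by (simp add: matrix_vector_mul_assoc \<open>M ** matrix_inv M = mat 1\<close>)
  then have e: "M $ 1 $ 1 * u $ 1 + M $ 1 $ 2 * u $ 2 = z $ 1" "M $ 1 $ 2 * u $ 1 + M $ 2 $ 2 * u $ 2 = z $ 2"
    using sym unfolding symmetric_2 by (auto simp: vec_eq_iff forall_2 matrix_vector_mult_def sum_2)
  have d: "det M = M $ 1 $ 1 * M $ 2 $ 2 - M $ 1 $ 2 * M $ 1 $ 2"
    using sym unfolding symmetric_2 by (simp add: det_2)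
  have "det M * (z \<bullet> u) = M $ 2 $ 2 * (z $ 1)\<^sup>2 - 2 * M $ 1 $ 2 * z $ 1 * z $ 2 + M $ 1 $ 1 * (z $ 2)\<^sup>2"
    unfolding inner_vec_def sum_2 d e[symmetric] by (simp add: power2_eq_square algebra_simps)
  then show ?thesis using det by (simp add: u_def field_simps)
qed

subsection \<open>Gaussian kernels\<close>

text \<open>The Fourier transform in p of a Gaussian Wigner function: the marginal density of q at r
  times the characteristic function, at -x, of p conditioned on q = r. The conditional variance is
  \<sigma>22 - \<sigma>12^2 / \<sigma>11 and the conditional mean stands in the phase.\<close>

definition gauss_rep :: "real^2^2 \<Rightarrow> real^2 \<Rightarrow> real \<Rightarrow> real \<Rightarrow> complex" where
  "gauss_rep \<sigma> d x r = of_real (1 / sqrt (2 * pi * \<sigma> $ 1 $ 1)) *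
     exp (- of_real ((r - d $ 1)\<^sup>2 / (2 * \<sigma> $ 1 $ 1) + (\<sigma> $ 2 $ 2 - (\<sigma> $ 1 $ 2)\<^sup>2 / \<sigma> $ 1 $ 1) * x\<^sup>2 / 2)
        - \<i> * of_real (((r - d $ 1) * \<sigma> $ 1 $ 2 / \<sigma> $ 1 $ 1 + d $ 2) * x))"

definition gauss_ker :: "real^2^2 \<Rightarrow> real^2 \<Rightarrow> opker" where
  "gauss_ker \<sigma> d q q' = gauss_rep \<sigma> d (q' - q) ((q + q') / 2)"

lemma gauss_rep_measurable [measurable (raw)]:
  assumes [measurable]: "f \<in> borel_measurable M" "g \<in> borel_measurable M"
  shows "(\<lambda>z. gauss_rep \<sigma> d (f z) (g z)) \<in> borel_measurable M"
  unfolding gauss_rep_def by measurable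

lemma pos_rep_gauss_ker: "pos_rep (gauss_ker \<sigma> d) x r = gauss_rep \<sigma> d x r"
  by (simp add: pos_rep_def gauss_ker_def)

context
  fixes \<sigma> :: "real^2^2"
  assumes sym: "transpose \<sigma> = \<sigma>" and pos: "\<And>x y. (x, y) \<noteq> (0, 0) \<Longrightarrow> quad2 \<sigma> x y > 0"
begin

lemma det_pos: "det \<sigma> > 0" and det_eq: "det \<sigma> = \<sigma> $ 1 $ 1 * \<sigma> $ 2 $ 2 - (\<sigma> $ 1 $ 2)\<^sup>2"
  using pos_def_2D[OF pos] sym unfolding symmetric_2 by (simp_all add: det_2 power2_eq_square)

text \<open>The exponent of a bivariate normal density is the marginal exponent in q plus the
  conditional exponent in p. Here a is half the conditional variance and w the deviation of p from
  its conditional mean.\<close>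

lemma gauss_rep_fourier:
  "has_bochner_integral lborel (\<lambda>x. gauss_rep \<sigma> d x q * cis (p * x))
     (2 * of_real pi * (let z = vector [q, p] - d
            in of_real (exp (- (z \<bullet> (matrix_inv \<sigma> *v z)) / 2) / (2 * pi * sqrt (det \<sigma>)))))"
proof -
  let ?s = "\<sigma> $ 1 $ 1" and ?t = "\<sigma> $ 1 $ 2" and ?u = "\<sigma> $ 2 $ 2"
  define y where "y = q - d $ 1"
  define w where "w = p - d $ 2 - y * ?t / ?s"
  define a where "a = det \<sigma> / (2 * ?s)"
  have s: "?s > 0" using pos_def_2D[OF pos] by simp
  have a: "a > 0" using det_pos s by (simp add: a_def)
  define C where "C = complex_of_real (1 / sqrt (2 * pi * ?s) * exp (- y\<^sup>2 / (2 * ?s)))"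
  have as: "(?u - ?t\<^sup>2 / ?s) / 2 = a"
    using s by (simp add: a_def det_eq field_simps power2_eq_square)
  have 1: "gauss_rep \<sigma> d x q * cis (p * x) = C * exp (- of_real (a * x\<^sup>2) + (\<i> * of_real w) * of_real x)" for x
  proof -
    have "gauss_rep \<sigma> d x q * cis (p * x) = of_real (1 / sqrt (2 * pi * ?s)) *
      exp (of_real (- y\<^sup>2 / (2 * ?s)) + (- of_real ((?u - ?t\<^sup>2 / ?s) / 2 * x\<^sup>2) + (\<i> * of_real w) * of_real x))"
      unfolding gauss_rep_def cis_conv_exp mult.assoc exp_add[symmetric] y_def[symmetric]
      by (simp add: w_def algebra_simps)
    then show ?thesis unfolding exp_add as C_def by (simp add: exp_of_real[symmetric] flip: exp_add)
  qed
  have "has_bochner_integral lborel (\<lambda>x. gauss_rep \<sigma> d x q * cis (p * x))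
      (C * (of_real (sqrt (pi / a)) * exp ((\<i> * of_real w)\<^sup>2 / (4 * of_real a))))"
    unfolding 1 by (intro has_bochner_integral_mult_right has_bochner_integral_gaussian a)
  also have "C * (of_real (sqrt (pi / a)) * exp ((\<i> * of_real w)\<^sup>2 / (4 * of_real a))) =
      of_real (1 / sqrt (2 * pi * ?s) * sqrt (pi / a) * (exp (- y\<^sup>2 / (2 * ?s)) * exp (- w\<^sup>2 / (4 * a))))"
    by (simp add: C_def power_mult_distrib exp_of_real[symmetric])
  also have "1 / sqrt (2 * pi * ?s) * sqrt (pi / a) = 1 / sqrt (det \<sigma>)"
    using s det_pos by (simp add: a_def real_sqrt_divide real_sqrt_mult field_simps)
  also have "exp (- y\<^sup>2 / (2 * ?s)) * exp (- w\<^sup>2 / (4 * a)) =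
     exp (- ((?u * y\<^sup>2 - 2 * ?t * y * (p - d $ 2) + ?s * (p - d $ 2)\<^sup>2) / det \<sigma>) / 2)"
  proof -
    have "y\<^sup>2 * det \<sigma> + (p - d $ 2 - y * ?t / ?s)\<^sup>2 * ?s\<^sup>2 = ?s * (?u * y\<^sup>2 - 2 * ?t * y * (p - d $ 2) + ?s * (p - d $ 2)\<^sup>2)"
      using s unfolding det_eq by (simp add: field_simps power2_eq_square)
    then have Q: "y\<^sup>2 * det \<sigma> + w\<^sup>2 * ?s\<^sup>2 = ?s * (?u * y\<^sup>2 - 2 * ?t * y * (p - d $ 2) + ?s * (p - d $ 2)\<^sup>2)"
      by (simp only: w_def)
    have "y\<^sup>2 / (2 * ?s) + w\<^sup>2 / (4 * a) = (y\<^sup>2 * det \<sigma> + w\<^sup>2 * ?s\<^sup>2) / (2 * ?s * det \<sigma>)"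
      using s det_pos by (simp add: a_def field_simps power2_eq_square)
    also have "\<dots> = (?u * y\<^sup>2 - 2 * ?t * y * (p - d $ 2) + ?s * (p - d $ 2)\<^sup>2) / det \<sigma> / 2"
      unfolding Q using s by simp
    finally have "y\<^sup>2 / (2 * ?s) + w\<^sup>2 / (4 * a) = (?u * y\<^sup>2 - 2 * ?t * y * (p - d $ 2) + ?s * (p - d $ 2)\<^sup>2) / det \<sigma> / 2" .
    then show ?thesis by (simp flip: exp_add)
  qed
  also have "\<dots> = exp (- ((vector [q, p] - d) \<bullet> (matrix_inv \<sigma> *v (vector [q, p] - d))) / 2)"
    using det_pos by (simp add: matrix_inv_quad_2[OF sym] y_def)
  finally show ?thesis by (simp add: Let_def)
qed

lemma gauss_rep_integrable: "integrable lborel (\<lambda>x. gauss_rep \<sigma> d x q)"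
  using gauss_rep_fourier[of d q 0, THEN integrable.intros] by simp

lemma wigner_gauss_rep:
  assumes "\<And>x. pos_rep K x q = gauss_rep \<sigma> d x q"
  shows "wigner K q p = (let z = vector [q, p] - d
            in of_real (exp (- (z \<bullet> (matrix_inv \<sigma> *v z)) / 2) / (2 * pi * sqrt (det \<sigma>))))"
  using has_bochner_integral_integral_eq[OF gauss_rep_fourier[of d q p]]
  by (simp add: wigner_def assms cis_conv_exp)

end

lemma gaussian_state_withD:
  assumes "gaussian_state_with K \<sigma> d"
  shows "transpose \<sigma> = \<sigma>" "(x, y) \<noteq> (0, 0) \<Longrightarrow> quad2 \<sigma> x y > 0" "density_operator K"
  using assms pos_def_2[of \<sigma>] unfolding gaussian_state_with_def by blast+

text \<open>For almost every q the Wigner condition prescribes the Fourier transform of the section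
  x \<mapsto> \<rho>(x, q), and injectivity fixes that section almost everywhere. Measurability of
  the exceptional set turns this into a statement on the plane.\<close>

lemma gaussian_state_ker:
  assumes K: "gaussian_state_with K \<sigma> d"
  shows "ker_eq K (gauss_ker \<sigma> d)"
proof -
  note D = gaussian_state_withD[OF K]
  have tc: "trace_class K" using D(3) by (auto simp: density_operator_def trace_class_def)
  note Km = pos_rep_measurable[OF trace_class_measurable[OF tc]]
  have "AE q in lborel. AE x in lborel. pos_rep K x q = gauss_rep \<sigma> d x q"
    using K[unfolded gaussian_state_with_def, THEN conjunct2, THEN conjunct2, THEN conjunct2]
  proof eventually_elim
    case (elim q)
    show ?case
    proof (rule fourier_unique)
      show "integrable lborel (\<lambda>x. pos_rep K x q)" using elim by simp
      show "integrable lborel (\<lambda>x. gauss_rep \<sigma> d x q)" by (rule gauss_rep_integrable[OF D(1,2)])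
      fix p
      have "1 / (2 * of_real pi) * (LINT x|lborel. pos_rep K x q * cis (p * x)) = wigner K q p"
        by (simp add: wigner_def cis_conv_exp)
      also have "\<dots> = 1 / (2 * of_real pi) * (LINT x|lborel. gauss_rep \<sigma> d x q * cis (p * x))"
        using has_bochner_integral_integral_eq[OF gauss_rep_fourier[OF D(1,2), of d q p]] elim by simp
      finally show "(LINT x|lborel. pos_rep K x q * cis (p * x)) = (LINT x|lborel. gauss_rep \<sigma> d x q * cis (p * x))"
        by simp
    qed
  qed
  let ?N = "{p. pos_rep K (fst p) (snd p) \<noteq> gauss_rep \<sigma> d (fst p) (snd p)}"
  have N: "?N \<in> sets borel"
  proof -
    have "(\<lambda>p. pos_rep K (fst p) (snd p) - gauss_rep \<sigma> d (fst p) (snd p)) \<in> borel_measurable borel"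
      using Km by measurable
    from measurable_sets[OF this, of "- {0}"] show ?thesis by (simp add: vimage_def)
  qed
  let ?N' = "(\<lambda>(q, x). (x, q)) -` ?N"
  have "?N' \<in> sets borel"
    by (intro borel_set_vimage N) (auto simp: case_prod_unfold intro!: continuous_intros)
  moreover have "AE q in lborel. AE x in lborel. (q, x) \<notin> ?N'"
    using \<open>AE q in lborel. AE x in lborel. _ q x\<close> by simp
  ultimately have "AE x in lborel. AE q in lborel. (x, q) \<notin> ?N"
    using AE_pair_swap[of ?N'] by simp
  from AE_lborel_pairI[OF N this]
  have "AE p in lborel. pos_rep K (fst p) (snd p) = gauss_rep \<sigma> d (fst p) (snd p)" by simp
  from AE_ker_coords[OF this] show ?thesis
    unfolding ker_eq_def case_prod_unfold
    by eventually_elim (simp add: pos_rep_def gauss_ker_def field_simps)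
qed

subsection \<open>Pure Gaussian states\<close>

text \<open>The covariance matrices of determinant 1/4, parametrised by position variance A and
  correlation B.\<close>

definition pure_cov :: "real \<Rightarrow> real \<Rightarrow> real^2^2" where
  "pure_cov A B = vector [vector [A, B], vector [B, (1 / 4 + B\<^sup>2) / A]]"

text \<open>The wave function of the pure Gaussian state: the quadratic phase produces the
  correlation B and the linear phase the mean momentum.\<close>

definition pure_gauss :: "real \<Rightarrow> real \<Rightarrow> real^2 \<Rightarrow> real \<Rightarrow> complex" where
  "pure_gauss A B d q = of_real (1 / sqrt (sqrt (2 * pi * A))) *
     exp (- of_real ((q - d $ 1)\<^sup>2 / (4 * A)) + \<i> * of_real (B / (2 * A) * (q - d $ 1)\<^sup>2 + d $ 2 * q))"

lemma pure_cov_sel [simp]: "pure_cov A B $ 1 $ 1 = A" "pure_cov A B $ 1 $ 2 = B" "pure_cov A B $ 2 $ 1 = B"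
  "pure_cov A B $ 2 $ 2 = (1 / 4 + B\<^sup>2) / A"
  by (simp_all add: pure_cov_def)

context
  fixes A B :: real assumes A: "A > 0"
begin

lemma transpose_pure_cov: "transpose (pure_cov A B) = pure_cov A B"
  by (simp add: symmetric_2)

lemma quad2_pure_cov: "quad2 (pure_cov A B) x y = (A * x + B * y)\<^sup>2 / A + y\<^sup>2 / (4 * A)"
  using A by (simp add: quad2_def field_simps power2_eq_square)

lemma quad2_pure_cov_pos: "(x, y) \<noteq> (0, 0) \<Longrightarrow> quad2 (pure_cov A B) x y > 0"
  unfolding quad2_pure_cov using A by (cases "y = 0") (auto intro!: add_nonneg_pos)

lemma pure_gauss_measurable [measurable]: "pure_gauss A B d \<in> borel_measurable borel"
  unfolding pure_gauss_def by measurable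

lemma norm_pure_gauss: "(cmod (pure_gauss A B d q))\<^sup>2 = 1 / sqrt (2 * pi * A) * exp (- (q - d $ 1)\<^sup>2 / (2 * A))"
  using A by (simp add: pure_gauss_def norm_mult power_mult_distrib power_divide norm_divide field_simps
      flip: exp_of_nat_mult)

lemma L2_norm_pure_gauss: "L2_norm (pure_gauss A B d) = 1" and L2_fun_pure_gauss: "L2_fun (pure_gauss A B d)"
proof -
  have "has_bochner_integral lborel (\<lambda>q. exp (- (q - d $ 1)\<^sup>2 / (2 * A))) (sqrt (2 * pi * A))"
  proof (subst lborel_has_bochner_integral_real_affine_iff[of 1 _ _ "d $ 1"])
    have "has_bochner_integral lborel (\<lambda>k. exp (- complex_of_real (1 / (2 * A) * k\<^sup>2) + 0 * of_real k))
      (of_real (sqrt (pi / (1 / (2 * A)))) * exp (0\<^sup>2 / (4 * of_real (1 / (2 * A)))))"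
      by (rule has_bochner_integral_gaussian) (use A in simp)
    then have "has_bochner_integral lborel (\<lambda>k. complex_of_real (exp (- k\<^sup>2 / (2 * A)))) (of_real (sqrt (2 * pi * A)))"
      by (simp add: exp_of_real[symmetric] mult_ac)
    then show "has_bochner_integral lborel (\<lambda>x. exp (- (d $ 1 + 1 * x - d $ 1)\<^sup>2 / (2 * A))) (sqrt (2 * pi * A) /\<^sub>R \<bar>1\<bar>)"
      by (simp add: has_bochner_integral_iff complex_of_real_integrable_eq)
  qed simp
  from has_bochner_integral_mult_right[OF this, of "1 / sqrt (2 * pi * A)"]
  have h: "has_bochner_integral lborel (\<lambda>q. (cmod (pure_gauss A B d q))\<^sup>2) 1"
    unfolding norm_pure_gauss using A by simp
  then show "L2_norm (pure_gauss A B d) = 1" "L2_fun (pure_gauss A B d)"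
    by (simp_all add: L2_norm_def L2_fun_def has_bochner_integral_iff)
qed

lemma pos_rep_pure_gauss:
  "pos_rep (dyad (pure_gauss A B d) (pure_gauss A B d)) x r = gauss_rep (pure_cov A B) d x r"
proof -
  let ?y = "r - d $ 1"
  have e: "((r - x / 2 - d $ 1)\<^sup>2 / (4 * A)) + ((r + x / 2 - d $ 1)\<^sup>2 / (4 * A)) =
     ?y\<^sup>2 / (2 * A) + ((1 / 4 + B\<^sup>2) / A - B\<^sup>2 / A) * x\<^sup>2 / 2"
    using A by (simp add: field_simps power2_eq_square)
  have e2: "(B / (2 * A) * (r - x / 2 - d $ 1)\<^sup>2 + d $ 2 * (r - x / 2)) - (B / (2 * A) * (r + x / 2 - d $ 1)\<^sup>2 + d $ 2 * (r + x / 2))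
     = - ((?y * B / A + d $ 2) * x)"
    using A by (simp add: field_simps power2_eq_square)
  have c: "1 / sqrt (sqrt (2 * pi * A)) * (1 / sqrt (sqrt (2 * pi * A))) = 1 / sqrt (2 * pi * A)"
    using A by simp
  have cj: "cnj (of_real k * exp (- of_real X + \<i> * of_real Y)) = of_real k * exp (- of_real X - \<i> * of_real Y)"
    for k X Y :: real by (simp add: exp_cnj minus_diff_commute)
  let ?k = "1 / sqrt (sqrt (2 * pi * A))"
  let ?X = "\<lambda>q. (q - d $ 1)\<^sup>2 / (4 * A)" and ?Y = "\<lambda>q. B / (2 * A) * (q - d $ 1)\<^sup>2 + d $ 2 * q"
  have "pos_rep (dyad (pure_gauss A B d) (pure_gauss A B d)) x r =
    (of_real ?k * exp (- of_real (?X (r - x / 2)) + \<i> * of_real (?Y (r - x / 2)))) *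
    (of_real ?k * exp (- of_real (?X (r + x / 2)) - \<i> * of_real (?Y (r + x / 2))))"
    unfolding pos_rep_def dyad_def pure_gauss_def cj ..
  also have "\<dots> = of_real (?k * ?k) * (exp (- of_real (?X (r - x / 2)) + \<i> * of_real (?Y (r - x / 2))) *
    exp (- of_real (?X (r + x / 2)) - \<i> * of_real (?Y (r + x / 2))))"
    by (simp only: of_real_mult mult_ac)
  also have "\<dots> = of_real (?k * ?k) * exp (- of_real (?X (r - x / 2) + ?X (r + x / 2)) + \<i> * of_real (?Y (r - x / 2) - ?Y (r + x / 2)))"
    unfolding exp_add[symmetric] by (simp add: algebra_simps)
  also have "\<dots> = gauss_rep (pure_cov A B) d x r"
    unfolding e e2 c gauss_rep_def by simp
  finally show ?thesis .
qed

lemma gaussian_state_pure: "gaussian_state_with (dyad (pure_gauss A B d) (pure_gauss A B d)) (pure_cov A B) d"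
  unfolding gaussian_state_with_def
proof (intro conjI)
  show "density_operator (dyad (pure_gauss A B d) (pure_gauss A B d))"
    using has_trace_dyad[OF L2_fun_pure_gauss L2_fun_pure_gauss, of d d] block_positive_dyad[OF L2_fun_pure_gauss]
    by (simp add: density_operator_def ip_self L2_norm_pure_gauss)
  show "\<forall>v. v \<noteq> 0 \<longrightarrow> v \<bullet> (pure_cov A B *v v) > 0"
    unfolding pos_def_2[OF transpose_pure_cov] using quad2_pure_cov_pos by blast
  show "AE q in lborel. integrable lborel (\<lambda>x. pos_rep (dyad (pure_gauss A B d) (pure_gauss A B d)) x q) \<and>
        (\<forall>p. wigner (dyad (pure_gauss A B d) (pure_gauss A B d)) q p =
           (let z = vector [q, p] - d
            in of_real (exp (- (z \<bullet> (matrix_inv (pure_cov A B) *v z)) / 2) / (2 * pi * sqrt (det (pure_cov A B))))))"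
  proof (intro AE_I2 conjI allI)
    show "integrable lborel (\<lambda>x. pos_rep (dyad (pure_gauss A B d) (pure_gauss A B d)) x q)" for q
      unfolding pos_rep_pure_gauss by (rule gauss_rep_integrable[OF transpose_pure_cov quad2_pure_cov_pos])
    fix q p
    show "wigner (dyad (pure_gauss A B d) (pure_gauss A B d)) q p =
           (let z = vector [q, p] - d
            in of_real (exp (- (z \<bullet> (matrix_inv (pure_cov A B) *v z)) / 2) / (2 * pi * sqrt (det (pure_cov A B)))))"
      by (rule wigner_gauss_rep[OF transpose_pure_cov quad2_pure_cov_pos pos_rep_pure_gauss])
  qed
qed (rule transpose_pure_cov)

end

subsection \<open>Bounded sesquilinear forms vanishing on coherent states\<close>

text \<open>For |h| \<le> B the perturbation costs at most exp(B |q|). The extra factor exp |q|, in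
  return for widening B to B + 1, leaves room for the factor q that appears on differentiating in
  s.\<close>

lemma norm_gexp_add_le:
  assumes "cmod h \<le> B"
  shows "exp \<bar>q\<bar> * cmod (gexp (s + h) q) \<le> cmod (gexp (s + of_real (B + 1)) q) + cmod (gexp (s - of_real (B + 1)) q)"
proof -
  have "Re h * q \<le> B * \<bar>q\<bar>"
    using assms abs_Re_le_cmod[of h] by (metis abs_ge_self abs_ge_zero abs_mult mult_right_mono order_trans)
  then have "\<bar>q\<bar> + (Re (s + h) * q - q\<^sup>2 / 2) \<le> (Re s * q - q\<^sup>2 / 2) + (B + 1) * \<bar>q\<bar>"
    by (simp add: algebra_simps)
  then have "exp \<bar>q\<bar> * cmod (gexp (s + h) q) \<le> exp ((Re s * q - q\<^sup>2 / 2) + (B + 1) * \<bar>q\<bar>)"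
    unfolding norm_gexp by (simp flip: exp_add)
  also have "\<dots> \<le> exp (Re (s + of_real (B + 1)) * q - q\<^sup>2 / 2) + exp (Re (s - of_real (B + 1)) * q - q\<^sup>2 / 2)"
    by (cases "q \<ge> 0") (auto simp: algebra_simps intro: add_increasing add_increasing2)
  finally show ?thesis unfolding norm_gexp .
qed

definition gexp_dom :: "real \<Rightarrow> complex \<Rightarrow> real \<Rightarrow> complex" where
  "gexp_dom B s q = of_real (cmod (gexp (s + of_real (B + 1)) q) + cmod (gexp (s - of_real (B + 1)) q))"

lemma L2_fun_gexp_dom: "L2_fun (gexp_dom B s)"
proof -
  have *: "L2_fun (\<lambda>q. of_real (cmod (gexp t q)))" for t
  proof (rule L2_fun_bound[OF L2_fun_gexp[of t]])
    show "(\<lambda>q. complex_of_real (cmod (gexp t q))) \<in> borel_measurable borel"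
      using L2_fun_gexp[of t, THEN L2_fun_measurable] by measurable
  qed simp
  show ?thesis using L2_fun_add[OF * *] by (simp add: gexp_dom_def[abs_def])
qed

lemma cmod_gexp_dom: "cmod (gexp_dom B s q) = cmod (gexp (s + of_real (B + 1)) q) + cmod (gexp (s - of_real (B + 1)) q)"
  unfolding gexp_dom_def norm_of_real by simp

lemma gexp_L2_tendsto:
  assumes h: "h \<longlonglongrightarrow> 0"
  shows "(\<lambda>n. L2_norm (\<lambda>q. gexp (s + h n) q - gexp s q)) \<longlonglongrightarrow> 0"
proof -
  obtain B where B: "\<And>n. cmod (h n) \<le> B"
    using convergent_imp_Bseq[OF convergentI[OF h]] by (auto simp: Bseq_def)
  show ?thesis
  proof (rule L2_norm_dominated[OF _ _ L2_fun_gexp_dom[of B s]])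
    fix n q
    have "cmod (gexp (s + h n) q) \<le> exp \<bar>q\<bar> * cmod (gexp (s + h n) q)"
      by (simp add: mult_le_cancel_right1)
    also note norm_gexp_add_le[OF B]
    finally show "cmod (gexp (s + h n) q) \<le> cmod (gexp_dom B s q)"
      unfolding cmod_gexp_dom .
  next
    fix q
    have "(\<lambda>n. gexp (s + h n) q) \<longlonglongrightarrow> gexp (s + 0) q"
      unfolding gexp_def by (intro tendsto_intros h)
    then show "(\<lambda>n. gexp (s + h n) q) \<longlonglongrightarrow> gexp s q" by simp
  qed measurable
qed

lemma L2_fun_gexp_deriv: "L2_fun (\<lambda>q. of_real q * gexp s q)"
proof (rule L2_fun_bound[OF L2_fun_gexp_dom[of 0 s]])
  fix q :: real
  have "\<bar>q\<bar> \<le> exp \<bar>q\<bar>" using exp_ge_add_one_self[of "\<bar>q\<bar>"] by linarith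
  then have "cmod (of_real q * gexp s q) \<le> exp \<bar>q\<bar> * cmod (gexp (s + 0) q)"
    by (auto simp: norm_mult intro: mult_right_mono)
  also note norm_gexp_add_le[of 0 0]
  finally show "cmod (of_real q * gexp s q) \<le> cmod (gexp_dom 0 s q)"
    unfolding cmod_gexp_dom by simp
qed measurable

lemma gexp_L2_derivative:
  assumes h: "h \<longlonglongrightarrow> 0" and nz: "\<And>n. h n \<noteq> 0"
  shows "(\<lambda>n. L2_norm (\<lambda>q. 1 / h n * (gexp (s + h n) q - gexp s q) - of_real q * gexp s q)) \<longlonglongrightarrow> 0"
proof -
  obtain B where B: "\<And>n. cmod (h n) \<le> B"
    using convergent_imp_Bseq[OF convergentI[OF h]] by (auto simp: Bseq_def)
  have e: "gexp (s + k) q - gexp s q = gexp s q * (exp (k * of_real q) - 1)" for k q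
    by (simp add: gexp_def algebra_simps flip: exp_add)
  have q_le: "\<bar>q\<bar> \<le> exp \<bar>q\<bar>" for q :: real using exp_ge_add_one_self[of "\<bar>q\<bar>"] by linarith
  show "(\<lambda>n. L2_norm (\<lambda>q. 1 / h n * (gexp (s + h n) q - gexp s q) - of_real q * gexp s q)) \<longlonglongrightarrow> 0"
  proof (rule L2_norm_dominated[OF _ _ L2_fun_gexp_dom[of B s]])
    fix n q
    have "cmod (1 / h n * (gexp (s + h n) q - gexp s q)) =
        cmod (gexp s q) * cmod (exp (h n * of_real q) - 1) / cmod (h n)"
      unfolding e by (simp add: norm_mult norm_divide)
    \<comment> \<open>The Taylor bound of order zero, |exp z - 1| \<le> exp |Re z| * |z|. Its factor
      |h n| cancels the denominator and |q| is then absorbed by exp |q|.\<close>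
    also have "\<dots> \<le> cmod (gexp s q) * (exp \<bar>Re (h n * of_real q)\<bar> * cmod (h n * of_real q)) / cmod (h n)"
      using Taylor_exp[of "h n * of_real q" 0] by (intro divide_right_mono mult_left_mono) auto
    also have "\<dots> = cmod (gexp s q) * exp (\<bar>Re (h n)\<bar> * \<bar>q\<bar>) * \<bar>q\<bar>"
      using nz[of n] by (simp add: norm_mult abs_mult)
    also have "\<dots> \<le> cmod (gexp s q) * exp (B * \<bar>q\<bar>) * exp \<bar>q\<bar>"
      using abs_Re_le_cmod[of "h n"] B[of n] q_le[of q]
      by (intro mult_mono) (auto intro: mult_right_mono)
    also have "\<dots> = exp \<bar>q\<bar> * cmod (gexp (s + of_real (sgn q * B)) q)"
      by (simp add: norm_gexp sgn_if algebra_simps flip: exp_add)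
    also have "\<dots> \<le> cmod (gexp_dom B s q)"
      unfolding cmod_gexp_dom using order_trans[OF norm_ge_zero B[of n]]
      by (intro norm_gexp_add_le) (unfold norm_of_real, auto simp: abs_mult sgn_if)
    finally show "cmod (1 / h n * (gexp (s + h n) q - gexp s q)) \<le> cmod (gexp_dom B s q)" .
  next
    fix q
    have "((\<lambda>z::complex. exp (z * of_real q)) has_field_derivative of_real q) (at 0)"
      by (auto intro!: derivative_eq_intros)
    then have "(\<lambda>z::complex. (exp (z * of_real q) - 1) / z) \<midarrow>0\<rightarrow> of_real q"
      by (simp add: has_field_derivative_iff)
    then have "(\<lambda>n. (exp (h n * of_real q) - 1) / h n) \<longlonglongrightarrow> of_real q"
      by (rule filterlim_compose[OF _ filterlim_atI[OF h]]) (simp add: nz)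
    then have "(\<lambda>n. gexp s q * ((exp (h n * of_real q) - 1) / h n)) \<longlonglongrightarrow> gexp s q * of_real q"
      by (intro tendsto_intros)
    then show "(\<lambda>n. 1 / h n * (gexp (s + h n) q - gexp s q)) \<longlonglongrightarrow> of_real q * gexp s q"
      unfolding e by (simp add: mult_ac)
  qed measurable
qed

text \<open>Linear in the first and conjugate linear in the second argument, as the dyad |f><g| is;
  this is the opposite of the convention of \<open>ip\<close>.\<close>

locale bounded_sesquilinear =
  fixes F :: "(real \<Rightarrow> complex) \<Rightarrow> (real \<Rightarrow> complex) \<Rightarrow> complex" and M :: real
  assumes add_left: "L2_fun f \<Longrightarrow> L2_fun f' \<Longrightarrow> L2_fun g \<Longrightarrow> F (\<lambda>q. f q + f' q) g = F f g + F f' g"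
    and add_right: "L2_fun f \<Longrightarrow> L2_fun g \<Longrightarrow> L2_fun g' \<Longrightarrow> F f (\<lambda>q. g q + g' q) = F f g + F f g'"
    and cmult_left: "L2_fun f \<Longrightarrow> L2_fun g \<Longrightarrow> F (\<lambda>q. c * f q) g = c * F f g"
    and cmult_right: "L2_fun f \<Longrightarrow> L2_fun g \<Longrightarrow> F f (\<lambda>q. c * g q) = cnj c * F f g"
    and bound: "L2_fun f \<Longrightarrow> L2_fun g \<Longrightarrow> cmod (F f g) \<le> M * (L2_norm f * L2_norm g)"
begin

lemma diff_left: "L2_fun f \<Longrightarrow> L2_fun f' \<Longrightarrow> L2_fun g \<Longrightarrow> F (\<lambda>q. f q - f' q) g = F f g - F f' g"
  using add_left[of f "\<lambda>q. -1 * f' q" g] cmult_left[of f' g "-1"] L2_fun_cmult[of f' "-1"] by simp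

lemma diff_right: "L2_fun f \<Longrightarrow> L2_fun g \<Longrightarrow> L2_fun g' \<Longrightarrow> F f (\<lambda>q. g q - g' q) = F f g - F f g'"
  using add_right[of f g "\<lambda>q. -1 * g' q"] cmult_right[of f g' "-1"] L2_fun_cmult[of g' "-1"] by simp

lemma tendsto_left:
  assumes u: "\<And>n. L2_fun (u n)" and f: "L2_fun f" and g: "L2_fun g"
    and lim: "(\<lambda>n. L2_norm (\<lambda>q. u n q - f q)) \<longlonglongrightarrow> 0"
  shows "(\<lambda>n. F (u n) g) \<longlonglongrightarrow> F f g"
proof -
  have "(\<lambda>n. F (u n) g - F f g) \<longlonglongrightarrow> 0"
  proof (rule Lim_null_comparison)
    show "\<forall>\<^sub>F n in sequentially. norm (F (u n) g - F f g) \<le> M * (L2_norm (\<lambda>q. u n q - f q) * L2_norm g)"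
      using bound[OF L2_fun_diff[OF u f] g] by (simp add: diff_left u f g)
    show "(\<lambda>n. M * (L2_norm (\<lambda>q. u n q - f q) * L2_norm g)) \<longlonglongrightarrow> 0"
      using tendsto_mult_left[OF tendsto_mult_right[OF lim, of "L2_norm g"], of M] by simp
  qed
  then show ?thesis by (simp add: LIM_zero_iff)
qed

lemma tendsto_right:
  assumes w: "\<And>n. L2_fun (w n)" and f: "L2_fun f" and g: "L2_fun g"
    and lim: "(\<lambda>n. L2_norm (\<lambda>q. w n q - g q)) \<longlonglongrightarrow> 0"
  shows "(\<lambda>n. F f (w n)) \<longlonglongrightarrow> F f g"
proof -
  have "(\<lambda>n. F f (w n) - F f g) \<longlonglongrightarrow> 0"
  proof (rule Lim_null_comparison)
    show "\<forall>\<^sub>F n in sequentially. norm (F f (w n) - F f g) \<le> M * (L2_norm f * L2_norm (\<lambda>q. w n q - g q))"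
      using bound[OF f L2_fun_diff[OF w g]] by (simp add: diff_right w f g)
    show "(\<lambda>n. M * (L2_norm f * L2_norm (\<lambda>q. w n q - g q))) \<longlonglongrightarrow> 0"
      using tendsto_mult_left[OF tendsto_mult_left[OF lim, of "L2_norm f"], of M] by simp
  qed
  then show ?thesis by (simp add: LIM_zero_iff)
qed

lemma tendsto_both:
  assumes u: "\<And>n. L2_fun (u n)" and w: "\<And>n. L2_fun (w n)" and f: "L2_fun f" and g: "L2_fun g"
    and limu: "(\<lambda>n. L2_norm (\<lambda>q. u n q - f q)) \<longlonglongrightarrow> 0"
    and limw: "(\<lambda>n. L2_norm (\<lambda>q. w n q - g q)) \<longlonglongrightarrow> 0"
  shows "(\<lambda>n. F (u n) (w n)) \<longlonglongrightarrow> F f g"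
proof -
  \<comment> \<open>The mixed difference equals F(u n - f, w n - g), so it tends to zero without a
    separate bound on the norms of u n.\<close>
  have "(\<lambda>n. F (u n) (w n) - F (u n) g - F f (w n) + F f g) \<longlonglongrightarrow> 0"
  proof (rule Lim_null_comparison)
    have "F (u n) (w n) - F (u n) g - F f (w n) + F f g = F (\<lambda>q. u n q - f q) (\<lambda>q. w n q - g q)" for n
      by (simp add: diff_left diff_right L2_fun_diff u w f g)
    then show "\<forall>\<^sub>F n in sequentially. norm (F (u n) (w n) - F (u n) g - F f (w n) + F f g) \<le>
        M * (L2_norm (\<lambda>q. u n q - f q) * L2_norm (\<lambda>q. w n q - g q))"
      using bound[OF L2_fun_diff[OF u f] L2_fun_diff[OF w g]] by simp
    show "(\<lambda>n. M * (L2_norm (\<lambda>q. u n q - f q) * L2_norm (\<lambda>q. w n q - g q))) \<longlonglongrightarrow> 0"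
      using tendsto_mult_left[OF tendsto_mult[OF limu limw], of M] by simp
  qed
  from tendsto_diff[OF tendsto_add[OF tendsto_add[OF this tendsto_left[OF u f g limu]] tendsto_right[OF w f g limw]]
      tendsto_const[of "F f g"]]
  show ?thesis by simp
qed

text \<open>The conjugate in the second slot compensates its conjugate linearity, so the dependence
  on z is holomorphic; for real z both slots carry the same vector.\<close>

definition slice :: "complex \<Rightarrow> complex \<Rightarrow> complex" where
  "slice c z = F (gexp (z + c)) (gexp (cnj z + c))"

lemma slice_holomorphic: "slice c holomorphic_on UNIV"
  unfolding holomorphic_on_def
proof
  fix z
  let ?D = "F (\<lambda>q. of_real q * gexp (z + c) q) (gexp (cnj z + c)) + F (gexp (z + c)) (\<lambda>q. of_real q * gexp (cnj z + c) q)"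
  have "((\<lambda>h. (slice c (z + h) - slice c z) / h) \<longlongrightarrow> ?D) (at 0)"
    unfolding tendsto_at_iff_sequentially
  proof (intro allI impI)
    fix h assume hn: "\<forall>i. h i \<in> UNIV - {0 :: complex}" and h: "h \<longlonglongrightarrow> 0"
    have nz: "h n \<noteq> 0" for n using hn by auto
    have h': "(\<lambda>n. cnj (h n)) \<longlonglongrightarrow> 0" using tendsto_cnj[OF h] by simp
    have nz': "cnj (h n) \<noteq> 0" for n using nz by simp
    let ?s = "z + c" and ?t = "cnj z + c"
    let ?u = "\<lambda>n q. 1 / h n * (gexp (?s + h n) q - gexp ?s q)"
    \<comment> \<open>The increment in the second slot is the conjugate of h n, and conjugate
      linearity turns 1 / cnj (h n) back into 1 / h n. The two quotients \<open>?u\<close> and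
      \<open>?w\<close> add up as in the product rule.\<close>
    let ?w = "\<lambda>n q. 1 / cnj (h n) * (gexp (?t + cnj (h n)) q - gexp ?t q)"
    have L: "L2_fun (?u n)" "L2_fun (?w n)" for n
      by (intro L2_fun_cmult L2_fun_diff L2_fun_gexp)+
    have "(\<lambda>n. F (?u n) (gexp (?t + cnj (h n)))) \<longlonglongrightarrow> F (\<lambda>q. of_real q * gexp ?s q) (gexp ?t)"
      by (intro tendsto_both L L2_fun_gexp L2_fun_gexp_deriv gexp_L2_derivative gexp_L2_tendsto h h' nz)
    moreover have "(\<lambda>n. F (gexp ?s) (?w n)) \<longlonglongrightarrow> F (gexp ?s) (\<lambda>q. of_real q * gexp ?t q)"
      by (intro tendsto_right L L2_fun_gexp L2_fun_gexp_deriv gexp_L2_derivative h h' nz nz')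
    moreover have "F (?u n) (gexp (?t + cnj (h n))) + F (gexp ?s) (?w n) = (slice c (z + h n) - slice c z) / h n" for n
    proof -
      have "F (?u n) (gexp (?t + cnj (h n))) = 1 / h n * (F (gexp (?s + h n)) (gexp (?t + cnj (h n))) - F (gexp ?s) (gexp (?t + cnj (h n))))"
        by (subst cmult_left) (auto intro!: L2_fun_diff L2_fun_gexp simp: diff_left L2_fun_gexp)
      moreover have "F (gexp ?s) (?w n) = 1 / h n * (F (gexp ?s) (gexp (?t + cnj (h n))) - F (gexp ?s) (gexp ?t))"
        by (subst cmult_right) (auto intro!: L2_fun_diff L2_fun_gexp simp: diff_right L2_fun_gexp)
      ultimately show ?thesis
        unfolding slice_def by (simp add: add_ac diff_divide_distrib)
    qed
    ultimately show "((\<lambda>h. (slice c (z + h) - slice c z) / h) \<circ> h) \<longlonglongrightarrow> ?D"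
      using tendsto_add[of "\<lambda>n. F (?u n) (gexp (?t + cnj (h n)))" _ _ "\<lambda>n. F (gexp ?s) (?w n)"] by (simp add: o_def)
  qed
  then have "(slice c has_field_derivative ?D) (at z)" by (simp add: DERIV_def)
  then show "slice c field_differentiable at z within UNIV"
    by (auto simp: field_differentiable_def)
qed

lemma zero_of_coherent_zero:
  assumes diag: "\<And>s. F (gexp s) (gexp s) = 0" and f: "L2_fun f" and g: "L2_fun g"
  shows "F f g = 0"
proof -
  have off: "F (gexp (\<i> * of_real a)) (gexp (\<i> * of_real b)) = 0" for a b
  proof -
    \<comment> \<open>The solution of z + c = \<i> a and cnj z + c = \<i> b with imaginary z and c,
      so that the slice passes through the wanted off-diagonal pair.\<close>
    let ?c = "\<i> * of_real ((a + b) / 2)" and ?z = "\<i> * of_real ((a - b) / 2)"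
    have "slice ?c ?z = 0"
    proof (rule analytic_continuation[OF slice_holomorphic open_UNIV connected_UNIV])
      show "(0 :: complex) islimpt range of_real"
        unfolding islimpt_sequential
      proof (intro exI conjI allI)
        show "complex_of_real (1 / real (Suc n)) \<in> range of_real - {0}" for n
          using of_real_eq_0_iff[of "1 / real (Suc n)", where 'a=complex] by (metis Diff_iff divide_eq_0_iff of_nat_eq_0_iff
            old.nat.distinct(2) rangeI singletonD zero_neq_one)
        show "(\<lambda>n. complex_of_real (1 / real (Suc n))) \<longlonglongrightarrow> 0"
        proof -
          have "(\<lambda>n. complex_of_real (1 / real (Suc n))) \<longlonglongrightarrow> of_real 0"
            by (intro tendsto_of_real LIMSEQ_Suc lim_1_over_n)
          then show ?thesis by simp
        qed
      qed
      show "slice ?c x = 0" if "x \<in> range of_real" for x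
        using that diag by (auto simp: slice_def)
    qed auto
    moreover have "?z + ?c = \<i> * of_real a" "cnj ?z + ?c = \<i> * of_real b"
      by (auto simp: complex_eq_iff field_simps)
    ultimately show ?thesis by (simp add: slice_def)
  qed
  have left: "F f (gexp (\<i> * of_real b)) = 0" if "L2_fun f" for b f
    using _ _ _ _ that
  proof (rule L2_gexp_induct[where S = "\<lambda>f. F f (gexp (\<i> * of_real b)) = 0"])
    fix u f assume a: "\<And>n. L2_fun (u n)" "L2_fun f" "\<And>n. F (u n) (gexp (\<i> * of_real b)) = 0"
      "(\<lambda>n. L2_norm (\<lambda>x. u n x - f x)) \<longlonglongrightarrow> 0"
    from tendsto_left[OF a(1,2) L2_fun_gexp[of "\<i> * of_real b"] a(4)] show "F f (gexp (\<i> * of_real b)) = 0"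
      by (simp add: a(3) LIMSEQ_const_iff)
  qed (auto simp: add_left cmult_left L2_fun_gexp off)
  show ?thesis
    using _ _ _ _ g
  proof (rule L2_gexp_induct[where S = "\<lambda>g. F f g = 0"])
    fix u g assume a: "\<And>n. L2_fun (u n)" "L2_fun g" "\<And>n. F f (u n) = 0"
      "(\<lambda>n. L2_norm (\<lambda>x. u n x - g x)) \<longlonglongrightarrow> 0"
    from tendsto_right[OF a(1) f a(2) a(4)] show "F f g = 0"
      by (simp add: a(3) LIMSEQ_const_iff)
  qed (auto simp: add_right cmult_right f left)
qed

end

subsection \<open>Characteristic functions\<close>

lemma
  assumes f: "L2_fun f"
  shows L2_fun_shift: "L2_fun (\<lambda>q. f (q + c))" and L2_norm_shift: "L2_norm (\<lambda>q. f (q + c)) = L2_norm f"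
proof -
  note [measurable] = f[THEN L2_fun_measurable]
  have "has_bochner_integral lborel (\<lambda>q. (cmod (f q))\<^sup>2) ((L2_norm f)\<^sup>2)"
    using L2_fun_integrable[OF f] by (simp add: has_bochner_integral_iff L2_norm_power2)
  from lborel_has_bochner_integral_real_affine_iff[THEN iffD1, OF _ this, of 1 c]
  have h: "has_bochner_integral lborel (\<lambda>q. (cmod (f (q + c)))\<^sup>2) ((L2_norm f)\<^sup>2)" by (simp add: add.commute)
  show "L2_fun (\<lambda>q. f (q + c))"
    unfolding L2_fun_def using h by (auto simp: has_bochner_integral_iff)
  show "L2_norm (\<lambda>q. f (q + c)) = L2_norm f"
    using h unfolding L2_norm_def[of "\<lambda>q. f (q + c)"] by (simp add: has_bochner_integral_iff)
qed

text \<open>The quantum characteristic function of the dyad: the position representation is Fourier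
  transformed in the centre coordinate r only, while \<xi> is the difference coordinate
  itself.\<close>

definition chi :: "(real \<Rightarrow> complex) \<Rightarrow> (real \<Rightarrow> complex) \<Rightarrow> real \<Rightarrow> real \<Rightarrow> complex" where
  "chi \<psi> \<phi> \<kappa> \<xi> = (LINT r|lborel. \<psi> (r - \<xi> / 2) * cnj (\<phi> (r + \<xi> / 2)) * cis (- (\<kappa> * r)))"

lemma chi_measurable:
  assumes [measurable]: "\<psi> \<in> borel_measurable borel" "\<phi> \<in> borel_measurable borel"
    "f \<in> borel_measurable M" "g \<in> borel_measurable M"
  shows "(\<lambda>z. chi \<psi> \<phi> (f z) (g z)) \<in> borel_measurable M"
  unfolding chi_def by measurable

lemma chi_integrable:
  assumes "L2_fun \<psi>" "L2_fun \<phi>"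
  shows "integrable lborel (\<lambda>r. \<psi> (r - \<xi> / 2) * cnj (\<phi> (r + \<xi> / 2)) * cis (- (\<kappa> * r)))"
proof (rule Bochner_Integration.integrable_bound)
  note [measurable] = assms[THEN L2_fun_measurable]
  show "integrable lborel (\<lambda>r. \<psi> (r - \<xi> / 2) * cnj (\<phi> (r + \<xi> / 2)))"
    using L2_mult_integrable[OF L2_fun_shift[OF assms(1), of "- \<xi> / 2"] L2_fun_cnj[OF L2_fun_shift[OF assms(2), of "\<xi> / 2"]]]
    by simp
  show "(\<lambda>r. \<psi> (r - \<xi> / 2) * cnj (\<phi> (r + \<xi> / 2)) * cis (- (\<kappa> * r))) \<in> borel_measurable lborel" by measurable
qed (auto simp: norm_mult)

lemma chi_abs_integral:
  assumes "L2_fun \<psi>" "L2_fun \<phi>"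
  shows "(LINT r|lborel. cmod (\<psi> (r - \<xi> / 2)) * cmod (\<phi> (r + \<xi> / 2))) \<le> L2_norm \<psi> * L2_norm \<phi>"
  using Cauchy_Schwarz_L2[OF L2_fun_shift[OF assms(1), of "- \<xi> / 2"] L2_fun_shift[OF assms(2), of "\<xi> / 2"]]
  by (simp add: L2_norm_shift[OF assms(1), of "- \<xi> / 2", simplified] L2_norm_shift[OF assms(2)])

lemma chi_bound:
  assumes "L2_fun \<psi>" "L2_fun \<phi>"
  shows "cmod (chi \<psi> \<phi> \<kappa> \<xi>) \<le> L2_norm \<psi> * L2_norm \<phi>"
proof -
  have "cmod (chi \<psi> \<phi> \<kappa> \<xi>) \<le> (LINT r|lborel. cmod (\<psi> (r - \<xi> / 2)) * cmod (\<phi> (r + \<xi> / 2)))"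
    using integral_norm_bound[of lborel "\<lambda>r. \<psi> (r - \<xi> / 2) * cnj (\<phi> (r + \<xi> / 2)) * cis (- (\<kappa> * r))"]
    by (simp add: chi_def norm_mult)
  also note chi_abs_integral[OF assms]
  finally show ?thesis .
qed

lemma chi_add_left: "L2_fun \<psi> \<Longrightarrow> L2_fun \<psi>' \<Longrightarrow> L2_fun \<phi> \<Longrightarrow>
  chi (\<lambda>q. \<psi> q + \<psi>' q) \<phi> \<kappa> \<xi> = chi \<psi> \<phi> \<kappa> \<xi> + chi \<psi>' \<phi> \<kappa> \<xi>"
  by (simp add: chi_def distrib_right chi_integrable)

lemma chi_add_right: "L2_fun \<psi> \<Longrightarrow> L2_fun \<phi> \<Longrightarrow> L2_fun \<phi>' \<Longrightarrow>
  chi \<psi> (\<lambda>q. \<phi> q + \<phi>' q) \<kappa> \<xi> = chi \<psi> \<phi> \<kappa> \<xi> + chi \<psi> \<phi>' \<kappa> \<xi>"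
  by (simp add: chi_def distrib_right distrib_left chi_integrable)

lemma chi_cmult_left: "chi (\<lambda>q. c * \<psi> q) \<phi> \<kappa> \<xi> = c * chi \<psi> \<phi> \<kappa> \<xi>"
  by (simp add: chi_def mult.assoc)

lemma chi_cmult_right: "chi \<psi> (\<lambda>q. c * \<phi> q) \<kappa> \<xi> = cnj c * chi \<psi> \<phi> \<kappa> \<xi>"
proof -
  have *: "\<psi> (r - \<xi> / 2) * cnj (c * \<phi> (r + \<xi> / 2)) * cis (- (\<kappa> * r)) =
    cnj c * (\<psi> (r - \<xi> / 2) * cnj (\<phi> (r + \<xi> / 2)) * cis (- (\<kappa> * r)))" for r
    by (simp add: mult_ac)
  show ?thesis unfolding chi_def * by simp
qed

definition gauss_char :: "real^2^2 \<Rightarrow> real^2 \<Rightarrow> real \<Rightarrow> real \<Rightarrow> complex" where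
  "gauss_char \<sigma> d k x = exp (- of_real (quad2 \<sigma> k x / 2) - \<i> * of_real (k * d $ 1 + x * d $ 2))"

lemma gauss_char_measurable [measurable (raw)]:
  assumes [measurable]: "f \<in> borel_measurable M" "g \<in> borel_measurable M"
  shows "(\<lambda>z. gauss_char \<sigma> d (f z) (g z)) \<in> borel_measurable M"
  unfolding gauss_char_def quad2_def by measurable

lemma norm_gauss_char: "cmod (gauss_char \<sigma> d k x) = exp (- quad2 \<sigma> k x / 2)"
  by (simp add: gauss_char_def)

lemma gauss_rep_char:
  assumes s: "\<sigma> $ 1 $ 1 > 0"
  shows "(LINT r|lborel. gauss_rep \<sigma> d \<xi> r * cis (- (\<kappa> * r))) = gauss_char \<sigma> d \<kappa> \<xi>"
proof -
  let ?s = "\<sigma> $ 1 $ 1" and ?t = "\<sigma> $ 1 $ 2" and ?u = "\<sigma> $ 2 $ 2"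
  define w where "w = \<xi> * ?t / ?s + \<kappa>"
  define C where "C = complex_of_real (1 / sqrt (2 * pi * ?s)) *
    exp (- of_real ((?u - ?t\<^sup>2 / ?s) * \<xi>\<^sup>2 / 2) - \<i> * of_real (d $ 2 * \<xi> + \<kappa> * d $ 1))"
  have 1: "gauss_rep \<sigma> d \<xi> (d $ 1 + 1 * y) * cis (- (\<kappa> * (d $ 1 + 1 * y))) =
    C * exp (- of_real (1 / (2 * ?s) * y\<^sup>2) + (- \<i> * of_real w) * of_real y)" for y
    unfolding gauss_rep_def C_def cis_conv_exp mult.assoc exp_add[symmetric]
    by (simp add: w_def algebra_simps add_divide_distrib)
  have "(LINT r|lborel. gauss_rep \<sigma> d \<xi> r * cis (- (\<kappa> * r))) =
    (LINT y|lborel. gauss_rep \<sigma> d \<xi> (d $ 1 + 1 * y) * cis (- (\<kappa> * (d $ 1 + 1 * y))))"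
    by (subst lborel_integral_real_affine[where c = 1 and t = "d $ 1"]) auto
  also have "\<dots> = C * (of_real (sqrt (pi / (1 / (2 * ?s)))) * exp ((- \<i> * of_real w)\<^sup>2 / (4 * of_real (1 / (2 * ?s)))))"
    unfolding 1 by (simp only: integral_mult_right_zero) (subst integral_gaussian, use s in auto)
  also have "\<dots> = of_real (1 / sqrt (2 * pi * ?s) * sqrt (pi / (1 / (2 * ?s)))) *
    exp (- of_real ((?u - ?t\<^sup>2 / ?s) * \<xi>\<^sup>2 / 2 + w\<^sup>2 * ?s / 2) - \<i> * of_real (d $ 2 * \<xi> + \<kappa> * d $ 1))"
    unfolding C_def by (simp add: power_mult_distrib mult_exp_exp algebra_simps)
  also have "1 / sqrt (2 * pi * ?s) * sqrt (pi / (1 / (2 * ?s))) = 1"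
    using s by (simp add: mult_ac)
  also have "(?u - ?t\<^sup>2 / ?s) * \<xi>\<^sup>2 / 2 + w\<^sup>2 * ?s / 2 = quad2 \<sigma> \<kappa> \<xi> / 2"
    using s by (simp add: quad2_def w_def field_simps power2_eq_square)
  finally show ?thesis by (simp add: gauss_char_def algebra_simps)
qed

lemma sqrt_divide_conv: "0 < x \<Longrightarrow> 0 < y \<Longrightarrow> sqrt (x / y) = x / sqrt (x * y)"
  by (simp add: real_sqrt_divide real_sqrt_mult real_div_sqrt flip: divide_divide_eq_left)

text \<open>Only \<sigma>11 enters as the coefficient of k^2, so its positivity is enough for the
  integral. The formula serves for output covariances and also for the noise matrix
  \<open>N\<close>.\<close>

lemma gauss_char_inverse:
  assumes s: "\<sigma> $ 1 $ 1 > 0"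
  shows "1 / (2 * of_real pi) * (LINT k|lborel. cis (k * r) * gauss_char \<sigma> d k x) = gauss_rep \<sigma> d x r"
proof -
  let ?s = "\<sigma> $ 1 $ 1" and ?t = "\<sigma> $ 1 $ 2" and ?u = "\<sigma> $ 2 $ 2"
  define y where "y = r - d $ 1"
  define C where "C = exp (- complex_of_real (?u * x\<^sup>2 / 2) - \<i> * of_real (x * d $ 2))"
  let ?b = "\<i> * of_real y - of_real (?t * x)"
  have 1: "cis (k * r) * gauss_char \<sigma> d k x = C * exp (- of_real (?s / 2 * k\<^sup>2) + ?b * of_real k)" for k
    unfolding gauss_char_def C_def cis_conv_exp exp_add[symmetric]
    by (simp add: y_def quad2_def algebra_simps add_divide_distrib)
  have "(LINT k|lborel. cis (k * r) * gauss_char \<sigma> d k x) = C * (of_real (sqrt (pi / (?s / 2))) * exp (?b\<^sup>2 / (4 * of_real (?s / 2))))"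
    unfolding 1 by (simp only: integral_mult_right_zero) (subst integral_gaussian, use s in auto)
  also have "?b\<^sup>2 / (4 * of_real (?s / 2)) = - of_real (y\<^sup>2 / (2 * ?s)) + of_real (?t\<^sup>2 * x\<^sup>2 / (2 * ?s)) - \<i> * of_real (y * ?t / ?s * x)"
    using s by (simp add: power2_eq_square field_simps)
  finally have "1 / (2 * of_real pi) * (LINT k|lborel. cis (k * r) * gauss_char \<sigma> d k x) =
     of_real (1 / (2 * pi) * sqrt (pi / (?s / 2))) *
     (C * exp (- of_real (y\<^sup>2 / (2 * ?s)) + of_real (?t\<^sup>2 * x\<^sup>2 / (2 * ?s)) - \<i> * of_real (y * ?t / ?s * x)))"
    by simp
  also have "1 / (2 * pi) * sqrt (pi / (?s / 2)) = 1 / sqrt (2 * pi * ?s)"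
  proof -
    have "2 * pi = sqrt (2 * pi) * sqrt (2 * pi)" by simp
    then have "1 / (2 * pi) * sqrt (pi / (?s / 2)) = sqrt (2 * pi) / sqrt ?s / (sqrt (2 * pi) * sqrt (2 * pi))"
      by (metis (no_types, opaque_lifting) divide_divide_eq_right mult.commute real_sqrt_divide times_divide_eq_left mult_1)
    then show ?thesis by (simp add: real_sqrt_mult)
  qed
  also have "C * exp (- of_real (y\<^sup>2 / (2 * ?s)) + of_real (?t\<^sup>2 * x\<^sup>2 / (2 * ?s)) - \<i> * of_real (y * ?t / ?s * x)) =
     exp (- of_real (y\<^sup>2 / (2 * ?s) + (?u - ?t\<^sup>2 / ?s) * x\<^sup>2 / 2) - \<i> * of_real ((y * ?t / ?s + d $ 2) * x))"
    unfolding C_def exp_add[symmetric] by (rule arg_cong[where f = exp]) (use s in \<open>simp add: field_simps\<close>)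
  finally show ?thesis by (simp add: gauss_rep_def y_def)
qed

lemma chi_pure_gauss:
  assumes "A > 0"
  shows "chi (pure_gauss A B d) (pure_gauss A B d) \<kappa> \<xi> = gauss_char (pure_cov A B) d \<kappa> \<xi>"
proof -
  have "pure_gauss A B d (r - \<xi> / 2) * cnj (pure_gauss A B d (r + \<xi> / 2)) = gauss_rep (pure_cov A B) d \<xi> r" for r
    using pos_rep_pure_gauss[OF assms, of B d \<xi> r] by (simp add: pos_rep_def dyad_def)
  then show ?thesis
    unfolding chi_def by (simp add: gauss_rep_char assms)
qed

subsection \<open>The kernel attached to a characteristic function\<close>

definition transform_cov :: "real^2^2 \<Rightarrow> real^2^2 \<Rightarrow> real^2^2 \<Rightarrow> real^2^2" where
  "transform_cov T N \<sigma> = T ** \<sigma> ** transpose T + N"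

lemma transform_cov_sel:
  assumes "transpose \<sigma> = \<sigma>"
  shows "transform_cov T N \<sigma> $ i $ j = \<sigma> $ 1 $ 1 * T $ i $ 1 * T $ j $ 1 +
    \<sigma> $ 1 $ 2 * (T $ i $ 1 * T $ j $ 2 + T $ i $ 2 * T $ j $ 1) + \<sigma> $ 2 $ 2 * T $ i $ 2 * T $ j $ 2 + N $ i $ j"
  using assms unfolding symmetric_2
  by (simp add: transform_cov_def matrix_matrix_mult_def transpose_def sum_2 algebra_simps)

lemma quad2_transform_cov:
  assumes "transpose \<sigma> = \<sigma>"
  shows "quad2 (transform_cov T N \<sigma>) k x =
    quad2 \<sigma> (T $ 1 $ 1 * k + T $ 2 $ 1 * x) (T $ 1 $ 2 * k + T $ 2 $ 2 * x) + quad2 N k x"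
  unfolding quad2_def transform_cov_sel[OF assms] by (simp add: power2_eq_square algebra_simps)

lemma gauss_char_transform:
  assumes "transpose \<sigma> = \<sigma>"
  shows "gauss_char \<sigma> d (T $ 1 $ 1 * k + T $ 2 $ 1 * x) (T $ 1 $ 2 * k + T $ 2 $ 2 * x) * gauss_char N \<tau> k x =
     gauss_char (transform_cov T N \<sigma>) (T *v d + \<tau>) k x"
  unfolding gauss_char_def exp_add[symmetric] quad2_transform_cov[OF assms]
  by (simp add: matrix_vector_mult_def sum_2 algebra_simps add_divide_distrib)

text \<open>Collects what can be said about the candidate formula from positivity of the noise
  alone; a singular Gaussian channel becomes an instance once its noise has been estimated.\<close>

locale transform_data =
  fixes T N :: "real^2^2" and \<tau> :: "real^2"
  assumes N_psd: "\<And>k x. 0 \<le> quad2 N k x" and N11: "N $ 1 $ 1 > 0"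
begin

text \<open>The minimum over k, at k = - N12 x / N11, is nonnegative, so the form dominates the
  perfect square N11 (k + N12 x / N11)^2. Its k-integral after exponentiation does not depend on x,
  which yields uniform bounds.\<close>

lemma quad2_N_ge: "N $ 1 $ 1 * k\<^sup>2 + 2 * N $ 1 $ 2 * x * k + (N $ 1 $ 2)\<^sup>2 / N $ 1 $ 1 * x\<^sup>2 \<le> quad2 N k x"
proof -
  have "0 \<le> quad2 N (- (N $ 1 $ 2) * x / N $ 1 $ 1) x" by (rule N_psd)
  also have "\<dots> = (N $ 2 $ 2 - (N $ 1 $ 2)\<^sup>2 / N $ 1 $ 1) * x\<^sup>2"
    using N11 by (simp add: quad2_def power2_eq_square field_simps)
  finally show ?thesis by (simp add: quad2_def algebra_simps)
qed

lemma
  shows gauss_char_N_integrable: "integrable lborel (\<lambda>k. gauss_char N \<tau> k x)"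
    and gauss_char_N_integral: "(LINT k|lborel. cmod (gauss_char N \<tau> k x)) \<le> sqrt (2 * pi / N $ 1 $ 1)"
proof -
  let ?a = "N $ 1 $ 1 / 2" and ?b = "- N $ 1 $ 2 * x" and ?c = "(N $ 1 $ 2)\<^sup>2 / N $ 1 $ 1 * x\<^sup>2 / 2"
  have a: "?a > 0" using N11 by simp
  have "has_bochner_integral lborel (\<lambda>k. exp (- ?c) * exp (?b * k - ?a * k\<^sup>2)) (exp (- ?c) * (sqrt (pi / ?a) * exp (?b\<^sup>2 / (4 * ?a))))"
  proof (rule has_bochner_integral_mult_right)
    have e: "exp (- complex_of_real (?a * k\<^sup>2) + of_real ?b * of_real k) = of_real (exp (?b * k - ?a * k\<^sup>2))" for k
      by (simp add: exp_of_real[symmetric] algebra_simps)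
    have "has_bochner_integral lborel (\<lambda>k. complex_of_real (exp (?b * k - ?a * k\<^sup>2))) (of_real (sqrt (pi / ?a) * exp (?b\<^sup>2 / (4 * ?a))))"
      using has_bochner_integral_gaussian[OF a, of "of_real ?b"] unfolding e by (simp add: exp_of_real[symmetric])
    then show "has_bochner_integral lborel (\<lambda>k. exp (?b * k - ?a * k\<^sup>2)) (sqrt (pi / ?a) * exp (?b\<^sup>2 / (4 * ?a)))"
      unfolding has_bochner_integral_iff complex_of_real_integrable_eq integral_complex_of_real of_real_eq_iff .
  qed
  also have "exp (- ?c) * (sqrt (pi / ?a) * exp (?b\<^sup>2 / (4 * ?a))) = sqrt (2 * pi / N $ 1 $ 1)"
  proof -
    have "?b\<^sup>2 / (4 * ?a) = ?c" using N11 by (simp add: field_simps power2_eq_square)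
    then show ?thesis by (simp add: mult_ac flip: exp_add)
  qed
  finally have h: "has_bochner_integral lborel (\<lambda>k. exp (- ?c) * exp (?b * k - ?a * k\<^sup>2)) (sqrt (2 * pi / N $ 1 $ 1))" .
  have le: "cmod (gauss_char N \<tau> k x) \<le> exp (- ?c) * exp (?b * k - ?a * k\<^sup>2)" for k
    using quad2_N_ge[of k x] unfolding norm_gauss_char exp_add[symmetric] by (simp add: field_simps)
  show i: "integrable lborel (\<lambda>k. gauss_char N \<tau> k x)"
    by (rule Bochner_Integration.integrable_bound[OF h[THEN integrable.intros]]) (use le in \<open>auto intro: order_trans[OF _ abs_ge_self]\<close>)
  have "(LINT k|lborel. cmod (gauss_char N \<tau> k x)) \<le> (LINT k|lborel. exp (- ?c) * exp (?b * k - ?a * k\<^sup>2))"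
    by (rule integral_mono[OF integrable_norm[OF i] h[THEN integrable.intros] le])
  then show "(LINT k|lborel. cmod (gauss_char N \<tau> k x)) \<le> sqrt (2 * pi / N $ 1 $ 1)"
    using h by (simp add: has_bochner_integral_iff)
qed

definition pull :: "(real \<Rightarrow> real \<Rightarrow> complex) \<Rightarrow> real \<Rightarrow> real \<Rightarrow> complex" where
  "pull X k x = X (T $ 1 $ 1 * k + T $ 2 $ 1 * x) (T $ 1 $ 2 * k + T $ 2 $ 2 * x)"

text \<open>The claimed position representation of the output for input characteristic function X.
  As \<open>pull\<close> evaluates X at the transpose of T applied to (k, x), this is the inverse
  Fourier transform in k of the claimed output characteristic function.\<close>

definition out_rep :: "(real \<Rightarrow> real \<Rightarrow> complex) \<Rightarrow> real \<Rightarrow> real \<Rightarrow> complex" where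
  "out_rep X x r = 1 / (2 * of_real pi) * (LINT k|lborel. cis (k * r) * (pull X k x * gauss_char N \<tau> k x))"

text \<open>All that the candidate formula asks of X, so it can be applied uniformly to single dyads
  and to infinite sums without knowing which operator X belongs to.\<close>

definition bounded_char :: "real \<Rightarrow> (real \<Rightarrow> real \<Rightarrow> complex) \<Rightarrow> bool" where
  "bounded_char c X \<longleftrightarrow> (\<lambda>p. X (fst p) (snd p)) \<in> borel_measurable borel \<and> (\<forall>\<kappa> \<xi>. cmod (X \<kappa> \<xi>) \<le> c)"

lemma pull_measurable:
  assumes X: "bounded_char c X" and [measurable]: "f \<in> borel_measurable M" "g \<in> borel_measurable M"
  shows "(\<lambda>z. pull X (f z) (g z)) \<in> borel_measurable M"
proof -
  have X': "(\<lambda>p. X (fst p) (snd p)) \<in> borel_measurable (borel \<Otimes>\<^sub>M borel)"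
    using X by (simp add: bounded_char_def borel_prod)
  have "(\<lambda>z. (T $ 1 $ 1 * f z + T $ 2 $ 1 * g z, T $ 1 $ 2 * f z + T $ 2 $ 2 * g z)) \<in> M \<rightarrow>\<^sub>M borel \<Otimes>\<^sub>M borel"
    by measurable
  from measurable_compose[OF this X'] show ?thesis by (simp add: pull_def)
qed

lemma out_rep_integrable:
  assumes X: "bounded_char c X"
  shows "integrable lborel (\<lambda>k. cis (k * r) * (pull X k x * gauss_char N \<tau> k x))"
proof (rule Bochner_Integration.integrable_bound)
  show "integrable lborel (\<lambda>k. c * cmod (gauss_char N \<tau> k x))"
    by (intro integrable_mult_right integrable_norm gauss_char_N_integrable)
  note [measurable] = pull_measurable[OF X]
  show "(\<lambda>k. cis (k * r) * (pull X k x * gauss_char N \<tau> k x)) \<in> borel_measurable lborel" by measurable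
  show "AE k in lborel. norm (cis (k * r) * (pull X k x * gauss_char N \<tau> k x)) \<le> norm (c * cmod (gauss_char N \<tau> k x))"
    using X by (auto simp: norm_mult bounded_char_def pull_def intro!: mult_right_mono order_trans[OF _ abs_ge_self])
qed

lemma out_rep_bound:
  assumes X: "bounded_char c X"
  shows "cmod (out_rep X x r) \<le> c / sqrt (2 * pi * N $ 1 $ 1)"
proof -
  have c: "0 \<le> c" using X norm_ge_zero order_trans unfolding bounded_char_def by blast
  have "cmod (LINT k|lborel. cis (k * r) * (pull X k x * gauss_char N \<tau> k x)) \<le>
      (LINT k|lborel. cmod (cis (k * r) * (pull X k x * gauss_char N \<tau> k x)))"
    by (rule integral_norm_bound)
  also have "\<dots> \<le> (LINT k|lborel. c * cmod (gauss_char N \<tau> k x))"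
    by (rule integral_mono[OF integrable_norm[OF out_rep_integrable[OF X]]])
       (use X in \<open>auto simp: norm_mult bounded_char_def pull_def intro!: mult_right_mono integrable_norm gauss_char_N_integrable\<close>)
  also have "\<dots> \<le> c * sqrt (2 * pi / N $ 1 $ 1)"
    using gauss_char_N_integral c by (simp add: mult_left_mono)
  finally have "cmod (out_rep X x r) \<le> 1 / (2 * pi) * (c * sqrt (2 * pi / N $ 1 $ 1))"
    unfolding out_rep_def by (simp add: norm_mult norm_divide divide_right_mono)
  also have "\<dots> = c / sqrt (2 * pi * N $ 1 $ 1)"
  proof -
    have "sqrt (2 * pi / N $ 1 $ 1) = 2 * pi / sqrt (2 * pi * N $ 1 $ 1)"
      by (rule sqrt_divide_conv) (use N11 in auto)
    then show ?thesis by simp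
  qed
  finally show ?thesis .
qed

lemma out_rep_measurable:
  assumes X: "bounded_char c X" and [measurable]: "f \<in> borel_measurable M" "g \<in> borel_measurable M"
  shows "(\<lambda>z. out_rep X (f z) (g z)) \<in> borel_measurable M"
proof -
  note [measurable] = pull_measurable[OF X]
  show ?thesis unfolding out_rep_def by measurable
qed

lemma out_rep_add:
  assumes "bounded_char c X" "bounded_char c' Y"
  shows "out_rep (\<lambda>\<kappa> \<xi>. X \<kappa> \<xi> + Y \<kappa> \<xi>) x r = out_rep X x r + out_rep Y x r"
  using out_rep_integrable[OF assms(1), of r x] out_rep_integrable[OF assms(2), of r x]
  by (simp add: out_rep_def pull_def distrib_left distrib_right)

lemma out_rep_cmult: "out_rep (\<lambda>\<kappa> \<xi>. c * X \<kappa> \<xi>) x r = c * out_rep X x r"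
proof -
  have *: "cis (k * r) * (pull (\<lambda>\<kappa> \<xi>. c * X \<kappa> \<xi>) k x * gauss_char N \<tau> k x) =
    c * (cis (k * r) * (pull X k x * gauss_char N \<tau> k x))" for k
    by (simp add: pull_def mult_ac)
  show ?thesis unfolding out_rep_def * by simp
qed

definition out_ker :: "(real \<Rightarrow> real \<Rightarrow> complex) \<Rightarrow> opker" where
  "out_ker X q q' = out_rep X (q' - q) ((q + q') / 2)"

lemma out_ker_measurable: "bounded_char c X \<Longrightarrow> (\<lambda>p. out_ker X (fst p) (snd p)) \<in> borel_measurable borel"
  unfolding out_ker_def by (rule out_rep_measurable) auto

text \<open>The candidate kernel is only known to be bounded, so its matrix elements are controlled
  by L1 norms of the test functions; this is where integrability of test vectors enters.\<close>

lemma
  assumes X: "bounded_char c X" and f: "integrable lborel f" and g: "integrable lborel g"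
  shows out_ker_qf_integrable: "integrable lborel (\<lambda>p. cnj (f (fst p)) * out_ker X (fst p) (snd p) * g (snd p))"
    and out_ker_qf_bound: "cmod (qf f (out_ker X) g) \<le>
      c * ((LINT q|lborel. cmod (f q)) * (LINT q|lborel. cmod (g q)) / sqrt (2 * pi * N $ 1 $ 1))"
proof -
  let ?C = "c / sqrt (2 * pi * N $ 1 $ 1)"
  have [measurable]: "f \<in> borel_measurable borel" "g \<in> borel_measurable borel" using f g by auto
  note [measurable] = out_ker_measurable[OF X]
  have i: "integrable lborel (\<lambda>p. cmod (f (fst p)) * cmod (g (snd p)))"
    and v: "(LINT p|lborel. cmod (f (fst p)) * cmod (g (snd p))) = (LINT q|lborel. cmod (f q)) * (LINT q|lborel. cmod (g q))"
    using integrable_lborel_prod[OF integrable_norm[OF f] integrable_norm[OF g]]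
      integral_lborel_prod[OF integrable_norm[OF f] integrable_norm[OF g]] by (simp_all add: case_prod_unfold)
  have le: "cmod (cnj (f (fst p)) * out_ker X (fst p) (snd p) * g (snd p)) \<le> ?C * (cmod (f (fst p)) * cmod (g (snd p)))" for p
    using mult_right_mono[OF out_rep_bound[OF X, of "snd p - fst p" "(fst p + snd p) / 2"], of "cmod (f (fst p)) * cmod (g (snd p))"]
    by (simp add: norm_mult out_ker_def mult_ac)
  show I: "integrable lborel (\<lambda>p. cnj (f (fst p)) * out_ker X (fst p) (snd p) * g (snd p))"
  proof (rule Bochner_Integration.integrable_bound[OF integrable_mult_right[OF i, of ?C]])
    show "AE p in lborel. norm (cnj (f (fst p)) * out_ker X (fst p) (snd p) * g (snd p)) \<le>
      norm (?C * (cmod (f (fst p)) * cmod (g (snd p))))"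
      by (rule AE_I2, rule order_trans[OF le], unfold real_norm_def, rule abs_ge_self)
  qed measurable
  have "cmod (qf f (out_ker X) g) \<le> (LINT p|lborel. cmod (cnj (f (fst p)) * out_ker X (fst p) (snd p) * g (snd p)))"
    unfolding qf_def case_prod_unfold by (rule integral_norm_bound)
  also have "\<dots> \<le> (LINT p|lborel. ?C * (cmod (f (fst p)) * cmod (g (snd p))))"
    by (rule integral_mono[OF integrable_norm[OF I] integrable_mult_right[OF i] le])
  also have "\<dots> = c * ((LINT q|lborel. cmod (f q)) * (LINT q|lborel. cmod (g q)) / sqrt (2 * pi * N $ 1 $ 1))"
    by (simp add: v)
  finally show "cmod (qf f (out_ker X) g) \<le>
      c * ((LINT q|lborel. cmod (f q)) * (LINT q|lborel. cmod (g q)) / sqrt (2 * pi * N $ 1 $ 1))" .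
qed

lemma qf_out_ker_add:
  assumes "bounded_char c X" "bounded_char c' Y" "integrable lborel f"
  shows "qf f (out_ker (\<lambda>\<kappa> \<xi>. X \<kappa> \<xi> + Y \<kappa> \<xi>)) f = qf f (out_ker X) f + qf f (out_ker Y) f"
  using out_ker_qf_integrable[OF assms(1,3,3)] out_ker_qf_integrable[OF assms(2,3,3)]
  by (simp add: qf_def case_prod_unfold out_ker_def out_rep_add[OF assms(1,2)] distrib_left distrib_right)

lemma qf_out_ker_cmult: "qf f (out_ker (\<lambda>\<kappa> \<xi>. c * X \<kappa> \<xi>)) f = c * qf f (out_ker X) f"
  using qf_cmult[of f c "out_ker X" f] by (simp add: out_ker_def[abs_def] out_rep_cmult)

lemma bounded_char_chi:
  assumes "L2_fun \<psi>" "L2_fun \<phi>"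
  shows "bounded_char (L2_norm \<psi> * L2_norm \<phi>) (chi \<psi> \<phi>)"
  unfolding bounded_char_def
  by (intro conjI allI chi_bound[OF assms] chi_measurable[OF assms[THEN L2_fun_measurable]]) auto

lemma out_ker_gauss_char:
  assumes sym: "transpose \<sigma> = \<sigma>" and pos: "transform_cov T N \<sigma> $ 1 $ 1 > 0"
  shows "out_ker (gauss_char \<sigma> d) = gauss_ker (transform_cov T N \<sigma>) (T *v d + \<tau>)"
  unfolding out_ker_def[abs_def] gauss_ker_def[abs_def] out_rep_def pull_def gauss_char_transform[OF sym]
  by (simp only: gauss_char_inverse[where \<sigma> = "transform_cov T N \<sigma>", OF pos])

end

subsection \<open>Noise of a singular Gaussian channel\<close>

lemma rank_one_2:
  assumes "det (T :: real^2^2) = 0"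
  shows "\<exists>u v :: 2 \<Rightarrow> real. \<forall>i j. T $ i $ j = u i * v j"
proof (cases "T $ 1 $ 1 = 0 \<and> T $ 1 $ 2 = 0")
  case True
  then have "T $ i $ j = (if i = 1 then 0 else 1) * T $ 2 $ j" for i j
    using exhaust_2[of i] exhaust_2[of j] by auto
  then show ?thesis by (intro exI allI)
next
  case False
  have d: "T $ 1 $ 1 * T $ 2 $ 2 = T $ 1 $ 2 * T $ 2 $ 1" using assms by (simp add: det_2)
  define c where "c = (if T $ 1 $ 1 \<noteq> 0 then T $ 2 $ 1 / T $ 1 $ 1 else T $ 2 $ 2 / T $ 1 $ 2)"
  have "T $ 2 $ 1 = c * T $ 1 $ 1" "T $ 2 $ 2 = c * T $ 1 $ 2"
    using False d by (auto simp: c_def field_simps)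
  then have "T $ i $ j = (if i = 1 then 1 else c) * T $ 1 $ j" for i j
    using exhaust_2[of i] exhaust_2[of j] by auto
  then show ?thesis by (intro exI allI)
qed

text \<open>Squeezing: some pure Gaussian state has arbitrarily small variance in any prescribed
  direction, at the price of a large variance elsewhere.\<close>

lemma quad2_pure_cov_small:
  assumes e: "e > 0"
  obtains A B where "A > 0" "quad2 (pure_cov A B) x y < e"
proof (cases "y = 0")
  case True
  \<comment> \<open>The summand 1 keeps the quotient defined for x = 0.\<close>
  define A where "A = e / (2 * (x\<^sup>2 + 1))"
  have p: "x\<^sup>2 + 1 > 0" by (simp add: add_nonneg_pos)
  have A: "A > 0" using e p by (simp add: A_def)
  have "quad2 (pure_cov A 0) x y = e / 2 * (x\<^sup>2 / (x\<^sup>2 + 1))"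
    by (simp add: quad2_def True A_def)
  also have "\<dots> \<le> e / 2 * 1"
    using e p by (intro mult_left_mono) (auto simp: divide_le_eq_1)
  also have "\<dots> < e" using e by simp
  finally show ?thesis using A that by blast
next
  case False
  \<comment> \<open>With B = - A x / y the square (A x + B y)^2 disappears, and the remaining y^2 /
    (4 A) equals e / 2.\<close>
  define A where "A = y\<^sup>2 / (2 * e)"
  have A: "A > 0" using e False by (simp add: A_def)
  have "quad2 (pure_cov A (- A * x / y)) x y = y\<^sup>2 / (4 * A)"
    unfolding quad2_pure_cov[OF A] using False by simp
  also have "\<dots> < e" using e False by (simp add: A_def)
  finally show ?thesis using A that by blast
qed

lemma iterated_gaussian_integral:
  fixes \<alpha> \<beta> :: real
  assumes a: "\<alpha> > 0" and ab: "\<alpha>\<^sup>2 - \<beta>\<^sup>2 > 0"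
  shows "(LINT x|lborel. LINT y|lborel. exp (- complex_of_real (\<alpha> * x\<^sup>2 + 2 * \<beta> * x * y + \<alpha> * y\<^sup>2))) =
    of_real (pi / sqrt (\<alpha>\<^sup>2 - \<beta>\<^sup>2))"
proof -
  let ?\<gamma> = "\<alpha> - \<beta>\<^sup>2 / \<alpha>"
  have g: "?\<gamma> > 0" using a ab by (simp add: field_simps power2_eq_square)
  have 1: "(LINT y|lborel. exp (- complex_of_real (\<alpha> * x\<^sup>2 + 2 * \<beta> * x * y + \<alpha> * y\<^sup>2))) =
     of_real (sqrt (pi / \<alpha>)) * exp (- of_real (?\<gamma> * x\<^sup>2) + 0 * of_real x)" for x
  proof -
    have "exp (- complex_of_real (\<alpha> * x\<^sup>2 + 2 * \<beta> * x * y + \<alpha> * y\<^sup>2)) =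
       exp (- of_real (\<alpha> * x\<^sup>2)) * exp (- of_real (\<alpha> * y\<^sup>2) + of_real (- 2 * \<beta> * x) * of_real y)" for y
      unfolding exp_add[symmetric] by (simp add: algebra_simps)
    then have "(LINT y|lborel. exp (- complex_of_real (\<alpha> * x\<^sup>2 + 2 * \<beta> * x * y + \<alpha> * y\<^sup>2))) =
       exp (- of_real (\<alpha> * x\<^sup>2)) * (of_real (sqrt (pi / \<alpha>)) * exp ((of_real (- 2 * \<beta> * x))\<^sup>2 / (4 * of_real \<alpha>)))"
      by (simp only: integral_mult_right_zero integral_gaussian[OF a])
    also have "\<dots> = of_real (sqrt (pi / \<alpha>)) * (exp (- of_real (\<alpha> * x\<^sup>2)) * exp ((of_real (- 2 * \<beta> * x))\<^sup>2 / (4 * of_real \<alpha>)))"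
      by (simp only: mult_ac)
    also have "exp (- of_real (\<alpha> * x\<^sup>2)) * exp ((of_real (- 2 * \<beta> * x))\<^sup>2 / (4 * of_real \<alpha>)) = exp (- complex_of_real (?\<gamma> * x\<^sup>2) + 0 * of_real x)"
      unfolding exp_add[symmetric] by (rule arg_cong[where f = exp]) (use a in \<open>simp add: field_simps power2_eq_square\<close>)
    finally show ?thesis .
  qed
  have "(LINT x|lborel. LINT y|lborel. exp (- complex_of_real (\<alpha> * x\<^sup>2 + 2 * \<beta> * x * y + \<alpha> * y\<^sup>2))) =
     of_real (sqrt (pi / \<alpha>)) * (of_real (sqrt (pi / ?\<gamma>)) * exp (0\<^sup>2 / (4 * of_real ?\<gamma>)))"
    unfolding 1 by (simp only: integral_mult_right_zero integral_gaussian[OF g])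
  also have "\<dots> = of_real (sqrt (pi / \<alpha>) * sqrt (pi / ?\<gamma>))" by simp
  also have "sqrt (pi / \<alpha>) * sqrt (pi / ?\<gamma>) = pi / sqrt (\<alpha>\<^sup>2 - \<beta>\<^sup>2)"
  proof -
    have "sqrt (pi / \<alpha>) * sqrt (pi / ?\<gamma>) = sqrt (pi * pi / (\<alpha> * ?\<gamma>))"
      by (simp add: real_sqrt_mult[symmetric])
    also have "\<alpha> * ?\<gamma> = \<alpha>\<^sup>2 - \<beta>\<^sup>2" using a by (simp add: field_simps power2_eq_square)
    finally show ?thesis by (simp add: real_sqrt_divide)
  qed
  finally show ?thesis .
qed

lemma lborel_integral_shift:
  fixes f :: "real \<Rightarrow> complex"
  shows "(LINT x|lborel. f (x - c)) = (LINT x|lborel. f x)"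
  using lborel_integral_real_affine[of 1 "\<lambda>x. f (x - c)" c] by simp

text \<open>Equal mean, position variance and correlation make the two phases identical, so the
  conjugate cancels them and the overlap integrand is a real Gaussian.\<close>

lemma gauss_rep_overlap:
  assumes "\<sigma> $ 1 $ 1 = \<rho> $ 1 $ 1" "\<sigma> $ 1 $ 2 = \<rho> $ 1 $ (2::2)" and s: "\<sigma> $ 1 $ 1 > 0"
  shows "cnj (gauss_rep \<rho> d x r) * gauss_rep \<sigma> d x r = of_real (1 / (2 * pi * \<sigma> $ 1 $ 1)) *
    exp (- of_real ((r - d $ 1)\<^sup>2 / \<sigma> $ 1 $ 1 + (\<sigma> $ 2 $ 2 + \<rho> $ 2 $ 2 - 2 * (\<sigma> $ 1 $ 2)\<^sup>2 / \<sigma> $ 1 $ 1) * x\<^sup>2 / 2))"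
proof -
  let ?s = "\<sigma> $ 1 $ 1"
  have c: "cnj (of_real k * exp (- of_real X - \<i> * of_real Y)) = of_real k * exp (- of_real X + \<i> * of_real Y)"
    for k X Y :: real by (simp add: exp_cnj)
  have "(of_real k * exp (- of_real X + \<i> * of_real Z)) * (of_real k * exp (- of_real Y - \<i> * of_real Z)) =
     of_real (k * k) * exp (- complex_of_real (X + Y))" for k X Y Z :: real
    by (simp add: mult_exp_exp mult_ac)
  then have "cnj (gauss_rep \<rho> d x r) * gauss_rep \<sigma> d x r = of_real (1 / sqrt (2 * pi * ?s) * (1 / sqrt (2 * pi * ?s))) *
    exp (- of_real (((r - d $ 1)\<^sup>2 / (2 * ?s) + (\<rho> $ 2 $ 2 - (\<sigma> $ 1 $ 2)\<^sup>2 / ?s) * x\<^sup>2 / 2)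
      + ((r - d $ 1)\<^sup>2 / (2 * ?s) + (\<sigma> $ 2 $ 2 - (\<sigma> $ 1 $ 2)\<^sup>2 / ?s) * x\<^sup>2 / 2)))"
    unfolding gauss_rep_def assms(1,2)[symmetric] c by (simp only:)
  also have "1 / sqrt (2 * pi * ?s) * (1 / sqrt (2 * pi * ?s)) = 1 / (2 * pi * ?s)" using s by simp
  also have "((r - d $ 1)\<^sup>2 / (2 * ?s) + (\<rho> $ 2 $ 2 - (\<sigma> $ 1 $ 2)\<^sup>2 / ?s) * x\<^sup>2 / 2)
      + ((r - d $ 1)\<^sup>2 / (2 * ?s) + (\<sigma> $ 2 $ 2 - (\<sigma> $ 1 $ 2)\<^sup>2 / ?s) * x\<^sup>2 / 2) =
      (r - d $ 1)\<^sup>2 / ?s + (\<sigma> $ 2 $ 2 + \<rho> $ 2 $ 2 - 2 * (\<sigma> $ 1 $ 2)\<^sup>2 / ?s) * x\<^sup>2 / 2"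
    by (simp add: field_simps)
  finally show ?thesis .
qed

text \<open>The uncertainty principle, tested only against the pure state with the same position variance
  and correlation.\<close>

lemma gaussian_state_uncertainty:
  assumes K: "gaussian_state_with K \<sigma> d"
  shows "det \<sigma> \<ge> 1 / 4"
proof (rule ccontr)
  assume neg: "\<not> det \<sigma> \<ge> 1 / 4"
  note D = gaussian_state_withD[OF K]
  define s t u where "s = \<sigma> $ 1 $ 1" and "t = \<sigma> $ 1 $ 2" and "u = \<sigma> $ 2 $ 2"
  have s: "s > 0" using pos_def_2D(1)[of \<sigma>] D(2) by (simp add: s_def)
  have det: "det \<sigma> = s * u - t\<^sup>2" and det_pos: "det \<sigma> > 0"
    using det_eq[OF D(1,2)] det_pos[OF D(1,2)] by (simp_all add: s_def t_def u_def)
  \<comment> \<open>The conditional variance of the momentum; the claim is equivalent to 4 s m \<ge>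
    1.\<close>
  define m where "m = det \<sigma> / s"
  have m: "m > 0" "4 * s * m < 1" using det_pos s neg by (simp_all add: m_def)
  define f where "f = pure_gauss s t d"
  have f: "L2_fun f" "L2_norm f = 1"
    unfolding f_def using s by (simp_all add: L2_fun_pure_gauss L2_norm_pure_gauss)
  have tr: "has_trace K 1" "block_positive 1 (\<lambda>_ _. K)" "trace_class K"
    using D(3) by (auto simp: density_operator_def trace_class_def)
  have le1: "cmod (qf f K f) \<le> 1"
    using positive_qf_bound[OF tr(1,2) f(1)] f(2) by simp
  \<comment> \<open>Coefficients of the overlap exponent in a = q - d1 and b = q' - d1, read off
    from (a + b)^2 / (4 s) + (m + 1/(4 s)) (b - a)^2 / 2.\<close>
  define \<alpha> \<beta> where "\<alpha> = 1 / (4 * s) + (m + 1 / (4 * s)) / 2" and "\<beta> = 1 / (4 * s) - (m + 1 / (4 * s)) / 2"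
  have a: "\<alpha> > 0" using s m by (simp add: \<alpha>_def add_pos_pos)
  have "\<alpha>\<^sup>2 - \<beta>\<^sup>2 = (\<alpha> + \<beta>) * (\<alpha> - \<beta>)" by (simp add: power2_eq_square algebra_simps)
  also have "\<dots> = 1 / (2 * s) * (m + 1 / (4 * s))" using s by (simp add: \<alpha>_def \<beta>_def field_simps)
  finally have ab: "\<alpha>\<^sup>2 - \<beta>\<^sup>2 = 1 / (2 * s) * (m + 1 / (4 * s))" .
  have ab_pos: "\<alpha>\<^sup>2 - \<beta>\<^sup>2 > 0" unfolding ab using s m by (simp add: add_pos_pos)
  let ?h = "\<lambda>x y. exp (- complex_of_real (\<alpha> * x\<^sup>2 + 2 * \<beta> * x * y + \<alpha> * y\<^sup>2))"
  have pc: "\<sigma> $ 1 $ 1 = pure_cov s t $ 1 $ 1" "\<sigma> $ 1 $ 2 = pure_cov s t $ 1 $ 2"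
    by (simp_all add: s_def t_def)
  have prod: "cnj (f q) * gauss_ker \<sigma> d q q' * f q' = of_real (1 / (2 * pi * s)) * ?h (q - d $ 1) (q' - d $ 1)" for q q'
  proof -
    let ?x = "q' - q" and ?r = "(q + q') / 2"
    have "f q * cnj (f q') = gauss_rep (pure_cov s t) d ?x ?r"
    proof -
      have "(q + q') / 2 - (q' - q) / 2 = q" "(q + q') / 2 + (q' - q) / 2 = q'" by argo+
      then show ?thesis
        using pos_rep_pure_gauss[OF s, of t d ?x ?r] by (simp add: pos_rep_def dyad_def f_def)
    qed
    then have "cnj (f q) * f q' = cnj (gauss_rep (pure_cov s t) d ?x ?r)"
      by (metis complex_cnj_cnj complex_cnj_mult)
    moreover have "cnj (f q) * gauss_ker \<sigma> d q q' * f q' = (cnj (f q) * f q') * gauss_rep \<sigma> d ?x ?r"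
      unfolding gauss_ker_def by (simp only: mult_ac)
    ultimately have "cnj (f q) * gauss_ker \<sigma> d q q' * f q' = cnj (gauss_rep (pure_cov s t) d ?x ?r) * gauss_rep \<sigma> d ?x ?r"
      by (simp only:)
    also have "\<dots> = of_real (1 / (2 * pi * s)) *
      exp (- of_real ((?r - d $ 1)\<^sup>2 / s + (u + (1 / 4 + t\<^sup>2) / s - 2 * t\<^sup>2 / s) * ?x\<^sup>2 / 2))"
      using gauss_rep_overlap[OF pc, of d ?x ?r] s by (simp only: s_def[symmetric] t_def[symmetric] u_def[symmetric] pure_cov_sel)
    also have "u + (1 / 4 + t\<^sup>2) / s - 2 * t\<^sup>2 / s = m + 1 / (4 * s)"
      using s by (simp add: m_def det field_simps)
    also have "(?r - d $ 1)\<^sup>2 / s + (m + 1 / (4 * s)) * ?x\<^sup>2 / 2 =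
      \<alpha> * (q - d $ 1)\<^sup>2 + 2 * \<beta> * (q - d $ 1) * (q' - d $ 1) + \<alpha> * (q' - d $ 1)\<^sup>2"
    proof -
      have "(?r - d $ 1)\<^sup>2 / s = 1 / (4 * s) * ((q - d $ 1) + (q' - d $ 1))\<^sup>2"
        using s by (simp add: field_simps power2_eq_square)
      moreover have "?x = (q' - d $ 1) - (q - d $ 1)" by simp
      moreover have "k * (a + b)\<^sup>2 + l * (b - a)\<^sup>2 / 2 = (k + l / 2) * a\<^sup>2 + 2 * (k - l / 2) * a * b + (k + l / 2) * b\<^sup>2"
        for k l a b :: real by (simp add: power2_eq_square field_simps)
      ultimately show ?thesis
        unfolding \<alpha>_def \<beta>_def by (simp only:)
    qed
    finally show ?thesis .
  qed
  have gm: "(\<lambda>p. gauss_ker \<sigma> d (fst p) (snd p)) \<in> borel_measurable borel"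
    unfolding gauss_ker_def by measurable
  have Km: "(\<lambda>p. K (fst p) (snd p)) \<in> borel_measurable borel" by (rule trace_class_measurable[OF tr(3)])
  have q: "qf f K f = qf f (gauss_ker \<sigma> d) f"
    by (intro qf_cong Km gm gaussian_state_ker K L2_fun_measurable f)
  note [measurable] = Km gm f(1)[THEN L2_fun_measurable]
  have "integrable lborel (\<lambda>p. cnj (f (fst p)) * K (fst p) (snd p) * f (snd p))"
    using trace_class_qf_integrable[OF tr(3) f(1) f(1)] by (simp add: case_prod_unfold)
  moreover have "AE p in lborel. cnj (f (fst p)) * K (fst p) (snd p) * f (snd p) =
     cnj (f (fst p)) * gauss_ker \<sigma> d (fst p) (snd p) * f (snd p)"
    using gaussian_state_ker[OF K] unfolding ker_eq_def case_prod_unfold by eventually_elim simp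
  ultimately have "integrable lborel (\<lambda>p. cnj (f (fst p)) * gauss_ker \<sigma> d (fst p) (snd p) * f (snd p))"
    by (subst (asm) integrable_cong_AE) auto
  then have I: "integrable (lborel \<Otimes>\<^sub>M lborel) (\<lambda>p. of_real (1 / (2 * pi * s)) * ?h (fst p - d $ 1) (snd p - d $ 1))"
    unfolding lborel_prod prod .
  have "qf f (gauss_ker \<sigma> d) f = (LINT q|lborel. LINT q'|lborel. of_real (1 / (2 * pi * s)) * ?h (q - d $ 1) (q' - d $ 1))"
    using lborel_pair.integral_fst'[OF I, symmetric] unfolding lborel_prod fst_conv snd_conv qf_def case_prod_unfold prod .
  also have "\<dots> = of_real (1 / (2 * pi * s)) * (LINT q|lborel. LINT q'|lborel. ?h (q - d $ 1) (q' - d $ 1))"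
    by (simp only: integral_mult_right_zero)
  also have "(LINT q|lborel. LINT q'|lborel. ?h (q - d $ 1) (q' - d $ 1)) = (LINT q|lborel. LINT q'|lborel. ?h q q')"
  proof -
    have "(LINT q|lborel. LINT q'|lborel. ?h (q - d $ 1) (q' - d $ 1)) = (LINT q|lborel. LINT q'|lborel. ?h (q - d $ 1) q')"
      by (rule Bochner_Integration.integral_cong[OF refl], rule lborel_integral_shift)
    also have "\<dots> = (LINT q|lborel. LINT q'|lborel. ?h q q')"
      by (rule lborel_integral_shift)
    finally show ?thesis .
  qed
  also have "\<dots> = of_real (pi / sqrt (\<alpha>\<^sup>2 - \<beta>\<^sup>2))" by (rule iterated_gaussian_integral[OF a ab_pos])
  finally have "qf f K f = of_real (1 / (2 * pi * s) * (pi / sqrt (\<alpha>\<^sup>2 - \<beta>\<^sup>2)))"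
    unfolding q by simp
  then have "cmod (of_real (1 / (2 * pi * s) * (pi / sqrt (\<alpha>\<^sup>2 - \<beta>\<^sup>2)))) \<le> 1"
    using le1 by (simp only:)
  then have "1 / (2 * pi * s) * (pi / sqrt (\<alpha>\<^sup>2 - \<beta>\<^sup>2)) \<le> 1"
    unfolding norm_of_real by (rule abs_le_D1)
  then have "1 / (2 * s) \<le> sqrt (\<alpha>\<^sup>2 - \<beta>\<^sup>2)"
    using s ab_pos by (simp add: field_simps)
  then have "(1 / (2 * s))\<^sup>2 \<le> (sqrt (\<alpha>\<^sup>2 - \<beta>\<^sup>2))\<^sup>2"
    by (rule power_mono) (use s in simp)
  then have "(1 / (2 * s))\<^sup>2 \<le> \<alpha>\<^sup>2 - \<beta>\<^sup>2" using ab_pos by simp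
  \<comment> \<open>The overlap with a unit vector is at most the trace 1, which says 1/(4 s^2)
    \<le> (m + 1/(4 s)) / (2 s).\<close>
  then have "1 \<le> 4 * s * m"
    unfolding ab using s by (simp add: field_simps power2_eq_square)
  then show False using m by simp
qed

locale singular_gaussian_channel = channel \<Phi> for \<Phi> +
  fixes T N :: "real^2^2" and \<tau> :: "real^2"
  assumes desc: "described_by \<Phi> T N \<tau>" and sing: "det T = 0"
begin

lemma described:
  "gaussian_state_with K \<sigma> d \<Longrightarrow> gaussian_state_with (\<Phi> K) (transform_cov T N \<sigma>) (T *v d + \<tau>)"
  using desc by (auto simp: described_by_def transform_cov_def)

text \<open>With T = u v^T the input covariance enters only through the number q = v . \<sigma> v,
  and the output covariance is N + q u u^T. Its determinant is affine in q, with slope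
  \<open>quad2 N (u 2) (- u 1)\<close>. The vector u is chosen before e, so the coefficients stay
  fixed while q shrinks.\<close>

lemma small_output:
  "\<exists>u. \<forall>e>0. \<exists>q. 0 \<le> q \<and> q < e \<and> (\<forall>k x. 0 \<le> q * (u 1 * k + u (2::2) * x)\<^sup>2 + quad2 N k x) \<and>
    1 / 4 \<le> N $ 1 $ 1 * N $ 2 $ 2 - (N $ 1 $ 2)\<^sup>2 + q * quad2 N (u 2) (- u 1)"
proof -
  obtain u v :: "2 \<Rightarrow> real" where uv: "\<And>i j. T $ i $ j = u i * v j" using rank_one_2[OF sing] by blast
  show ?thesis
  proof (intro exI[of _ u] allI impI)
    fix e :: real assume "e > 0"
    then obtain A B where A: "A > 0" and small: "quad2 (pure_cov A B) (v 1) (v 2) < e"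
      by (rule quad2_pure_cov_small)
    let ?q = "quad2 (pure_cov A B) (v 1) (v 2)" and ?\<sigma> = "transform_cov T N (pure_cov A B)"
    note st = described[OF gaussian_state_pure[OF A, of B 0]]
    note D = gaussian_state_withD[OF st]
    have sel: "?\<sigma> $ i $ j = ?q * (u i * u j) + N $ i $ j" for i j
      unfolding transform_cov_sel[OF transpose_pure_cov[OF A]] uv quad2_def
      by (simp only: power2_eq_square ring_distribs mult_ac add_ac)
    have e: "quad2 ?\<sigma> k x = ?q * (u 1 * k + u 2 * x)\<^sup>2 + quad2 N k x" for k x
      unfolding quad2_def[of ?\<sigma>] quad2_def[of N] sel by (simp add: power2_eq_square algebra_simps)
    have "0 \<le> ?q"
      unfolding quad2_pure_cov[OF A] using A by simp
    moreover have "0 \<le> ?q * (u 1 * k + u 2 * x)\<^sup>2 + quad2 N k x" for k x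
      using D(2)[of k x] unfolding e[symmetric] by (cases "(k, x) = (0, 0)") (auto simp: quad2_def[of _ 0 0])
    moreover have "1 / 4 \<le> N $ 1 $ 1 * N $ 2 $ 2 - (N $ 1 $ 2)\<^sup>2 + ?q * quad2 N (u 2) (- u 1)"
    proof -
      have "1 / 4 \<le> det ?\<sigma>" by (rule gaussian_state_uncertainty[OF st])
      also have "\<dots> = ?\<sigma> $ 1 $ 1 * ?\<sigma> $ 2 $ 2 - (?\<sigma> $ 1 $ 2)\<^sup>2" by (rule det_eq[OF D(1,2)])
      also have "\<dots> = N $ 1 $ 1 * N $ 2 $ 2 - (N $ 1 $ 2)\<^sup>2 + ?q * quad2 N (u 2) (- u 1)"
        unfolding sel quad2_def[of N] by (simp add: power2_eq_square algebra_simps)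
      finally show ?thesis .
    qed
    ultimately show "\<exists>q. 0 \<le> q \<and> q < e \<and> (\<forall>k x. 0 \<le> q * (u 1 * k + u 2 * x)\<^sup>2 + quad2 N k x) \<and>
      1 / 4 \<le> N $ 1 $ 1 * N $ 2 $ 2 - (N $ 1 $ 2)\<^sup>2 + q * quad2 N (u 2) (- u 1)"
      using small by blast
  qed
qed

lemma le_small_perturbation:
  fixes a c L :: real
  assumes "\<And>e. e > 0 \<Longrightarrow> \<exists>q. 0 \<le> q \<and> q < e \<and> a \<le> c + q * L"
  shows "a \<le> c"
proof (rule field_le_epsilon)
  fix \<epsilon> :: real assume \<epsilon>: "\<epsilon> > 0"
  have p: "\<bar>L\<bar> + 1 > 0" by linarith
  obtain q where q: "0 \<le> q" "q < \<epsilon> / (\<bar>L\<bar> + 1)" "a \<le> c + q * L"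
    using assms[of "\<epsilon> / (\<bar>L\<bar> + 1)"] \<epsilon> p by auto
  have "q * L \<le> q * (\<bar>L\<bar> + 1)" using q(1) by (intro mult_left_mono) auto
  also have "\<dots> \<le> \<epsilon>" using q(2) p by (simp add: pos_less_divide_eq)
  finally show "a \<le> c + \<epsilon>" using q(3) by simp
qed

lemma N_psd: "0 \<le> quad2 N k x"
proof -
  obtain u where u: "\<And>e. e > 0 \<Longrightarrow> \<exists>q. 0 \<le> q \<and> q < e \<and> (\<forall>k x. 0 \<le> q * (u 1 * k + u (2::2) * x)\<^sup>2 + quad2 N k x) \<and>
    1 / 4 \<le> N $ 1 $ 1 * N $ 2 $ 2 - (N $ 1 $ 2)\<^sup>2 + q * quad2 N (u 2) (- u 1)"
    using small_output by blast
  show ?thesis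
    by (rule le_small_perturbation[where L = "(u 1 * k + u 2 * x)\<^sup>2"]) (use u in \<open>metis add.commute\<close>)
qed

lemma N11_pos: "N $ 1 $ 1 > 0"
proof -
  obtain u where u: "\<And>e. e > 0 \<Longrightarrow> \<exists>q. 0 \<le> q \<and> q < e \<and> (\<forall>k x. 0 \<le> q * (u 1 * k + u (2::2) * x)\<^sup>2 + quad2 N k x) \<and>
    1 / 4 \<le> N $ 1 $ 1 * N $ 2 $ 2 - (N $ 1 $ 2)\<^sup>2 + q * quad2 N (u 2) (- u 1)"
    using small_output by blast
  have "1 / 4 \<le> N $ 1 $ 1 * N $ 2 $ 2 - (N $ 1 $ 2)\<^sup>2"
    by (rule le_small_perturbation[where L = "quad2 N (u 2) (- u 1)"]) (use u in blast)
  then have "0 < N $ 1 $ 1 * N $ 2 $ 2"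
    using zero_le_power2[of "N $ 1 $ 2"] by linarith
  moreover have "0 \<le> N $ 1 $ 1" using N_psd[of 1 0] by (simp add: quad2_def)
  ultimately show ?thesis by (auto simp: zero_less_mult_iff)
qed

sublocale transform_data T N \<tau>
  by unfold_locales (rule N_psd N11_pos)+

end

subsection \<open>Fourier uniqueness in two variables\<close>

lemma fourier_continuous:
  fixes f :: "real \<Rightarrow> complex"
  assumes f: "integrable lborel f"
  shows "continuous_on UNIV (\<lambda>v. LINT x|lborel. f x * cis (v * x))"
proof (rule continuous_at_imp_continuous_on, rule ballI, rule continuous_at_sequentiallyI)
  fix v :: real and u assume u: "u \<longlonglongrightarrow> v"
  have [measurable]: "f \<in> borel_measurable borel" using f by auto
  show "(\<lambda>n. LINT x|lborel. f x * cis (u n * x)) \<longlonglongrightarrow> (LINT x|lborel. f x * cis (v * x))"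
  proof (rule integral_dominated_convergence[where w = "\<lambda>x. cmod (f x)"])
    show "AE x in lborel. (\<lambda>n. f x * cis (u n * x)) \<longlonglongrightarrow> f x * cis (v * x)"
      by (intro AE_I2 tendsto_intros u)
  qed (use f in \<open>auto simp: norm_mult\<close>)
qed

text \<open>One-dimensional injectivity is applied in each variable. The null set of q excluded by
  the first application depends on the frequency b, so only rational b are used there; continuity of
  the inner transform in b restores the rest.\<close>

lemma AE_zero_of_double_fourier_zero:
  fixes E :: "real \<times> real \<Rightarrow> complex"
  assumes E: "integrable lborel E"
    and z: "\<And>a b. (LINT p|lborel. cis (a * fst p) * E p * cis (b * snd p)) = 0"
  shows "AE p in lborel. E p = 0"
proof -
  have Em [measurable]: "E \<in> borel_measurable borel" using E by auto
  have Em' [measurable]: "E \<in> borel_measurable (borel \<Otimes>\<^sub>M borel)" using Em by (simp add: borel_prod)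
  have E': "integrable (lborel \<Otimes>\<^sub>M lborel) E" using E by (simp add: lborel_prod)
  have int: "integrable (lborel \<Otimes>\<^sub>M lborel) (\<lambda>p. cis (a * fst p) * E p * cis (b * snd p))" for a b
    by (rule Bochner_Integration.integrable_bound[OF E']) (auto simp: norm_mult)
  have int2: "integrable (lborel \<Otimes>\<^sub>M lborel) (\<lambda>p. E p * cis (b * snd p))" for b
    using int[of 0 b] by simp
  define h where "h b q = (LINT q'|lborel. E (q, q') * cis (b * q'))" for b q
  have h_int: "integrable lborel (h b)" for b
    using lborel_pair.integrable_fst'[OF int2[of b]] by (simp add: h_def[abs_def])
  have "(LINT q|lborel. h b q * cis (a * q)) = 0" for a b
  proof -
    have "(LINT q|lborel. h b q * cis (a * q)) = (LINT q|lborel. LINT q'|lborel. cis (a * q) * E (q, q') * cis (b * q'))"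
      unfolding h_def by (simp add: mult_ac flip: integral_mult_right_zero)
    also have "\<dots> = (LINT p|lborel. cis (a * fst p) * E p * cis (b * snd p))"
      using lborel_pair.integral_fst'[OF int[of a b]] by (simp add: lborel_prod)
    finally show ?thesis using z by simp
  qed
  then have "AE q in lborel. h b q = 0" for b
    by (intro AE_zero_of_fourier_zero h_int)
  then have "AE q in lborel. \<forall>b\<in>\<rat>. h b q = 0"
    by (simp add: AE_ball_countable countable_rat)
  moreover have "AE q in lborel. integrable lborel (\<lambda>q'. E (q, q'))"
    by (rule lborel_pair.AE_integrable_fst'[OF E'])
  ultimately have "AE q in lborel. AE q' in lborel. (q, q') \<notin> {p. E p \<noteq> 0}"
  proof eventually_elim
    case (elim q)
    have "h b q = 0" for b
    proof (rule continuous_constant_on_closure[of \<rat> "\<lambda>b. h b q"])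
      show "continuous_on (closure \<rat>) (\<lambda>b. h b q)"
        unfolding h_def using fourier_continuous[OF elim(2)] continuous_on_subset by blast
    qed (use elim(1) Rats_closure_real in auto)
    then have "AE q' in lborel. E (q, q') = 0"
      by (intro AE_zero_of_fourier_zero elim(2)) (simp add: h_def)
    then show ?case by simp
  qed
  moreover have "{p. E p \<noteq> 0} \<in> sets borel"
    using measurable_sets[OF Em, of "- {0}"] by (simp add: vimage_def)
  ultimately show ?thesis using AE_lborel_pairI[of "{p. E p \<noteq> 0}"] by simp
qed

lemma gauss_quarter_L2: "L2_fun (\<lambda>r. complex_of_real (exp (- r\<^sup>2 / 4)))"
proof -
  have "(exp (- r\<^sup>2 / 4))\<^sup>2 = exp (0 * r - 1 / 2 * r\<^sup>2)" for r :: real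
    by (simp add: power2_eq_square[of "exp _"] flip: exp_add)
  then show ?thesis
    unfolding L2_fun_def using integrable_gaussian_real[of "1 / 2" 0] by simp
qed

text \<open>\<open>chi_bound\<close> makes L2 convergence of \<psi> uniform in \<xi>, so continuity
  passes to limits and needs checking only on the total family of Gaussian exponentials.\<close>

lemma chi_continuous:
  assumes \<psi>: "L2_fun \<psi>" and \<phi>: "L2_fun \<phi>"
  shows "continuous_on UNIV (\<lambda>\<xi>. chi \<psi> \<phi> \<kappa> \<xi>)"
  using _ _ _ _ \<psi>
proof (rule L2_gexp_induct[where S = "\<lambda>\<psi>. continuous_on UNIV (\<lambda>\<xi>. chi \<psi> \<phi> \<kappa> \<xi>)"])
  fix f g assume "L2_fun f" "L2_fun g"
    "continuous_on UNIV (\<lambda>\<xi>. chi f \<phi> \<kappa> \<xi>)" "continuous_on UNIV (\<lambda>\<xi>. chi g \<phi> \<kappa> \<xi>)"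
  then show "continuous_on UNIV (\<lambda>\<xi>. chi (\<lambda>x. f x + g x) \<phi> \<kappa> \<xi>)"
    by (simp add: chi_add_left \<phi> continuous_on_add)
next
  fix c f assume "continuous_on UNIV (\<lambda>\<xi>. chi f \<phi> \<kappa> \<xi>)"
  then show "continuous_on UNIV (\<lambda>\<xi>. chi (\<lambda>x. c * f x) \<phi> \<kappa> \<xi>)"
    by (simp add: chi_cmult_left continuous_on_mult_left)
next
  fix u f assume u: "\<And>n. L2_fun (u n)" and f: "L2_fun f" and c: "\<And>n. continuous_on UNIV (\<lambda>\<xi>. chi (u n) \<phi> \<kappa> \<xi>)"
    and lim: "(\<lambda>n. L2_norm (\<lambda>x. u n x - f x)) \<longlonglongrightarrow> 0"
  have "uniform_limit UNIV (\<lambda>n \<xi>. chi (u n) \<phi> \<kappa> \<xi>) (\<lambda>\<xi>. chi f \<phi> \<kappa> \<xi>) sequentially"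
  proof (rule uniform_limitI)
    fix e :: real assume e: "e > 0"
    have le: "dist (chi (u n) \<phi> \<kappa> \<xi>) (chi f \<phi> \<kappa> \<xi>) \<le> L2_norm (\<lambda>x. u n x - f x) * L2_norm \<phi>" for n \<xi>
    proof -
      have "chi (u n) \<phi> \<kappa> \<xi> - chi f \<phi> \<kappa> \<xi> = chi (\<lambda>x. u n x - f x) \<phi> \<kappa> \<xi>"
        using chi_add_left[OF u L2_fun_cmult[OF f, of "-1"] \<phi>, of n \<kappa> \<xi>] chi_cmult_left[of "-1" f \<phi> \<kappa> \<xi>] by simp
      then show ?thesis
        using chi_bound[OF L2_fun_diff[OF u f] \<phi>] by (simp add: dist_norm)
    qed
    have "(\<lambda>n. L2_norm (\<lambda>x. u n x - f x) * L2_norm \<phi>) \<longlonglongrightarrow> 0"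
      using tendsto_mult_right[OF lim, of "L2_norm \<phi>"] by simp
    then have "\<forall>\<^sub>F n in sequentially. L2_norm (\<lambda>x. u n x - f x) * L2_norm \<phi> < e"
      using e by (rule order_tendstoD)
    then show "\<forall>\<^sub>F n in sequentially. \<forall>\<xi>\<in>UNIV. dist (chi (u n) \<phi> \<kappa> \<xi>) (chi f \<phi> \<kappa> \<xi>) < e"
      by eventually_elim (use le in \<open>blast intro: le_less_trans\<close>)
  qed
  then show "continuous_on UNIV (\<lambda>\<xi>. chi f \<phi> \<kappa> \<xi>)"
    by (rule uniform_limit_theorem[rotated]) (use c in auto)
next
  fix v
  note [measurable] = \<phi>[THEN L2_fun_measurable]
  let ?g = "gexp (\<i> * of_real v)"
  \<comment> \<open>Shifting the integration variable removes \<xi> from \<phi>, which has no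
    regularity; all dependence on \<xi> then sits in explicit functions and dominated convergence
    applies.\<close>
  let ?I = "\<lambda>\<xi> r. ?g (r - \<xi>) * cnj (\<phi> r) * cis (- (\<kappa> * (r - \<xi> / 2)))"
  have e: "chi ?g \<phi> \<kappa> \<xi> = (LINT r|lborel. ?I \<xi> r)" for \<xi>
    unfolding chi_def using lborel_integral_shift[of "\<lambda>r. ?g (r - \<xi> / 2) * cnj (\<phi> (r + \<xi> / 2)) * cis (- (\<kappa> * r))" "\<xi> / 2"]
    by simp
  show "continuous_on UNIV (\<lambda>\<xi>. chi ?g \<phi> \<kappa> \<xi>)"
    unfolding e
  proof (rule continuous_at_imp_continuous_on, rule ballI, rule continuous_at_sequentiallyI)
    fix \<xi> :: real and u assume u: "u \<longlonglongrightarrow> \<xi>"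
    obtain B where B: "\<And>n. \<bar>u n\<bar> \<le> B"
      using convergent_imp_Bseq[OF convergentI[OF u]] by (auto simp: Bseq_def)
    show "(\<lambda>n. LINT r|lborel. ?I (u n) r) \<longlonglongrightarrow> (LINT r|lborel. ?I \<xi> r)"
    proof (rule integral_dominated_convergence[where w = "\<lambda>r. exp (B\<^sup>2 / 2) * cmod (complex_of_real (exp (- r\<^sup>2 / 4)) * \<phi> r)"])
      show "integrable lborel (\<lambda>r. exp (B\<^sup>2 / 2) * cmod (complex_of_real (exp (- r\<^sup>2 / 4)) * \<phi> r))"
        by (intro integrable_mult_right integrable_norm L2_mult_integrable gauss_quarter_L2 \<phi>)
      show "AE r in lborel. (\<lambda>n. ?I (u n) r) \<longlonglongrightarrow> ?I \<xi> r"
        unfolding gexp_def by (intro AE_I2 tendsto_intros u) auto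
      show "AE r in lborel. norm (?I (u n) r) \<le> exp (B\<^sup>2 / 2) * cmod (complex_of_real (exp (- r\<^sup>2 / 4)) * \<phi> r)" for n
      proof (rule AE_I2)
        fix r
        have "(u n)\<^sup>2 \<le> B\<^sup>2" using B[of n] by (metis abs_ge_zero power2_abs power_mono)
        \<comment> \<open>This square gives (r - u)^2 / 2 \<ge> r^2 / 4 - u^2 / 2, a Gaussian bound
          of half the decay rate that is uniform in bounded u.\<close>
        moreover have "0 \<le> (r - 2 * u n)\<^sup>2" by simp
        ultimately have "- ((r - u n)\<^sup>2 / 2) \<le> B\<^sup>2 / 2 + (- r\<^sup>2 / 4)"
          by (simp add: power2_diff field_simps power2_eq_square)
        then have "cmod (?g (r - u n)) \<le> exp (B\<^sup>2 / 2) * exp (- r\<^sup>2 / 4)"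
          unfolding norm_gexp exp_add[symmetric] by simp
        then show "norm (?I (u n) r) \<le> exp (B\<^sup>2 / 2) * cmod (complex_of_real (exp (- r\<^sup>2 / 4)) * \<phi> r)"
          unfolding norm_mult norm_of_real by (simp add: mult_right_mono mult.assoc[symmetric])
      qed
    qed measurable
  qed
qed

subsection \<open>The action of a singular Gaussian channel\<close>

definition chi_sum :: "(nat \<Rightarrow> real \<Rightarrow> complex) \<Rightarrow> (nat \<Rightarrow> real \<Rightarrow> complex) \<Rightarrow> real \<Rightarrow> real \<Rightarrow> complex" where
  "chi_sum \<psi> \<phi> \<kappa> \<xi> = (\<Sum>n. chi (\<psi> n) (\<phi> n) \<kappa> \<xi>)"

lemma nuclear_chi_bound: "nuclear \<psi> \<phi> \<Longrightarrow> cmod (chi (\<psi> n) (\<phi> n) \<kappa> \<xi>) \<le> L2_norm (\<psi> n) * L2_norm (\<phi> n)"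
  by (intro chi_bound nuclear_L2)

lemma nuclear_chi_summable: "nuclear \<psi> \<phi> \<Longrightarrow> summable (\<lambda>n. cmod (chi (\<psi> n) (\<phi> n) \<kappa> \<xi>))"
  by (rule summable_comparison_test'[where g = "\<lambda>n. L2_norm (\<psi> n) * L2_norm (\<phi> n)"])
     (auto simp: nuclear_chi_bound, simp add: nuclear_def)

context transform_data
begin

lemma bounded_char_chi_sum:
  assumes nuc: "nuclear \<psi> \<phi>"
  shows "bounded_char (\<Sum>n. L2_norm (\<psi> n) * L2_norm (\<phi> n)) (chi_sum \<psi> \<phi>)"
  unfolding bounded_char_def
proof (intro conjI allI)
  note [measurable] = chi_measurable[OF nuclear_L2(1)[OF nuc, THEN L2_fun_measurable] nuclear_L2(2)[OF nuc, THEN L2_fun_measurable]]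
  show "(\<lambda>p. chi_sum \<psi> \<phi> (fst p) (snd p)) \<in> borel_measurable borel"
    unfolding chi_sum_def by measurable
  show "cmod (chi_sum \<psi> \<phi> \<kappa> \<xi>) \<le> (\<Sum>n. L2_norm (\<psi> n) * L2_norm (\<phi> n))" for \<kappa> \<xi>
    unfolding chi_sum_def
    by (rule norm_suminf_le[OF nuclear_chi_bound[OF nuc]]) (use nuc in \<open>simp add: nuclear_def\<close>)
qed

text \<open>The counterpart of \<open>form_split\<close> for the candidate formula, with L1 norms of
  f in the remainder. Both sides being countably additive, it suffices to compare them on
  dyads.\<close>

lemma qf_out_ker_split:
  assumes "nuclear \<psi> \<phi>" and f: "integrable lborel f"
  shows "cmod (qf f (out_ker (chi_sum \<psi> \<phi>)) f - (\<Sum>n<N'. qf f (out_ker (chi (\<psi> n) (\<phi> n))) f)) \<le>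
    (\<Sum>n. L2_norm (\<psi> (n + N')) * L2_norm (\<phi> (n + N'))) *
      ((LINT q|lborel. cmod (f q)) * (LINT q|lborel. cmod (f q)) / sqrt (2 * pi * N $ 1 $ 1))"
  using assms(1)
proof (induction N' arbitrary: \<psi> \<phi>)
  case 0
  then show ?case using out_ker_qf_bound[OF bounded_char_chi_sum[OF 0] f f] by simp
next
  case (Suc M)
  note nuc' = nuclear_shift[OF Suc.prems]
  have e: "chi_sum \<psi> \<phi> = (\<lambda>\<kappa> \<xi>. chi (\<psi> 0) (\<phi> 0) \<kappa> \<xi> + chi_sum (\<lambda>n. \<psi> (Suc n)) (\<lambda>n. \<phi> (Suc n)) \<kappa> \<xi>)"
    unfolding chi_sum_def
    by (intro ext) (simp add: suminf_split_head[OF summable_norm_cancel[OF nuclear_chi_summable[OF Suc.prems]]])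
  have "qf f (out_ker (chi_sum \<psi> \<phi>)) f = qf f (out_ker (chi (\<psi> 0) (\<phi> 0))) f
     + qf f (out_ker (chi_sum (\<lambda>n. \<psi> (Suc n)) (\<lambda>n. \<phi> (Suc n)))) f"
    unfolding e
    by (rule qf_out_ker_add[OF bounded_char_chi[OF nuclear_L2(1)[OF Suc.prems, of 0] nuclear_L2(2)[OF Suc.prems, of 0]]
         bounded_char_chi_sum[OF nuc'] f])
  then have "qf f (out_ker (chi_sum \<psi> \<phi>)) f - (\<Sum>n<Suc M. qf f (out_ker (chi (\<psi> n) (\<phi> n))) f) =
     qf f (out_ker (chi_sum (\<lambda>n. \<psi> (Suc n)) (\<lambda>n. \<phi> (Suc n)))) f -
     (\<Sum>n<M. qf f (out_ker (chi (\<psi> (Suc n)) (\<phi> (Suc n)))) f)"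
    by (simp only: sum.lessThan_Suc_shift) simp
  then show ?case using Suc.IH[OF nuc'] by simp
qed

lemma qf_out_ker_sums:
  assumes nuc: "nuclear \<psi> \<phi>" and f: "integrable lborel f"
  shows "(\<lambda>n. qf f (out_ker (chi (\<psi> n) (\<phi> n))) f) sums qf f (out_ker (chi_sum \<psi> \<phi>)) f"
  unfolding sums_def
proof (rule Lim_transform2[OF tendsto_const])
  let ?C = "(LINT q|lborel. cmod (f q)) * (LINT q|lborel. cmod (f q)) / sqrt (2 * pi * N $ 1 $ 1)"
  have "(\<lambda>N. \<Sum>n. L2_norm (\<psi> (n + N)) * L2_norm (\<phi> (n + N))) \<longlonglongrightarrow> 0"
  proof (rule LIMSEQ_I)
    fix r :: real assume "0 < r"
    then show "\<exists>N. \<forall>n\<ge>N. norm ((\<Sum>i. L2_norm (\<psi> (i + n)) * L2_norm (\<phi> (i + n))) - 0) < r"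
      using suminf_exist_split[of r "\<lambda>n. L2_norm (\<psi> n) * L2_norm (\<phi> n)"] nuc by (simp add: nuclear_def)
  qed
  from tendsto_mult_right[OF this, of ?C]
  show "(\<lambda>N'. qf f (out_ker (chi_sum \<psi> \<phi>)) f - (\<Sum>n<N'. qf f (out_ker (chi (\<psi> n) (\<phi> n))) f)) \<longlonglongrightarrow> 0"
    by (intro Lim_null_comparison[OF always_eventually[OF allI[OF qf_out_ker_split[OF nuc f]]]]) simp
qed

end

context singular_gaussian_channel
begin

definition defect :: "(real \<Rightarrow> complex) \<Rightarrow> (real \<Rightarrow> complex) \<Rightarrow> (real \<Rightarrow> complex) \<Rightarrow> complex" where
  "defect f \<psi> \<phi> = form f (dyad \<psi> \<phi>) - qf f (out_ker (chi \<psi> \<phi>)) f"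

lemma form_pure_gauss:
  assumes f: "L2_fun f"
  shows "form f (dyad (pure_gauss (1/2) 0 d) (pure_gauss (1/2) 0 d)) =
    qf f (out_ker (chi (pure_gauss (1/2) 0 d) (pure_gauss (1/2) 0 d))) f"
proof -
  have h: "(1/2 :: real) > 0" by simp
  let ?K = "dyad (pure_gauss (1/2) 0 d) (pure_gauss (1/2) 0 d)"
  note st = described[OF gaussian_state_pure[OF h, of 0 d]]
  have "transform_cov T N (pure_cov (1/2) 0) $ 1 $ 1 > 0"
    using pos_def_2D(1)[OF gaussian_state_withD(2)[OF st]] .
  then have e: "out_ker (chi (pure_gauss (1/2) 0 d) (pure_gauss (1/2) 0 d)) =
      gauss_ker (transform_cov T N (pure_cov (1/2) 0)) (T *v d + \<tau>)"
    unfolding chi_pure_gauss[OF h, abs_def] by (rule out_ker_gauss_char[OF transpose_pure_cov[OF h]])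
  have "trace_class (\<Phi> ?K)"
    by (intro channel_trace_class trace_class_dyad L2_fun_pure_gauss h)
  then have "(\<lambda>p. \<Phi> ?K (fst p) (snd p)) \<in> borel_measurable borel" by (rule trace_class_measurable)
  moreover have "(\<lambda>p. gauss_ker (transform_cov T N (pure_cov (1/2) 0)) (T *v d + \<tau>) (fst p) (snd p)) \<in> borel_measurable borel"
    unfolding gauss_ker_def by measurable
  ultimately show ?thesis
    unfolding form_def e by (intro qf_cong gaussian_state_ker[OF st] L2_fun_measurable f)
qed

text \<open>Completing the square in Re s gives exp((Re s)^2 / 2), and the fourth root of pi undoes
  the normalisation at position variance 1/2. Thus the Gaussian exponentials are multiples of states
  on which the channel is prescribed.\<close>

lemma gexp_pure_gauss:
  "gexp s = (\<lambda>q. of_real (sqrt (sqrt pi) * exp ((Re s)\<^sup>2 / 2)) * pure_gauss (1/2) 0 (vector [Re s, Im s]) q)"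
proof
  fix q
  have "s * of_real q - of_real (q\<^sup>2 / 2) =
     of_real ((Re s)\<^sup>2 / 2) + (- of_real ((q - Re s)\<^sup>2 / 2) + \<i> * of_real (Im s * q))"
    by (simp add: complex_eq_iff power2_eq_square field_simps)
  then show "gexp s q = of_real (sqrt (sqrt pi) * exp ((Re s)\<^sup>2 / 2)) * pure_gauss (1/2) 0 (vector [Re s, Im s]) q"
    by (simp add: gexp_def pure_gauss_def exp_add exp_of_real[symmetric])
qed

text \<open>Boundedness of the defect has two sources: \<open>f\<close> in L2 for the channel,
  through the trace bound, and \<open>f\<close> in L1 for the candidate, through its bounded kernel.
  Both constants add up to the bound of the sesquilinear form.\<close>

lemma form_dyad_eq:
  assumes f: "L2_fun f" and fi: "integrable lborel f" and \<psi>: "L2_fun \<psi>" and \<phi>: "L2_fun \<phi>"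
  shows "form f (dyad \<psi> \<phi>) = qf f (out_ker (chi \<psi> \<phi>)) f"
proof -
  let ?C = "(LINT q|lborel. cmod (f q)) * (LINT q|lborel. cmod (f q)) / sqrt (2 * pi * N $ 1 $ 1)"
  interpret bounded_sesquilinear "defect f" "4 * (L2_norm f)\<^sup>2 + ?C"
  proof
    fix u u' g assume a: "L2_fun u" "L2_fun u'" "L2_fun g"
    have "chi (\<lambda>q. u q + u' q) g = (\<lambda>\<kappa> \<xi>. chi u g \<kappa> \<xi> + chi u' g \<kappa> \<xi>)"
      by (intro ext) (rule chi_add_left[OF a])
    then show "defect f (\<lambda>q. u q + u' q) g = defect f u g + defect f u' g"
      using a by (simp add: defect_def form_dyad_add_left[OF f]
          qf_out_ker_add[OF bounded_char_chi[OF a(1,3)] bounded_char_chi[OF a(2,3)] fi])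
    have "chi g (\<lambda>q. u q + u' q) = (\<lambda>\<kappa> \<xi>. chi g u \<kappa> \<xi> + chi g u' \<kappa> \<xi>)"
      by (intro ext) (rule chi_add_right[OF a(3,1,2)])
    then show "defect f g (\<lambda>q. u q + u' q) = defect f g u + defect f g u'"
      using a by (simp add: defect_def form_dyad_add_right[OF f]
          qf_out_ker_add[OF bounded_char_chi[OF a(3,1)] bounded_char_chi[OF a(3,2)] fi])
  next
    fix u g c assume a: "L2_fun u" "L2_fun g"
    have "chi (\<lambda>q. c * u q) g = (\<lambda>\<kappa> \<xi>. c * chi u g \<kappa> \<xi>)" by (intro ext) (rule chi_cmult_left)
    then show "defect f (\<lambda>q. c * u q) g = c * defect f u g"
      using a by (simp add: defect_def form_dyad_cmult_left[OF f] qf_out_ker_cmult right_diff_distrib)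
    have "chi u (\<lambda>q. c * g q) = (\<lambda>\<kappa> \<xi>. cnj c * chi u g \<kappa> \<xi>)" by (intro ext) (rule chi_cmult_right)
    then show "defect f u (\<lambda>q. c * g q) = cnj c * defect f u g"
      using a by (simp add: defect_def form_dyad_cmult_right[OF f] qf_out_ker_cmult right_diff_distrib)
    have "cmod (defect f u g) \<le> cmod (form f (dyad u g)) + cmod (qf f (out_ker (chi u g)) f)"
      unfolding defect_def by (rule norm_triangle_ineq4)
    also have "\<dots> \<le> 4 * (L2_norm u * L2_norm g) * (L2_norm f)\<^sup>2 + (L2_norm u * L2_norm g) * ?C"
      by (intro add_mono form_dyad_bound f a out_ker_qf_bound[OF bounded_char_chi[OF a] fi fi])
    also have "\<dots> = (4 * (L2_norm f)\<^sup>2 + ?C) * (L2_norm u * L2_norm g)"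
      by (simp only: ring_distribs mult_ac)
    finally show "cmod (defect f u g) \<le> (4 * (L2_norm f)\<^sup>2 + ?C) * (L2_norm u * L2_norm g)" .
  qed
  have "defect f (gexp s) (gexp s) = 0" for s
    unfolding gexp_pure_gauss
    by (subst cmult_left, (intro L2_fun_cmult L2_fun_pure_gauss, simp)+, subst cmult_right,
        (intro L2_fun_pure_gauss, simp)+, simp add: defect_def form_pure_gauss[OF f])
  from zero_of_coherent_zero[OF this \<psi> \<phi>] show ?thesis by (simp add: defect_def)
qed

lemma qf_channel_eq:
  assumes f: "L2_fun f" and fi: "integrable lborel f" and nuc: "nuclear \<psi> \<phi>" and K: "ker_sums \<psi> \<phi> K"
  shows "qf f (\<Phi> K) f = qf f (out_ker (chi_sum \<psi> \<phi>)) f"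
proof -
  have "(\<lambda>n. form f (dyad (\<psi> n) (\<phi> n))) sums qf f (\<Phi> K) f"
    using form_sums[OF f nuc K] by (simp add: form_def)
  moreover have "(\<lambda>n. form f (dyad (\<psi> n) (\<phi> n))) sums qf f (out_ker (chi_sum \<psi> \<phi>)) f"
    using qf_out_ker_sums[OF nuc fi] by (simp add: form_dyad_eq[OF f fi nuclear_L2[OF nuc]])
  ultimately show ?thesis by (rule sums_unique2)
qed

end

lemma gexp_integrable: "integrable lborel (gexp s)"
  using integrable_gaussian[of "1 / 2" s] by (simp add: gexp_def[abs_def] algebra_simps)

context singular_gaussian_channel
begin

text \<open>The difference D of the two kernels has vanishing diagonal matrix elements for all f in
  L1 and L2. Polarisation removes the restriction to the diagonal, and a Gaussian weight makes D
  integrable so that its double Fourier transform, made of such matrix elements, can be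
  used.\<close>

lemma channel_kernel:
  assumes nuc: "nuclear \<psi> \<phi>" and K: "ker_sums \<psi> \<phi> K"
  shows "AE p in lborel. \<Phi> K (fst p) (snd p) = out_ker (chi_sum \<psi> \<phi>) (fst p) (snd p)"
proof -
  let ?X = "chi_sum \<psi> \<phi>"
  note bX = bounded_char_chi_sum[OF nuc]
  have tc: "trace_class (\<Phi> K)" by (intro channel_trace_class trace_classI[OF nuc K])
  define D where "D p = \<Phi> K (fst p) (snd p) - out_ker ?X (fst p) (snd p)" for p
  define B where "B f g = (LINT p|lborel. cnj (f (fst p)) * D p * g (snd p))" for f g
  have i1: "integrable lborel (\<lambda>p. cnj (f (fst p)) * \<Phi> K (fst p) (snd p) * g (snd p))"
    if "L2_fun f" "L2_fun g" for f g
    using trace_class_qf_integrable[OF tc that] by (simp add: case_prod_unfold)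
  note i2 = out_ker_qf_integrable[OF bX]
  have split: "cnj (f (fst p)) * D p * g (snd p) = cnj (f (fst p)) * \<Phi> K (fst p) (snd p) * g (snd p)
     - cnj (f (fst p)) * out_ker ?X (fst p) (snd p) * g (snd p)" for f g p
    by (simp add: D_def right_diff_distrib left_diff_distrib)
  have Bi: "integrable lborel (\<lambda>p. cnj (f (fst p)) * D p * g (snd p))"
    if "L2_fun f" "L2_fun g" "integrable lborel f" "integrable lborel g" for f g
    unfolding split by (intro Bochner_Integration.integrable_diff i1 i2 that)
  have B0: "B f f = 0" if f: "L2_fun f" "integrable lborel f" for f
  proof -
    have "B f f = qf f (\<Phi> K) f - qf f (out_ker ?X) f"
      unfolding B_def split qf_def case_prod_unfold by (intro Bochner_Integration.integral_diff i1 i2 f)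
    then show ?thesis using qf_channel_eq[OF f nuc K] by simp
  qed
  have Bzero: "B f g = 0" if f: "L2_fun f" "integrable lborel f" and g: "L2_fun g" "integrable lborel g" for f g
  proof -
    have expand: "B (\<lambda>q. f q + c * g q) (\<lambda>q. f q + c * g q) = B f f + c * B f g + cnj c * B g f + (cnj c * c) * B g g" for c
    proof -
      have eq: "cnj (f (fst p) + c * g (fst p)) * D p * (f (snd p) + c * g (snd p)) =
        cnj (f (fst p)) * D p * f (snd p) + c * (cnj (f (fst p)) * D p * g (snd p)) +
        cnj c * (cnj (g (fst p)) * D p * f (snd p)) + (cnj c * c) * (cnj (g (fst p)) * D p * g (snd p))" for p
        by (simp add: algebra_simps)
      then show ?thesis
        unfolding B_def using Bi[OF f(1) f(1) f(2) f(2)] Bi[OF f(1) g(1) f(2) g(2)] Bi[OF g(1) f(1) g(2) f(2)] Bi[OF g(1) g(1) g(2) g(2)]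
        by simp
    qed
    have z: "B (\<lambda>q. f q + c * g q) (\<lambda>q. f q + c * g q) = 0" for c
      by (intro B0 L2_fun_add L2_fun_cmult Bochner_Integration.integrable_add integrable_mult_right f g)
    \<comment> \<open>The scalars 1 and \<i> give the sum and the difference of the two off-diagonal
      terms.\<close>
    have "B f g + B g f = 0" using expand[of 1] z[of 1] B0[OF f] B0[OF g] by simp
    moreover have "\<i> * B f g + cnj \<i> * B g f = 0" using expand[of \<i>] z[of \<i>] B0[OF f] B0[OF g] by simp
    then have "B f g = B g f" by simp
    ultimately show ?thesis by simp
  qed
  define E where "E p = cnj (gexp 0 (fst p)) * D p * gexp 0 (snd p)" for p
  have "AE p in lborel. E p = 0"
  proof (rule AE_zero_of_double_fourier_zero)
    show "integrable lborel E"
      unfolding E_def[abs_def] by (intro Bi L2_fun_gexp gexp_integrable)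
    fix a b
    have e1: "cis (a * q) * cnj (gexp 0 q) = cnj (gexp (\<i> * of_real (- a)) q)" for q
      by (simp add: gexp_def cis_conv_exp exp_cnj algebra_simps flip: exp_add)
    have e2: "gexp 0 q * cis (b * q) = gexp (\<i> * of_real b) q" for q
      by (simp add: gexp_def cis_conv_exp algebra_simps flip: exp_add)
    have e3: "cis (a * fst p) * E p * cis (b * snd p) =
      cnj (gexp (\<i> * of_real (- a)) (fst p)) * D p * gexp (\<i> * of_real b) (snd p)" for p
    proof -
      have "cis (a * fst p) * E p * cis (b * snd p) =
        (cis (a * fst p) * cnj (gexp 0 (fst p))) * D p * (gexp 0 (snd p) * cis (b * snd p))"
        unfolding E_def by (simp only: mult_ac)
      then show ?thesis unfolding e1 e2 .
    qed
    have "(LINT p|lborel. cis (a * fst p) * E p * cis (b * snd p)) = B (gexp (\<i> * of_real (- a))) (gexp (\<i> * of_real b))"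
      unfolding B_def e3 ..
    also have "\<dots> = 0" by (intro Bzero L2_fun_gexp gexp_integrable)
    finally show "(LINT p|lborel. cis (a * fst p) * E p * cis (b * snd p)) = 0" .
  qed
  then show ?thesis
  proof eventually_elim
    case (elim p)
    have "gexp 0 q \<noteq> 0" for q by (simp add: gexp_def)
    then have "D p = 0" using elim by (simp add: E_def)
    then show ?case by (simp add: D_def)
  qed
qed

lemma channel_pos_rep:
  assumes "nuclear \<psi> \<phi>" "ker_sums \<psi> \<phi> K"
  shows "AE p in lborel. pos_rep (\<Phi> K) (fst p) (snd p) = out_rep (chi_sum \<psi> \<phi>) (fst p) (snd p)"
  using AE_pos_rep_coords[OF channel_kernel[OF assms]]
proof eventually_elim
  case (elim p)
  have "(snd p + fst p / 2) - (snd p - fst p / 2) = fst p" "((snd p - fst p / 2) + (snd p + fst p / 2)) / 2 = snd p" by argo+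
  then show ?case using elim by (simp add: pos_rep_def out_ker_def)
qed

end

subsection \<open>Schwartz kernels\<close>

lemma integrable_inverse_1_plus_square_real: "integrable lborel (\<lambda>x :: real. 1 / (1 + x\<^sup>2))"
  using integrable_inverse_1_plus_square by (simp add: set_integrable_def einterval_def inverse_eq_divide)

text \<open>Adding the four seminorms with weights 1, x^2, r^2 and x^2 r^2 produces the product
  weight (1 + x^2)(1 + r^2), whose inverse is integrable in each variable separately.\<close>

lemma
  assumes "schwartz \<rho>"
  shows schwartz_bound: "\<exists>C. \<forall>x r. cmod (\<rho> x r) \<le> C * (1 / (1 + x\<^sup>2)) * (1 / (1 + r\<^sup>2))"
    and schwartz_continuous: "continuous_on UNIV (\<lambda>x. \<rho> x r)"
proof -
  obtain D where D0: "D 0 0 = \<rho>"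
    and Dd: "\<forall>m n x r. ((\<lambda>u. D m n u r) has_vector_derivative D (Suc m) n x r) (at x) \<and>
      ((\<lambda>u. D m n x u) has_vector_derivative D m (Suc n) x r) (at r)"
    and Db: "\<forall>m n k l. bounded (range (\<lambda>(x, r). of_real (x ^ k * r ^ l) * D m n x r))"
    using assms unfolding schwartz_def by (elim exE conjE) (rule that)
  have "\<exists>C. \<forall>x r. cmod (of_real (x ^ k * r ^ l) * \<rho> x r) \<le> C" for k l
    using Db[rule_format, of k l 0 0] unfolding D0 bounded_iff by auto
  then obtain C where C: "\<And>k l x r. cmod (of_real (x ^ k * r ^ l) * \<rho> x r) \<le> C k l" by metis
  have "cmod (\<rho> x r) \<le> (C 0 0 + C 2 0 + C 0 2 + C 2 2) * (1 / (1 + x\<^sup>2)) * (1 / (1 + r\<^sup>2))" for x r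
  proof -
    have "cmod (\<rho> x r) * ((1 + x\<^sup>2) * (1 + r\<^sup>2)) =
      cmod (of_real (x ^ 0 * r ^ 0) * \<rho> x r) + cmod (of_real (x ^ 2 * r ^ 0) * \<rho> x r) +
      cmod (of_real (x ^ 0 * r ^ 2) * \<rho> x r) + cmod (of_real (x ^ 2 * r ^ 2) * \<rho> x r)"
      unfolding norm_mult norm_of_real by (simp add: abs_mult algebra_simps)
    also have "\<dots> \<le> C 0 0 + C 2 0 + C 0 2 + C 2 2" by (intro add_mono C)
    finally have le: "cmod (\<rho> x r) * ((1 + x\<^sup>2) * (1 + r\<^sup>2)) \<le> C 0 0 + C 2 0 + C 0 2 + C 2 2" .
    have "0 < (1 + x\<^sup>2) * (1 + r\<^sup>2)" by (intro mult_pos_pos add_pos_nonneg) auto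
    then have "cmod (\<rho> x r) \<le> (C 0 0 + C 2 0 + C 0 2 + C 2 2) / ((1 + x\<^sup>2) * (1 + r\<^sup>2))"
      using le by (simp add: pos_le_divide_eq)
    then show ?thesis by simp
  qed
  then show "\<exists>C. \<forall>x r. cmod (\<rho> x r) \<le> C * (1 / (1 + x\<^sup>2)) * (1 / (1 + r\<^sup>2))" by blast
  show "continuous_on UNIV (\<lambda>x. \<rho> x r)"
  proof (intro continuous_at_imp_continuous_on ballI)
    fix x
    show "isCont (\<lambda>x. \<rho> x r) x"
      using Dd[rule_format, of 0 0 r x, THEN conjunct1] unfolding D0 by (rule has_vector_derivative_continuous)
  qed
qed

text \<open>The characteristic function computed from the kernel itself, without a nuclear
  decomposition; for Schwartz kernels it is meaningful at every single \<xi>.\<close>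

definition fourier_r :: "(real \<Rightarrow> real \<Rightarrow> complex) \<Rightarrow> real \<Rightarrow> real \<Rightarrow> complex" where
  "fourier_r \<rho> \<kappa> \<xi> = (LINT r|lborel. \<rho> \<xi> r * cis (- (\<kappa> * r)))"

locale schwartz_kernel =
  fixes K :: opker
  assumes tc: "trace_class K" and schw: "schwartz (pos_rep K)"
begin

lemma pos_rep_pair_measurable: "(\<lambda>p. pos_rep K (fst p) (snd p)) \<in> borel_measurable borel"
  by (rule pos_rep_measurable[OF trace_class_measurable[OF tc]])

lemma pos_rep_compose [measurable (raw)]:
  assumes "f \<in> borel_measurable M" "g \<in> borel_measurable M"
  shows "(\<lambda>z. pos_rep K (f z) (g z)) \<in> borel_measurable M"
proof -
  have "(\<lambda>z. (f z, g z)) \<in> M \<rightarrow>\<^sub>M borel" unfolding borel_prod[symmetric] using assms by measurable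
  from measurable_compose[OF this pos_rep_pair_measurable] show ?thesis by simp
qed

lemma pos_rep_section_integrable: "integrable lborel (\<lambda>r. pos_rep K x r)"
proof -
  obtain C where C: "\<And>x r. cmod (pos_rep K x r) \<le> C * (1 / (1 + x\<^sup>2)) * (1 / (1 + r\<^sup>2))"
    using schwartz_bound[OF schw] by blast
  show ?thesis
  proof (rule Bochner_Integration.integrable_bound)
    show "integrable lborel (\<lambda>r. C * (1 / (1 + x\<^sup>2)) * (1 / (1 + r\<^sup>2)))"
      by (intro integrable_mult_right integrable_inverse_1_plus_square_real)
    show "AE r in lborel. norm (pos_rep K x r) \<le> norm (C * (1 / (1 + x\<^sup>2)) * (1 / (1 + r\<^sup>2)))"
      by (intro AE_I2 order_trans[OF C]) (simp only: real_norm_def abs_ge_self)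
  qed measurable
qed

lemma pos_rep_integrable: "integrable (lborel \<Otimes>\<^sub>M lborel) (\<lambda>p. pos_rep K (fst p) (snd p))"
proof -
  obtain C where C: "\<And>x r. cmod (pos_rep K x r) \<le> C * (1 / (1 + x\<^sup>2)) * (1 / (1 + r\<^sup>2))"
    using schwartz_bound[OF schw] by blast
  have "integrable lborel (\<lambda>p. C * (1 / (1 + (fst p)\<^sup>2) * (1 / (1 + (snd p)\<^sup>2))) :: real)"
    using integrable_lborel_prod[OF integrable_inverse_1_plus_square_real integrable_inverse_1_plus_square_real]
    by (intro integrable_mult_right) (simp add: case_prod_unfold)
  then show ?thesis
    unfolding lborel_prod
  proof (rule Bochner_Integration.integrable_bound)
    show "AE p in lborel. norm (pos_rep K (fst p) (snd p)) \<le> norm (C * (1 / (1 + (fst p)\<^sup>2) * (1 / (1 + (snd p)\<^sup>2))))"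
    proof (rule AE_I2)
      fix p :: "real \<times> real"
      show "norm (pos_rep K (fst p) (snd p)) \<le> norm (C * (1 / (1 + (fst p)\<^sup>2) * (1 / (1 + (snd p)\<^sup>2))))"
        using order_trans[OF C[of "fst p" "snd p"] abs_ge_self] by (simp only: mult.assoc real_norm_def)
    qed
  qed (simp add: pos_rep_pair_measurable)
qed

lemma fourier_r_continuous: "continuous_on UNIV (\<lambda>\<xi>. fourier_r (pos_rep K) \<kappa> \<xi>)"
proof (rule continuous_at_imp_continuous_on, rule ballI, rule continuous_at_sequentiallyI)
  fix \<xi> :: real and u assume u: "u \<longlonglongrightarrow> \<xi>"
  obtain C where C: "\<And>x r. cmod (pos_rep K x r) \<le> C * (1 / (1 + x\<^sup>2)) * (1 / (1 + r\<^sup>2))"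
    using schwartz_bound[OF schw] by blast
  have C0: "0 \<le> C" using order_trans[OF norm_ge_zero C[of 0 0]] by simp
  show "(\<lambda>n. fourier_r (pos_rep K) \<kappa> (u n)) \<longlonglongrightarrow> fourier_r (pos_rep K) \<kappa> \<xi>"
    unfolding fourier_r_def
  proof (rule integral_dominated_convergence[where w = "\<lambda>r. C * (1 / (1 + r\<^sup>2))"])
    show "integrable lborel (\<lambda>r. C * (1 / (1 + r\<^sup>2)))"
      by (intro integrable_mult_right integrable_inverse_1_plus_square_real)
    show "AE r in lborel. (\<lambda>n. pos_rep K (u n) r * cis (- (\<kappa> * r))) \<longlonglongrightarrow> pos_rep K \<xi> r * cis (- (\<kappa> * r))"
    proof (rule AE_I2)
      fix r
      have "continuous (at \<xi>) (\<lambda>x. pos_rep K x r)"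
        using schwartz_continuous[OF schw, of r] by (simp add: continuous_on_eq_continuous_at)
      then have "(\<lambda>n. pos_rep K (u n) r) \<longlonglongrightarrow> pos_rep K \<xi> r"
        using u by (rule isCont_tendsto_compose)
      then show "(\<lambda>n. pos_rep K (u n) r * cis (- (\<kappa> * r))) \<longlonglongrightarrow> pos_rep K \<xi> r * cis (- (\<kappa> * r))"
        by (intro tendsto_intros)
    qed
    show "AE r in lborel. norm (pos_rep K (u n) r * cis (- (\<kappa> * r))) \<le> C * (1 / (1 + r\<^sup>2))" for n
    proof (rule AE_I2)
      fix r
      have "C * (1 / (1 + (u n)\<^sup>2)) * (1 / (1 + r\<^sup>2)) \<le> C * 1 * (1 / (1 + r\<^sup>2))"
        using C0 by (intro mult_right_mono mult_left_mono) (auto simp: divide_le_eq_1 add_pos_nonneg)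
      then show "norm (pos_rep K (u n) r * cis (- (\<kappa> * r))) \<le> C * (1 / (1 + r\<^sup>2))"
        using C[of "u n" r] by (simp add: norm_mult)
    qed
  qed measurable
qed

lemma chi_sum_continuous:
  assumes nuc: "nuclear \<psi> \<phi>"
  shows "continuous_on UNIV (\<lambda>\<xi>. chi_sum \<psi> \<phi> \<kappa> \<xi>)"
proof -
  have "uniform_limit UNIV (\<lambda>n \<xi>. \<Sum>i<n. chi (\<psi> i) (\<phi> i) \<kappa> \<xi>) (\<lambda>\<xi>. \<Sum>i. chi (\<psi> i) (\<phi> i) \<kappa> \<xi>) sequentially"
    by (rule Weierstrass_m_test[OF nuclear_chi_bound[OF nuc]]) (use nuc in \<open>simp add: nuclear_def\<close>)
  then show ?thesis
    unfolding chi_sum_def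
    by (rule uniform_limit_theorem[rotated])
       (auto intro!: always_eventually continuous_on_sum chi_continuous nuclear_L2[OF nuc])
qed

text \<open>Both sides are continuous in the difference variable, which removes the null set on which a
  nuclear decomposition need not represent the kernel.\<close>

lemma chi_sum_eq_fourier:
  assumes nuc: "nuclear \<psi> \<phi>" and K: "ker_sums \<psi> \<phi> K"
  shows "chi_sum \<psi> \<phi> \<kappa> \<xi> = fourier_r (pos_rep K) \<kappa> \<xi>"
proof -
  have "AE p in lborel. (\<lambda>n. \<psi> n (fst p) * cnj (\<phi> n (snd p))) sums K (fst p) (snd p)"
    using K by (simp add: ker_sums_def case_prod_unfold)
  from AE_pos_rep_coords[OF this]
  have ae: "AE p in lborel \<Otimes>\<^sub>M lborel. (\<lambda>n. \<psi> n (snd p - fst p / 2) * cnj (\<phi> n (snd p + fst p / 2))) sums pos_rep K (fst p) (snd p)"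
    unfolding lborel_prod pos_rep_def .
  have "AE \<xi> in lborel. chi_sum \<psi> \<phi> \<kappa> \<xi> = fourier_r (pos_rep K) \<kappa> \<xi>"
    using lborel_pair.AE_pair[OF ae]
  proof eventually_elim
    case (elim \<xi>)
    let ?F = "\<lambda>n r. \<psi> n (r - \<xi> / 2) * cnj (\<phi> n (r + \<xi> / 2)) * cis (- (\<kappa> * r))"
    have Fi: "integrable lborel (?F n)" for n by (intro chi_integrable nuclear_L2[OF nuc])
    have le: "(LINT r|lborel. norm (?F n r)) \<le> L2_norm (\<psi> n) * L2_norm (\<phi> n)" for n
      using chi_abs_integral[OF nuclear_L2(1)[OF nuc, of n] nuclear_L2(2)[OF nuc, of n], of \<xi>] by (simp add: norm_mult)
    have sm: "summable (\<lambda>n. LINT r|lborel. norm (?F n r))"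
    proof (rule summable_comparison_test')
      show "summable (\<lambda>n. L2_norm (\<psi> n) * L2_norm (\<phi> n))" using nuc by (simp add: nuclear_def)
      show "norm (LINT r|lborel. norm (?F n r)) \<le> L2_norm (\<psi> n) * L2_norm (\<phi> n)" for n
        using le[of n] by (subst real_norm_def, subst abs_of_nonneg) (auto intro!: integral_nonneg_AE)
    qed
    have as: "AE r in lborel. summable (\<lambda>n. norm (?F n r))"
      by (rule AE_summable_integral[OF integrable_norm[OF Fi] _ sm]) simp
    have "chi_sum \<psi> \<phi> \<kappa> \<xi> = (LINT r|lborel. (\<Sum>n. ?F n r))"
      unfolding chi_sum_def chi_def using integral_suminf[OF Fi as sm] by simp
    also have "\<dots> = fourier_r (pos_rep K) \<kappa> \<xi>"
      unfolding fourier_r_def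
    proof (rule integral_cong_AE)
      note [measurable] = nuclear_L2[OF nuc, THEN L2_fun_measurable]
      show "(\<lambda>r. \<Sum>n. ?F n r) \<in> borel_measurable lborel" by measurable
      show "(\<lambda>r. pos_rep K \<xi> r * cis (- (\<kappa> * r))) \<in> borel_measurable lborel" by measurable
      show "AE r in lborel. (\<Sum>n. ?F n r) = pos_rep K \<xi> r * cis (- (\<kappa> * r))"
        using elim
      proof eventually_elim
        case (elim r)
        from sums_mult2[OF elim, of "cis (- (\<kappa> * r))"] show ?case by (simp add: sums_iff)
      qed
    qed
    finally show ?case .
  qed
  then have "AE \<xi> in lebesgue. \<xi> \<in> {\<xi>. chi_sum \<psi> \<phi> \<kappa> \<xi> = fourier_r (pos_rep K) \<kappa> \<xi>}"
    by (simp add: AE_completion)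
  from mem_closed_if_AE_lebesgue[OF closed_Collect_eq[OF chi_sum_continuous[OF nuc] fourier_r_continuous] this]
  show ?thesis by simp
qed

end

lemma (in singular_gaussian_channel) channel_schwartz:
  assumes "trace_class K" "schwartz (pos_rep K)"
  shows "AE p in lborel. pos_rep (\<Phi> K) (fst p) (snd p) = out_rep (fourier_r (pos_rep K)) (fst p) (snd p)"
proof -
  interpret schwartz_kernel K by unfold_locales fact+
  obtain \<psi> \<phi> where nuc: "nuclear \<psi> \<phi>" and K: "ker_sums \<psi> \<phi> K"
    using tc by (auto simp: trace_class_iff)
  have "chi_sum \<psi> \<phi> = fourier_r (pos_rep K)"
    by (intro ext) (rule chi_sum_eq_fourier[OF nuc K])
  with channel_pos_rep[OF nuc K] show ?thesis by simp
qed

subsection \<open>The functional forms\<close>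

text \<open>The prefactor carries the modulus of b3 because it is the Jacobian of a substitution: b3
  will be 1 / T12, whose sign is dictated by the channel.\<close>

definition kernel_one ::
  "real \<Rightarrow> real \<Rightarrow> real \<Rightarrow> real \<Rightarrow> real \<Rightarrow> real \<Rightarrow> real \<Rightarrow> real \<Rightarrow> real \<Rightarrow> real \<Rightarrow> real \<Rightarrow> real \<Rightarrow> complex" where
  "kernel_one a1 a2 a3 b1 b3 b4 c1 c2 xf xi rf ri = of_real (\<bar>b3\<bar> / (2 * pi)) *
     exp (\<i> * of_real (b1 * xf * rf + b3 * xi * rf + b4 * xi * ri + c1 * xf + c2 * xi)
          - of_real (a1 * xf\<^sup>2 + a2 * xf * xi + a3 * xi\<^sup>2))"

text \<open>The last exponent is the complete square e1 (rf - d + e2 ri / (2 e1))^2. Its offset d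
  will be the first component of \<tau>, by which the channel displaces the centre coordinate; d = 0
  leaves the undisplaced form in rf. The factor |\<beta>| cancels the mass 1/|\<beta>| of
  \<open>delta_affine\<close>.\<close>

definition kernel_two ::
  "real \<Rightarrow> real \<Rightarrow> real \<Rightarrow> real \<Rightarrow> real \<Rightarrow> real \<Rightarrow> real \<Rightarrow> real \<Rightarrow> real \<Rightarrow> real \<Rightarrow> real \<Rightarrow> real \<Rightarrow> real \<Rightarrow>
   real \<Rightarrow> real \<Rightarrow> real \<Rightarrow> real \<Rightarrow> complex" where
  "kernel_two \<beta> a1 a2 a3 b1 b2 b3 b4 c1 c2 e1 e2 d xf xi rf ri = of_real (\<bar>\<beta>\<bar> * sqrt (e1 / pi)) *
     exp (- of_real (a2 * xf * xi + a1 * xf\<^sup>2 + a3 * xi\<^sup>2)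
          + \<i> * of_real (b2 * xf * ri + b3 * rf * xi + b1 * rf * xf + b4 * ri * xi + c1 * xf + c2 * xi)
          - of_real (e1 * (rf - d)\<^sup>2 + e2 * (rf - d) * ri + e2\<^sup>2 * ri\<^sup>2 / (4 * e1)))"

context singular_gaussian_channel
begin

lemma norm_gauss_char_N_le: "cmod (gauss_char N \<tau> k x) \<le> 1"
  using N_psd[of k x] by (simp add: norm_gauss_char)

lemma form_one:
  assumes t: "T $ 1 $ 2 \<noteq> 0"
  shows "\<exists>a1 a2 a3 b1 b3 b4 c1 c2. has_kernel \<Phi> (\<lambda>xf. lborel) (kernel_one a1 a2 a3 b1 b3 b4 c1 c2)"
proof -
  let ?t = "T $ 1 $ 2" and ?w = "T $ 2 $ 2"
  \<comment> \<open>These are the coefficients of \<open>quad2 N k x / 2\<close>, and c1, c2 those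
    of minus \<open>k * \<tau> $ 1 + x * \<tau> $ 2\<close>, after inserting k = (xi - T22 x) /
    T12.\<close>
  define a1 a2 a3 where "a1 = N $ 1 $ 1 * ?w\<^sup>2 / (2 * ?t\<^sup>2) - N $ 1 $ 2 * ?w / ?t + N $ 2 $ 2 / 2"
    and "a2 = N $ 1 $ 2 / ?t - N $ 1 $ 1 * ?w / ?t\<^sup>2" and "a3 = N $ 1 $ 1 / (2 * ?t\<^sup>2)"
  define c1 c2 where "c1 = ?w * \<tau> $ 1 / ?t - \<tau> $ 2" and "c2 = - \<tau> $ 1 / ?t"
  let ?J = "kernel_one a1 a2 a3 (- ?w / ?t) (1 / ?t) (- T $ 1 $ 1 / ?t) c1 c2"
  \<comment> \<open>Because det T = 0, the frequency T11 k + T21 x is T11 / T12 times xi = T12 k +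
    T22 x. It depends on xi alone, so the phase in ri has no xf.\<close>
  let ?k = "\<lambda>x xi. (xi - ?w * x) / ?t" and ?\<kappa> = "\<lambda>xi. T $ 1 $ 1 / ?t * xi"
  have J_eq: "?J x xi r ri = of_real (\<bar>1 / ?t\<bar> / (2 * pi)) * (cis (?k x xi * r) * gauss_char N \<tau> (?k x xi) x) * cis (- (?\<kappa> xi * ri))"
    for x xi r ri
  proof -
    have q: "quad2 N (?k x xi) x / 2 = a1 * x\<^sup>2 + a2 * x * xi + a3 * xi\<^sup>2"
      using t by (simp add: quad2_def a1_def a2_def a3_def field_simps power2_eq_square)
    have l: "?k x xi * r - (?k x xi * \<tau> $ 1 + x * \<tau> $ 2) - ?\<kappa> xi * ri =
      - ?w / ?t * x * r + 1 / ?t * xi * r + - T $ 1 $ 1 / ?t * xi * ri + c1 * x + c2 * xi"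
      using t by (simp add: c1_def c2_def field_simps)
    have "(cis (?k x xi * r) * gauss_char N \<tau> (?k x xi) x) * cis (- (?\<kappa> xi * ri)) =
      exp (\<i> * of_real (?k x xi * r - (?k x xi * \<tau> $ 1 + x * \<tau> $ 2) - ?\<kappa> xi * ri) - of_real (quad2 N (?k x xi) x / 2))"
      unfolding gauss_char_def cis_conv_exp exp_add[symmetric] by (simp add: algebra_simps)
    then show ?thesis unfolding kernel_one_def l q by (simp only: mult.assoc)
  qed
  have "has_kernel \<Phi> (\<lambda>xf. lborel) ?J"
    unfolding has_kernel_def
  proof (intro allI impI)
    fix K assume K: "trace_class K \<and> schwartz (pos_rep K)"
    interpret schwartz_kernel K using K by unfold_locales auto
    have main: "integrable (lborel \<Otimes>\<^sub>M lborel) (\<lambda>(xi, ri). ?J x xi r ri * pos_rep K xi ri) \<and>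
      out_rep (fourier_r (pos_rep K)) x r = (LINT (xi, ri)|(lborel \<Otimes>\<^sub>M lborel). ?J x xi r ri * pos_rep K xi ri)" for x r
    proof
      have Jm [measurable]: "(\<lambda>p. ?J x (fst p) r (snd p)) \<in> borel_measurable (borel \<Otimes>\<^sub>M borel)"
        unfolding kernel_one_def by measurable
      have i: "integrable (lborel \<Otimes>\<^sub>M lborel) (\<lambda>p. ?J x (fst p) r (snd p) * pos_rep K (fst p) (snd p))"
      proof (rule Bochner_Integration.integrable_bound)
        show "integrable (lborel \<Otimes>\<^sub>M lborel) (\<lambda>p. \<bar>1 / ?t\<bar> / (2 * pi) * cmod (pos_rep K (fst p) (snd p)))"
          by (intro integrable_mult_right integrable_norm pos_rep_integrable)
        have "cmod (?J x xi r ri) \<le> \<bar>1 / ?t\<bar> / (2 * pi)" for xi ri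
        proof -
          have "cmod (?J x xi r ri) = \<bar>1 / ?t\<bar> / (2 * pi) * cmod (gauss_char N \<tau> (?k x xi) x)"
            unfolding J_eq norm_mult norm_of_real by simp
          also have "\<dots> \<le> \<bar>1 / ?t\<bar> / (2 * pi) * 1"
            by (intro mult_left_mono norm_gauss_char_N_le) simp
          finally show ?thesis by simp
        qed
        then show "AE p in lborel \<Otimes>\<^sub>M lborel. norm (?J x (fst p) r (snd p) * pos_rep K (fst p) (snd p)) \<le>
            norm (\<bar>1 / ?t\<bar> / (2 * pi) * cmod (pos_rep K (fst p) (snd p)))"
          unfolding norm_mult real_norm_def by (intro AE_I2 mult_mono order_trans[OF _ abs_ge_self]) auto
      qed measurable
      then show "integrable (lborel \<Otimes>\<^sub>M lborel) (\<lambda>(xi, ri). ?J x xi r ri * pos_rep K xi ri)"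
        by (simp add: case_prod_unfold)
      define G where "G xi = of_real (\<bar>1 / ?t\<bar> / (2 * pi)) * (cis (?k x xi * r) * gauss_char N \<tau> (?k x xi) x) * fourier_r (pos_rep K) (?\<kappa> xi) xi" for xi
      have inner: "(LINT ri|lborel. ?J x xi r ri * pos_rep K xi ri) = G xi" for xi
      proof -
        have "?J x xi r ri * pos_rep K xi ri = of_real (\<bar>1 / ?t\<bar> / (2 * pi)) * (cis (?k x xi * r) * gauss_char N \<tau> (?k x xi) x) *
          (pos_rep K xi ri * cis (- (?\<kappa> xi * ri)))" for ri
          unfolding J_eq by (simp only: mult_ac)
        then show ?thesis unfolding G_def fourier_r_def by (simp only: integral_mult_right_zero)
      qed
      have Gk: "G (?w * x + ?t * k) = of_real (1 / (2 * pi * \<bar>?t\<bar>)) *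
         (cis (k * r) * (pull (fourier_r (pos_rep K)) k x * gauss_char N \<tau> k x))" for k
      proof -
        have "?k x (?w * x + ?t * k) = k" using t by simp
        moreover have "?\<kappa> (?w * x + ?t * k) = T $ 1 $ 1 * k + T $ 2 $ 1 * x"
          using t sing by (simp add: det_2 field_simps)
        moreover have "\<bar>1 / ?t\<bar> / (2 * pi) = 1 / (2 * pi * \<bar>?t\<bar>)" by simp
        ultimately show ?thesis unfolding G_def pull_def by (simp only: mult_ac add_ac)
      qed
      have "(LINT (xi, ri)|(lborel \<Otimes>\<^sub>M lborel). ?J x xi r ri * pos_rep K xi ri) = (LINT xi|lborel. G xi)"
        using lborel_pair.integral_fst'[OF i] unfolding fst_conv snd_conv inner by (simp add: case_prod_unfold)
      also have "\<dots> = \<bar>?t\<bar> *\<^sub>R (LINT k|lborel. G (?w * x + ?t * k))"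
        by (rule lborel_integral_real_affine[OF t])
      also have "\<dots> = out_rep (fourier_r (pos_rep K)) x r"
        unfolding Gk out_rep_def integral_mult_right_zero using t by (simp add: scaleR_conv_of_real)
      finally show "out_rep (fourier_r (pos_rep K)) x r = (LINT (xi, ri)|(lborel \<Otimes>\<^sub>M lborel). ?J x xi r ri * pos_rep K xi ri)" ..
    qed
    show "AE (xf, rf) in lborel. integrable (lborel \<Otimes>\<^sub>M lborel) (\<lambda>(xi, ri). ?J xf xi rf ri * pos_rep K xi ri) \<and>
      pos_rep (\<Phi> K) xf rf = (LINT (xi, ri)|(lborel \<Otimes>\<^sub>M lborel). ?J xf xi rf ri * pos_rep K xi ri)"
      using channel_schwartz[OF tc schw] unfolding case_prod_unfold
    proof eventually_elim
      case (elim p)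
      with main[of "fst p" "snd p", unfolded case_prod_unfold] show ?case by simp
    qed
  qed
  then show ?thesis by blast
qed

end

section \<open>Integration against the delta measure in the initial difference coordinate\<close>

lemma AE_delta_affine: "AE x in delta_affine a b. x = a / b"
  unfolding delta_affine_def by (subst AE_density) (auto simp: AE_return)

lemma sigma_finite_delta_affine: "sigma_finite_measure (delta_affine a b)"
proof -
  have "finite_measure (delta_affine a b)"
    by (rule finite_measureI) (simp add: delta_affine_def emeasure_density nn_integral_return)
  then show ?thesis by (rule finite_measure.axioms)
qed

lemma sets_delta_affine [measurable_cong]: "sets (delta_affine a b) = sets borel"
  by (simp add: delta_affine_def)

text \<open>The delta measure is finite and carried by the single point a / b, so integrability of
  that one section suffices for Fubini on the product.\<close>

lemma
  fixes h :: "real \<times> real \<Rightarrow> complex"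
  assumes hm: "h \<in> borel_measurable (borel \<Otimes>\<^sub>M borel)" and i: "integrable lborel (\<lambda>y. h (a / b, y))"
  shows delta_affine_pair_integrable: "integrable (delta_affine a b \<Otimes>\<^sub>M lborel) h"
    and delta_affine_pair_integral: "(LINT p|(delta_affine a b \<Otimes>\<^sub>M lborel). h p) = (LINT y|lborel. h (a / b, y)) / of_real \<bar>b\<bar>"
proof -
  note [measurable] = hm
  interpret M: sigma_finite_measure "delta_affine a b" by (rule sigma_finite_delta_affine)
  interpret P: pair_sigma_finite "delta_affine a b" "lborel :: real measure" by unfold_locales
  have fin: "finite_measure (delta_affine a b)"
    by (rule finite_measureI) (simp add: delta_affine_def emeasure_density nn_integral_return)
  have hm' [measurable]: "h \<in> borel_measurable (delta_affine a b \<Otimes>\<^sub>M lborel)"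
    by measurable
  show I: "integrable (delta_affine a b \<Otimes>\<^sub>M lborel) h"
  proof (rule P.Fubini_integrable[OF hm'])
    have "integrable (delta_affine a b) (\<lambda>x. LINT y|lborel. norm (h (a / b, y)))"
      by (rule finite_measure.integrable_const[OF fin])
    then show "integrable (delta_affine a b) (\<lambda>x. LINT y|lborel. norm (h (x, y)))"
      by (rule integrable_cong_AE_imp)
         (measurable, use AE_delta_affine[of a b] in \<open>auto elim!: eventually_mono\<close>)
    show "AE x in delta_affine a b. integrable lborel (\<lambda>y. h (x, y))"
      using AE_delta_affine[of a b] by eventually_elim (use i in simp)
  qed
  show "(LINT p|(delta_affine a b \<Otimes>\<^sub>M lborel). h p) = (LINT y|lborel. h (a / b, y)) / of_real \<bar>b\<bar>"
    unfolding P.integral_fst'[OF I, symmetric] by (rule integral_delta_affine) measurable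
qed

context singular_gaussian_channel
begin

lemma gauss_rep_N_bound: "cmod (gauss_rep N \<tau> x r) \<le> 1 / sqrt (2 * pi * N $ 1 $ 1)"
proof -
  let ?S = "(r - \<tau> $ 1)\<^sup>2 / (2 * N $ 1 $ 1) + (N $ 2 $ 2 - (N $ 1 $ 2)\<^sup>2 / N $ 1 $ 1) * x\<^sup>2 / 2"
  have n: "cmod (exp (- of_real S - \<i> * of_real Y)) = exp (- S)" for S Y :: real by simp
  have "0 \<le> ?S"
    using quad2_N_ge[of 0 x] N11 by (simp add: quad2_def left_diff_distrib)
  then have "1 / sqrt (2 * pi * N $ 1 $ 1) * exp (- ?S) \<le> 1 / sqrt (2 * pi * N $ 1 $ 1) * 1"
    using N11 by (intro mult_left_mono) (simp_all only: exp_le_one_iff neg_le_0_iff_le, simp)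
  then show ?thesis
    using N11 unfolding gauss_rep_def norm_mult norm_of_real n by simp
qed

lemma form_two:
  assumes t: "T $ 1 $ 2 = 0"
  shows "\<exists>\<alpha> \<beta> a1 a2 a3 b1 b2 b3 b4 c1 c2 e1 e2 d. \<beta> \<noteq> 0 \<and> e1 > 0 \<and> e2 * \<alpha> = 0 \<and> (\<tau> $ 1 = 0 \<longrightarrow> d = 0) \<and>
    has_kernel \<Phi> (\<lambda>xf. delta_affine (\<alpha> * xf) \<beta>) (kernel_two \<beta> a1 a2 a3 b1 b2 b3 b4 c1 c2 e1 e2 d)"
proof -
  let ?n = "N $ 1 $ 1" and ?m = "N $ 1 $ 2" and ?w = "T $ 2 $ 2" and ?v = "T $ 1 $ 1"
  \<comment> \<open>Obtained by expanding \<open>gauss_rep N \<tau> x (r - T11 * ri)\<close> times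
    the phase exp(- \<i> T21 x ri). Terms in xi are set to zero since the delta makes xi a multiple
    of x; \<beta> = 1 and \<alpha> = T22.\<close>
  let ?J = "kernel_two 1 ((N $ 2 $ 2 - ?m\<^sup>2 / ?n) / 2) 0 0 (- ?m / ?n) (?m * ?v / ?n - T $ 2 $ 1) 0 0 (?m * \<tau> $ 1 / ?n - \<tau> $ 2) 0
     (1 / (2 * ?n)) (- ?v / ?n) (\<tau> $ 1)"
  have J_eq: "?J x xi r ri = gauss_rep N \<tau> x (r - ?v * ri) * cis (- (T $ 2 $ 1 * x * ri))" for x xi r ri
  proof -
    have c: "\<bar>1\<bar> * sqrt (1 / (2 * ?n) / pi) = 1 / sqrt (2 * pi * ?n)"
      by (simp add: real_sqrt_divide real_sqrt_mult)
    have e: "(r - ?v * ri - \<tau> $ 1)\<^sup>2 / (2 * ?n) =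
       1 / (2 * ?n) * (r - \<tau> $ 1)\<^sup>2 + - ?v / ?n * (r - \<tau> $ 1) * ri + (- ?v / ?n)\<^sup>2 * ri\<^sup>2 / (4 * (1 / (2 * ?n)))"
      using N11 by (simp add: power2_eq_square field_simps)
    have p: "- (((r - ?v * ri - \<tau> $ 1) * ?m / ?n + \<tau> $ 2) * x) - T $ 2 $ 1 * x * ri =
       (?m * ?v / ?n - T $ 2 $ 1) * x * ri + 0 * r * xi + - ?m / ?n * r * x + 0 * ri * xi + (?m * \<tau> $ 1 / ?n - \<tau> $ 2) * x + 0 * xi"
      using N11 by (simp add: field_simps)
    have a: "(N $ 2 $ 2 - ?m\<^sup>2 / ?n) * x\<^sup>2 / 2 = 0 * x * xi + (N $ 2 $ 2 - ?m\<^sup>2 / ?n) / 2 * x\<^sup>2 + 0 * xi\<^sup>2" by simp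
    have "(C * exp (- of_real (A + B) - \<i> * of_real Y)) * cis (- Z) =
        C * exp (- of_real B + \<i> * of_real (- Y - Z) - of_real A)" for A B Y Z :: real and C :: complex
      unfolding cis_conv_exp mult.assoc exp_add[symmetric]
      by (rule arg_cong[where f = "\<lambda>z. C * exp z"]) (simp add: algebra_simps)
    then have "gauss_rep N \<tau> x (r - ?v * ri) * cis (- (T $ 2 $ 1 * x * ri)) = of_real (1 / sqrt (2 * pi * ?n)) *
       exp (- of_real ((N $ 2 $ 2 - ?m\<^sup>2 / ?n) * x\<^sup>2 / 2)
         + \<i> * of_real (- (((r - ?v * ri - \<tau> $ 1) * ?m / ?n + \<tau> $ 2) * x) - T $ 2 $ 1 * x * ri)
         - of_real ((r - ?v * ri - \<tau> $ 1)\<^sup>2 / (2 * ?n)))"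
      unfolding gauss_rep_def by (simp only:)
    then show ?thesis unfolding kernel_two_def c e p a ..
  qed
  have "has_kernel \<Phi> (\<lambda>xf. delta_affine (?w * xf) 1) ?J"
    unfolding has_kernel_def
  proof (intro allI impI)
    fix K assume K: "trace_class K \<and> schwartz (pos_rep K)"
    interpret schwartz_kernel K using K by unfold_locales auto
    have main: "integrable (delta_affine (?w * x) 1 \<Otimes>\<^sub>M lborel) (\<lambda>(xi, ri). ?J x xi r ri * pos_rep K xi ri) \<and>
      out_rep (fourier_r (pos_rep K)) x r = (LINT (xi, ri)|(delta_affine (?w * x) 1 \<Otimes>\<^sub>M lborel). ?J x xi r ri * pos_rep K xi ri)" for x r
    proof -
      let ?\<rho> = "pos_rep K (?w * x)"
      have Jm: "(\<lambda>p. ?J x (fst p) r (snd p) * pos_rep K (fst p) (snd p)) \<in> borel_measurable (borel \<Otimes>\<^sub>M borel)"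
        unfolding kernel_two_def by measurable
      have [measurable]: "?\<rho> \<in> borel_measurable borel" by measurable
      have i: "integrable lborel (\<lambda>ri. ?J x (?w * x) r ri * ?\<rho> ri)"
      proof (rule Bochner_Integration.integrable_bound)
        show "integrable lborel (\<lambda>ri. 1 / sqrt (2 * pi * ?n) * cmod (?\<rho> ri))"
          by (intro integrable_mult_right integrable_norm pos_rep_section_integrable)
        have "cmod (?J x (?w * x) r ri) \<le> 1 / sqrt (2 * pi * ?n)" for ri
          unfolding J_eq norm_mult using gauss_rep_N_bound[of x "r - ?v * ri"] by simp
        then show "AE ri in lborel. norm (?J x (?w * x) r ri * ?\<rho> ri) \<le> norm (1 / sqrt (2 * pi * ?n) * cmod (?\<rho> ri))"
          unfolding norm_mult real_norm_def by (intro AE_I2 mult_mono order_trans[OF _ abs_ge_self]) (use N11 in auto)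
        show "(\<lambda>ri. ?J x (?w * x) r ri * ?\<rho> ri) \<in> borel_measurable lborel"
          unfolding kernel_two_def by measurable
      qed
      \<comment> \<open>The joint integrand before either integration: over ri it gives the
        integrand of \<open>out_rep\<close>, over k the Gaussian kernel. Its modulus is a product of
        two integrable functions, so the order may be exchanged.\<close>
      define H where "H k ri = cis (k * (r - ?v * ri)) * gauss_char N \<tau> k x * (cis (- (T $ 2 $ 1 * x * ri)) * ?\<rho> ri)" for k ri
      have Hi: "integrable (lborel \<Otimes>\<^sub>M lborel) (\<lambda>p. H (fst p) (snd p))"
      proof (rule Bochner_Integration.integrable_bound)
        show "integrable (lborel \<Otimes>\<^sub>M lborel) (\<lambda>p. cmod (gauss_char N \<tau> (fst p) x) * cmod (?\<rho> (snd p)))"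
          using integrable_lborel_prod[OF integrable_norm[OF gauss_char_N_integrable[of x]] integrable_norm[OF pos_rep_section_integrable[of "?w * x"]]]
          by (simp add: lborel_prod case_prod_unfold)
        show "(\<lambda>p. H (fst p) (snd p)) \<in> borel_measurable (lborel \<Otimes>\<^sub>M lborel)"
          unfolding H_def by measurable
      qed (auto simp: H_def norm_mult)
      have Hk: "(LINT ri|lborel. H k ri) = cis (k * r) * (pull (fourier_r (pos_rep K)) k x * gauss_char N \<tau> k x)" for k
      proof -
        have "H k ri = cis (k * r) * gauss_char N \<tau> k x * (?\<rho> ri * cis (- ((?v * k + T $ 2 $ 1 * x) * ri)))" for ri
        proof -
          have "cis (k * (r - ?v * ri)) * cis (- (T $ 2 $ 1 * x * ri)) = cis (k * r) * cis (- ((?v * k + T $ 2 $ 1 * x) * ri))"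
            by (simp add: cis_mult algebra_simps)
          moreover have "H k ri = (cis (k * (r - ?v * ri)) * cis (- (T $ 2 $ 1 * x * ri))) * gauss_char N \<tau> k x * ?\<rho> ri"
            unfolding H_def by (simp only: mult_ac)
          ultimately show ?thesis by (simp only: mult_ac)
        qed
        then have "(LINT ri|lborel. H k ri) = cis (k * r) * gauss_char N \<tau> k x * fourier_r (pos_rep K) (?v * k + T $ 2 $ 1 * x) (?w * x)"
          unfolding fourier_r_def by (simp only: integral_mult_right_zero)
        then show ?thesis by (simp add: pull_def t mult_ac)
      qed
      have Hri: "(LINT k|lborel. H k ri) = 2 * of_real pi * (?J x (?w * x) r ri * ?\<rho> ri)" for ri
      proof -
        have "(LINT k|lborel. H k ri) = (LINT k|lborel. cis (k * (r - ?v * ri)) * gauss_char N \<tau> k x) * (cis (- (T $ 2 $ 1 * x * ri)) * ?\<rho> ri)"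
          unfolding H_def by (rule integral_mult_left_zero)
        also have "(LINT k|lborel. cis (k * (r - ?v * ri)) * gauss_char N \<tau> k x) = 2 * of_real pi * gauss_rep N \<tau> x (r - ?v * ri)"
          unfolding gauss_char_inverse[where \<sigma> = N, OF N11, symmetric] by simp
        finally show ?thesis unfolding J_eq by (simp only: mult_ac)
      qed
      have "out_rep (fourier_r (pos_rep K)) x r = 1 / (2 * of_real pi) * (LINT k|lborel. LINT ri|lborel. H k ri)"
        unfolding out_rep_def Hk ..
      also have "(LINT k|lborel. LINT ri|lborel. H k ri) = (LINT ri|lborel. LINT k|lborel. H k ri)"
        by (rule lborel_pair.Fubini_integral[symmetric]) (use Hi in \<open>simp add: case_prod_unfold\<close>)
      finally have "out_rep (fourier_r (pos_rep K)) x r = (LINT ri|lborel. ?J x (?w * x) r ri * ?\<rho> ri)"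
        unfolding Hri by simp
      moreover note delta_affine_pair_integrable[OF Jm, of "?w * x" 1] delta_affine_pair_integral[OF Jm, of "?w * x" 1]
      ultimately show ?thesis using i by (simp add: case_prod_unfold)
    qed
    show "AE (xf, rf) in lborel. integrable (delta_affine (?w * xf) 1 \<Otimes>\<^sub>M lborel) (\<lambda>(xi, ri). ?J xf xi rf ri * pos_rep K xi ri) \<and>
      pos_rep (\<Phi> K) xf rf = (LINT (xi, ri)|(delta_affine (?w * xf) 1 \<Otimes>\<^sub>M lborel). ?J xf xi rf ri * pos_rep K xi ri)"
      using channel_schwartz[OF tc schw] unfolding case_prod_unfold
    proof eventually_elim
      case (elim p)
      with main[of "fst p" "snd p", unfolded case_prod_unfold] show ?case by simp
    qed
  qed
  \<comment> \<open>With T12 = 0, singularity means T11 T22 = 0; this is the constraint e2 \<alpha>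
    = 0.\<close>
  moreover have "- ?v / ?n * ?w = 0" using sing t N11 by (auto simp: det_2)
  moreover have "(1 :: real) \<noteq> 0" "1 / (2 * ?n) > 0" using N11 by auto
  moreover have "\<tau> $ 1 = 0 \<longrightarrow> \<tau> $ 1 = 0" by simp
  ultimately show ?thesis by blast
qed

end

subsection \<open>Coherent states are Schwartz\<close>

lemma power_le_exp: "\<exists>C. \<forall>t\<ge>0. t ^ k \<le> C * exp (t :: real)"
proof (cases "k = 0")
  case False
  have "t ^ k \<le> real k ^ k * exp t" if "t \<ge> 0" for t :: real
  proof -
    have "(t / real k) ^ k \<le> (1 + t / real k) ^ k" using that False by (intro power_mono) auto
    also have "\<dots> \<le> exp t" using that False by (intro exp_ge_one_plus_x_over_n_power_n) auto
    finally show ?thesis using False by (simp add: power_divide field_simps)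
  qed
  then show ?thesis by blast
qed (auto intro!: exI[of _ 1])

text \<open>A class closed under differentiation, so that all derivatives of a coherent kernel are
  available as polynomials.\<close>

definition gauss_poly :: "real \<Rightarrow> complex \<Rightarrow> complex poly \<Rightarrow> real \<Rightarrow> complex" where
  "gauss_poly a b p x = poly p (of_real x) * exp (- of_real (a * x\<^sup>2) + b * of_real x)"

text \<open>In the induction on p, a factor x taken from the polynomial raises the exponent k by
  one, hence k stays arbitrary.\<close>

lemma gauss_poly_bounded:
  assumes a: "a > 0"
  shows "\<exists>C. \<forall>x. cmod (of_real (x ^ k) * gauss_poly a b p x) \<le> C"
proof (induction p arbitrary: k)
  case 0
  then show ?case by (auto simp: gauss_poly_def)
next
  case (pCons c p)
  obtain C1 where C1: "\<And>x. cmod (of_real (x ^ Suc k) * gauss_poly a b p x) \<le> C1" using pCons.IH[of "Suc k"] by blast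
  obtain C2 where C2: "\<And>t. t \<ge> 0 \<Longrightarrow> t ^ k \<le> C2 * exp (t :: real)" using power_le_exp[of k] by blast
  have "0 < C2 * exp 1" using C2[of 1] by simp
  then have C2_pos: "0 \<le> C2" by (simp add: zero_less_mult_iff)
  let ?m = "exp ((1 + \<bar>Re b\<bar>)\<^sup>2 / (4 * a))"
  have E: "\<bar>x\<bar> ^ k * cmod (exp (- of_real (a * x\<^sup>2) + b * of_real x)) \<le> C2 * ?m" for x
  proof -
    \<comment> \<open>The summand 1 accounts for exp |x|, which bounds the power of |x|; completing
      the square then gives the constant \<open>?m\<close>.\<close>
    have "0 \<le> (2 * a * \<bar>x\<bar> - (1 + \<bar>Re b\<bar>))\<^sup>2 / (4 * a)" using a by simp
    also have "\<dots> = a * x\<^sup>2 - (1 + \<bar>Re b\<bar>) * \<bar>x\<bar> + (1 + \<bar>Re b\<bar>)\<^sup>2 / (4 * a)"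
      using a by (simp add: field_simps power2_eq_square)
    finally have le: "\<bar>x\<bar> + (- (a * x\<^sup>2) + \<bar>Re b\<bar> * \<bar>x\<bar>) \<le> (1 + \<bar>Re b\<bar>)\<^sup>2 / (4 * a)"
      by (simp add: algebra_simps)
    have "Re b * x \<le> \<bar>Re b\<bar> * \<bar>x\<bar>" by (metis abs_ge_self abs_mult)
    then have "cmod (exp (- of_real (a * x\<^sup>2) + b * of_real x)) \<le> exp (- (a * x\<^sup>2) + \<bar>Re b\<bar> * \<bar>x\<bar>)"
      unfolding norm_exp_eq_Re by simp
    then have "\<bar>x\<bar> ^ k * cmod (exp (- of_real (a * x\<^sup>2) + b * of_real x)) \<le>
       (C2 * exp \<bar>x\<bar>) * exp (- (a * x\<^sup>2) + \<bar>Re b\<bar> * \<bar>x\<bar>)"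
      using C2_pos by (intro mult_mono C2) auto
    also have "\<dots> = C2 * exp (\<bar>x\<bar> + (- (a * x\<^sup>2) + \<bar>Re b\<bar> * \<bar>x\<bar>))"
      by (simp only: exp_add mult.assoc)
    also have "\<dots> \<le> C2 * ?m" using le C2_pos by (intro mult_left_mono) (simp_all only: exp_le_cancel_iff)
    finally show ?thesis .
  qed
  have "cmod (of_real (x ^ k) * gauss_poly a b (pCons c p) x) \<le> cmod c * (C2 * ?m) + C1" for x
  proof -
    have "of_real (x ^ k) * gauss_poly a b (pCons c p) x =
       c * (of_real (x ^ k) * exp (- of_real (a * x\<^sup>2) + b * of_real x)) + of_real (x ^ Suc k) * gauss_poly a b p x"
      by (simp add: gauss_poly_def algebra_simps)
    also have "cmod \<dots> \<le> cmod (c * (of_real (x ^ k) * exp (- of_real (a * x\<^sup>2) + b * of_real x))) + C1"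
      by (rule order_trans[OF norm_triangle_ineq add_left_mono[OF C1]])
    also have "cmod (c * (of_real (x ^ k) * exp (- of_real (a * x\<^sup>2) + b * of_real x))) \<le> cmod c * (C2 * ?m)"
      using E[of x] unfolding norm_mult norm_of_real power_abs by (intro mult_left_mono) auto
    finally show ?thesis by simp
  qed
  then show ?case by blast
qed

text \<open>The Hermite-type recursion p' + (b - 2 a x) p, from differentiating p times the Gaussian
  exp(- a x^2 + b x).\<close>

fun gauss_deriv :: "real \<Rightarrow> complex \<Rightarrow> nat \<Rightarrow> complex poly" where
  "gauss_deriv a b 0 = 1"
| "gauss_deriv a b (Suc m) = pderiv (gauss_deriv a b m) + [:b, - 2 * of_real a:] * gauss_deriv a b m"

lemma gauss_poly_deriv:
  "(gauss_poly a b (gauss_deriv a b m) has_vector_derivative gauss_poly a b (gauss_deriv a b (Suc m)) x) (at x)"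
proof -
  let ?p = "gauss_deriv a b m"
  have "((\<lambda>z. poly ?p z * exp (- (of_real a * z\<^sup>2) + b * z)) has_field_derivative
     poly (pderiv ?p) w * exp (- (of_real a * w\<^sup>2) + b * w) +
     (exp (- (of_real a * w\<^sup>2) + b * w) * (- (of_real a * (2 * w)) + b)) * poly ?p w) (at w)" for w
    by (rule DERIV_mult[OF poly_DERIV]) (rule derivative_eq_intros refl | simp)+
  moreover have "poly (pderiv ?p) w * exp (- (of_real a * w\<^sup>2) + b * w) +
     (exp (- (of_real a * w\<^sup>2) + b * w) * (- (of_real a * (2 * w)) + b)) * poly ?p w =
     poly (gauss_deriv a b (Suc m)) w * exp (- (of_real a * w\<^sup>2) + b * w)" for w
    by (simp add: algebra_simps)
  ultimately have "((\<lambda>z. poly ?p z * exp (- (of_real a * z\<^sup>2) + b * z)) has_field_derivative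
     poly (gauss_deriv a b (Suc m)) (of_real x) * exp (- (of_real a * (of_real x)\<^sup>2) + b * of_real x)) (at (of_real x))"
    by (simp only:)
  from field_vector_diff_chain_at[OF has_vector_derivative_of_real[OF DERIV_ident] this]
  show ?thesis by (simp add: gauss_poly_def[abs_def] o_def del: gauss_deriv.simps)
qed

lemma schwartz_gauss_product:
  assumes a: "a > 0" and a': "a' > 0"
  shows "schwartz (\<lambda>x r. c * gauss_poly a b 1 x * gauss_poly a' b' 1 r)"
  unfolding schwartz_def
proof (intro exI[of _ "\<lambda>m n x r. c * gauss_poly a b (gauss_deriv a b m) x * gauss_poly a' b' (gauss_deriv a' b' n) r"] conjI allI)
  fix m n x r
  show "((\<lambda>u. c * gauss_poly a b (gauss_deriv a b m) u * gauss_poly a' b' (gauss_deriv a' b' n) r) has_vector_derivative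
      c * gauss_poly a b (gauss_deriv a b (Suc m)) x * gauss_poly a' b' (gauss_deriv a' b' n) r) (at x)"
    by (intro has_vector_derivative_mult_left has_vector_derivative_mult_right gauss_poly_deriv)
  show "((\<lambda>u. c * gauss_poly a b (gauss_deriv a b m) x * gauss_poly a' b' (gauss_deriv a' b' n) u) has_vector_derivative
      c * gauss_poly a b (gauss_deriv a b m) x * gauss_poly a' b' (gauss_deriv a' b' (Suc n)) r) (at r)"
    by (intro has_vector_derivative_mult_right gauss_poly_deriv)
next
  fix m n k l
  obtain C1 where C1: "\<And>x. cmod (of_real (x ^ k) * gauss_poly a b (gauss_deriv a b m) x) \<le> C1"
    using gauss_poly_bounded[OF a] by blast
  obtain C2 where C2: "\<And>x. cmod (of_real (x ^ l) * gauss_poly a' b' (gauss_deriv a' b' n) x) \<le> C2"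
    using gauss_poly_bounded[OF a'] by blast
  have "cmod (of_real (x ^ k * r ^ l) * (c * gauss_poly a b (gauss_deriv a b m) x * gauss_poly a' b' (gauss_deriv a' b' n) r)) \<le> cmod c * (C1 * C2)" for x r
  proof -
    have "of_real (x ^ k * r ^ l) * (c * gauss_poly a b (gauss_deriv a b m) x * gauss_poly a' b' (gauss_deriv a' b' n) r) =
      c * ((of_real (x ^ k) * gauss_poly a b (gauss_deriv a b m) x) * (of_real (r ^ l) * gauss_poly a' b' (gauss_deriv a' b' n) r))"
      by (simp add: mult_ac)
    also have "cmod \<dots> \<le> cmod c * (C1 * C2)"
      unfolding norm_mult[of c] norm_mult[of "_ * gauss_poly a b _ _"]
      by (intro mult_left_mono mult_mono C1 C2 order_trans[OF norm_ge_zero C1]) auto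
    finally show ?thesis .
  qed
  then show "bounded (range (\<lambda>(x, r). of_real (x ^ k * r ^ l) * (c * gauss_poly a b (gauss_deriv a b m) x * gauss_poly a' b' (gauss_deriv a' b' n) r)))"
    unfolding bounded_iff by (intro exI[of _ "cmod c * (C1 * C2)"]) auto
qed simp

definition coherent_cov :: "real^2^2" where "coherent_cov = pure_cov (1 / 2) 0"

lemma coherent_rep: "gauss_rep coherent_cov d x r =
  of_real (1 / sqrt pi) * exp (- of_real ((r - d $ 1)\<^sup>2 + x\<^sup>2 / 4) - \<i> * of_real (d $ 2 * x))"
  by (simp add: gauss_rep_def coherent_cov_def)

lemma coherent_rep_shift: "gauss_rep coherent_cov d x (r + d $ 1) = gauss_rep coherent_cov 0 x r * cis (- (d $ 2 * x))"
  unfolding coherent_rep cis_conv_exp mult.assoc exp_add[symmetric] by simp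

lemma schwartz_coherent: "schwartz (gauss_rep coherent_cov d)"
proof -
  let ?c = "of_real (1 / sqrt pi) * exp (- complex_of_real ((d $ 1)\<^sup>2))"
  have "gauss_rep coherent_cov d x r =
    ?c * gauss_poly (1 / 4) (- \<i> * of_real (d $ 2)) 1 x * gauss_poly 1 (of_real (2 * d $ 1)) 1 r" for x r
    unfolding coherent_rep gauss_poly_def poly_1 mult_1_left mult.assoc exp_add[symmetric]
    by (simp add: power2_diff algebra_simps)
  then have "gauss_rep coherent_cov d =
    (\<lambda>x r. ?c * gauss_poly (1 / 4) (- \<i> * of_real (d $ 2)) 1 x * gauss_poly 1 (of_real (2 * d $ 1)) 1 r)"
    by (intro ext)
  moreover have "schwartz (\<lambda>x r. ?c * gauss_poly (1 / 4) (- \<i> * of_real (d $ 2)) 1 x * gauss_poly 1 (of_real (2 * d $ 1)) 1 r)"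
    by (rule schwartz_gauss_product) auto
  ultimately show ?thesis by (simp only:)
qed

subsection \<open>Kernels of the two forms identify distinct coherent states\<close>

text \<open>Continuity upgrades the equality to all points. The two characteristic functions then
  differ only by a phase linear in (k, x), which is trivial for all (k, x) only if the displacements
  agree.\<close>

lemma gauss_rep_displacement_unique:
  assumes s: "\<sigma> $ 1 $ 1 > 0" and ae: "AE p in lborel. gauss_rep \<sigma> d (fst p) (snd p) = gauss_rep \<sigma> d' (fst p) (snd p)"
  shows "d = d'"
proof -
  have c: "continuous_on UNIV (\<lambda>p. gauss_rep \<sigma> d (fst p) (snd p))" for d
    unfolding gauss_rep_def by (intro continuous_intros) (use s in auto)
  have "AE p in lebesgue. p \<in> {p. gauss_rep \<sigma> d (fst p) (snd p) = gauss_rep \<sigma> d' (fst p) (snd p)}"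
    using ae by (simp add: AE_completion)
  from mem_closed_if_AE_lebesgue[OF closed_Collect_eq[OF c c] this]
  have "(x, r) \<in> {p. gauss_rep \<sigma> d (fst p) (snd p) = gauss_rep \<sigma> d' (fst p) (snd p)}" for x r .
  then have eq: "gauss_rep \<sigma> d x r = gauss_rep \<sigma> d' x r" for x r by simp
  have 1: "cis (k * (d $ 1 - d' $ 1) + x * (d $ 2 - d' $ 2)) = 1" for k x
  proof -
    let ?X = "\<lambda>d. - complex_of_real (quad2 \<sigma> k x / 2) - \<i> * of_real (k * d $ 1 + x * d $ 2)"
    have "exp (?X d) = exp (?X d')"
      using gauss_rep_char[where \<sigma> = \<sigma>, OF s, of d x k] gauss_rep_char[where \<sigma> = \<sigma>, OF s, of d' x k]
      unfolding gauss_char_def eq by (simp only:)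
    then have "exp (?X d' - ?X d) = 1" unfolding exp_diff[of "?X d'" "?X d"] by simp
    moreover have "?X d' - ?X d = \<i> * of_real (k * (d $ 1 - d' $ 1) + x * (d $ 2 - d' $ 2))"
      by (simp add: algebra_simps)
    ultimately show ?thesis unfolding cis_conv_exp by (simp only:)
  qed
  have z: "y = 0" if "\<And>k. cis (k * y) = 1" for y
  proof (rule ccontr)
    assume "y \<noteq> 0"
    \<comment> \<open>At this frequency the phase would be -1.\<close>
    then show False using that[of "pi / y"] by simp
  qed
  have "d $ 1 - d' $ 1 = 0" by (rule z) (use 1[of _ 0] in simp)
  moreover have "d $ 2 - d' $ 2 = 0" by (rule z) (use 1[of 0] in simp)
  ultimately show ?thesis by (simp add: vec_eq_iff forall_2)
qed

text \<open>Displacing a coherent state by d shifts ri by d1 and multiplies by exp(- \<i> d2 xi).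
  The assumption \<open>inv\<close> says that the kernel undoes exactly this change, so the outputs
  of the displaced and the undisplaced state coincide, and their mean vectors with them.\<close>

lemma not_invertible_of_kernel:
  fixes T N :: "real^2^2" and \<tau> d :: "real^2"
  assumes ch: "quantum_channel \<Phi>" and desc: "described_by \<Phi> T N \<tau>" and ker: "has_kernel \<Phi> M J"
    and sf: "\<And>x. sigma_finite_measure (M x)"
    and d: "d \<noteq> 0"
    and inv: "\<And>x r. AE xi in M x. \<forall>ri. J x xi r (ri + d $ 1) * cis (- (d $ 2 * xi)) = J x xi r ri"
  shows "\<not> invertible T"
proof -
  interpret channel \<Phi> by unfold_locales (rule ch)
  have h: "(1 / 2 :: real) > 0" by simp
  let ?K = "\<lambda>d. dyad (pure_gauss (1 / 2) 0 d) (pure_gauss (1 / 2) 0 d)"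
  have rep: "pos_rep (?K d) = gauss_rep coherent_cov d" for d
    by (intro ext) (simp add: pos_rep_pure_gauss coherent_cov_def)
  have tc: "trace_class (?K d)" for d by (intro trace_class_dyad L2_fun_pure_gauss h)
  let ?R = "\<lambda>d x r. LINT (xi, ri)|(M x \<Otimes>\<^sub>M lborel). J x xi r ri * gauss_rep coherent_cov d xi ri"
  have out: "AE p in lborel. integrable (M (fst p) \<Otimes>\<^sub>M lborel) (\<lambda>(xi, ri). J (fst p) xi (snd p) ri * gauss_rep coherent_cov d xi ri) \<and>
      pos_rep (\<Phi> (?K d)) (fst p) (snd p) = ?R d (fst p) (snd p)" for d
    using ker[unfolded has_kernel_def, rule_format, of "?K d"] tc[of d] schwartz_coherent[of d]
    unfolding rep by (simp only: case_prod_unfold)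
  have R_eq: "?R d x r = ?R 0 x r"
    if i: "integrable (M x \<Otimes>\<^sub>M lborel) (\<lambda>(xi, ri). J x xi r ri * gauss_rep coherent_cov d xi ri)"
      and i0: "integrable (M x \<Otimes>\<^sub>M lborel) (\<lambda>(xi, ri). J x xi r ri * gauss_rep coherent_cov 0 xi ri)" for x r
  proof -
    interpret M: sigma_finite_measure "M x" by (rule sf)
    interpret P: pair_sigma_finite "M x" "lborel :: real measure" by unfold_locales
    have "AE xi in M x. (LINT ri|lborel. J x xi r ri * gauss_rep coherent_cov d xi ri) = (LINT ri|lborel. J x xi r ri * gauss_rep coherent_cov 0 xi ri)"
      using inv[of x r]
    proof eventually_elim
      case (elim xi)
      have "(LINT ri|lborel. J x xi r ri * gauss_rep coherent_cov d xi ri) =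
         (LINT ri|lborel. J x xi r (ri + d $ 1) * gauss_rep coherent_cov d xi (ri + d $ 1))"
        using lborel_integral_shift[of "\<lambda>ri. J x xi r (ri + d $ 1) * gauss_rep coherent_cov d xi (ri + d $ 1)" "d $ 1"] by simp
      also have "\<dots> = (LINT ri|lborel. J x xi r ri * gauss_rep coherent_cov 0 xi ri)"
      proof -
        have "J x xi r (ri + d $ 1) * gauss_rep coherent_cov d xi (ri + d $ 1) =
          (J x xi r (ri + d $ 1) * cis (- (d $ 2 * xi))) * gauss_rep coherent_cov 0 xi ri" for ri
          unfolding coherent_rep_shift by (simp only: mult_ac)
        then show ?thesis by (simp only: elim[rule_format])
      qed
      finally show ?case .
    qed
    then have "(LINT xi|M x. LINT ri|lborel. J x xi r ri * gauss_rep coherent_cov d xi ri) =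
      (LINT xi|M x. LINT ri|lborel. J x xi r ri * gauss_rep coherent_cov 0 xi ri)"
      using P.integrable_fst'[OF i] P.integrable_fst'[OF i0] by (intro integral_cong_AE) auto
    then show ?thesis using P.integral_fst'[OF i] P.integral_fst'[OF i0] by simp
  qed
  have ae: "AE p in lborel. pos_rep (\<Phi> (?K d)) (fst p) (snd p) = pos_rep (\<Phi> (?K 0)) (fst p) (snd p)"
    using out[of d] out[of 0] by eventually_elim (use R_eq in simp)
  let ?\<sigma> = "transform_cov T N coherent_cov"
  have st: "gaussian_state_with (\<Phi> (?K d)) ?\<sigma> (T *v d + \<tau>)" for d
    using desc gaussian_state_pure[OF h, of 0 d] unfolding described_by_def transform_cov_def coherent_cov_def by blast
  have g: "AE p in lborel. pos_rep (\<Phi> (?K d)) (fst p) (snd p) = gauss_rep ?\<sigma> (T *v d + \<tau>) (fst p) (snd p)" for d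
  proof -
    have "AE p in lborel. \<Phi> (?K d) (fst p) (snd p) = gauss_ker ?\<sigma> (T *v d + \<tau>) (fst p) (snd p)"
      using gaussian_state_ker[OF st] by (simp only: ker_eq_def case_prod_unfold)
    from AE_pos_rep_coords[OF this] show ?thesis
      by (simp only: pos_rep_def[symmetric] pos_rep_gauss_ker)
  qed
  have "AE p in lborel. gauss_rep ?\<sigma> (T *v d + \<tau>) (fst p) (snd p) = gauss_rep ?\<sigma> (T *v 0 + \<tau>) (fst p) (snd p)"
    using ae g[of d] g[of 0] by eventually_elim (simp only:)
  then have "T *v d + \<tau> = T *v 0 + \<tau>"
    by (rule gauss_rep_displacement_unique[rotated]) (rule pos_def_2D(1)[OF gaussian_state_withD(2)[OF st]])
  then have Td: "T *v d = 0" by (simp add: matrix_vector_mult_0_right)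
  show ?thesis
  proof
    assume "invertible T"
    then obtain T' where "T' ** T = mat 1" by (auto simp: invertible_def)
    then have "d = T' *v (T *v d)" by (simp add: matrix_vector_mul_assoc)
    with Td d show False by (simp add: matrix_vector_mult_0_right)
  qed
qed

lemma form_one_singular:
  assumes "quantum_channel \<Phi>" "described_by \<Phi> T N \<tau>"
    and "has_kernel \<Phi> (\<lambda>xf. lborel) (kernel_one a1 a2 a3 b1 b3 b4 c1 c2)"
  shows "\<not> invertible T"
proof -
  \<comment> \<open>The variable ri occurs only in the phase b4 xi ri; a unit shift of ri creates
    exp(\<i> b4 xi), which a momentum displacement by b4 removes.\<close>
  define v :: "real^2" where "v = vector [1, b4]"
  have v: "v $ 1 = 1" "v $ 2 = b4" by (simp_all add: v_def)
  have *: "(C * exp (\<i> * of_real X - of_real A)) * cis Y = C * exp (\<i> * of_real (X + Y) - of_real A)" for C X Y A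
    unfolding cis_conv_exp mult.assoc exp_add[symmetric] by (simp add: algebra_simps)
  show ?thesis
  proof (rule not_invertible_of_kernel[OF assms, where d = v])
    show "v \<noteq> 0" using v(1) by (metis zero_index zero_neq_one)
    show "AE xi in lborel. \<forall>ri. kernel_one a1 a2 a3 b1 b3 b4 c1 c2 x xi r (ri + v $ 1) * cis (- (v $ 2 * xi)) =
      kernel_one a1 a2 a3 b1 b3 b4 c1 c2 x xi r ri" for x r
      unfolding kernel_one_def * v by (simp add: algebra_simps)
  qed (rule sigma_finite_lborel)
qed

lemma form_two_singular:
  assumes q: "quantum_channel \<Phi>" "described_by \<Phi> T N \<tau>"
    and b: "\<beta> \<noteq> 0" and e: "e2 * \<alpha> = 0"
    and ker: "has_kernel \<Phi> (\<lambda>xf. delta_affine (\<alpha> * xf) \<beta>) (kernel_two \<beta> a1 a2 a3 b1 b2 b3 b4 c1 c2 e1 e2 d)"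
  shows "\<not> invertible T"
proof -
  let ?J = "kernel_two \<beta> a1 a2 a3 b1 b2 b3 b4 c1 c2 e1 e2 d"
  have *: "(C * exp (- of_real A + \<i> * of_real X - of_real B)) * cis Y = C * exp (- of_real A + \<i> * of_real (X + Y) - of_real B)" for C A X B Y
    unfolding cis_conv_exp mult.assoc exp_add[symmetric] by (simp add: algebra_simps)
  \<comment> \<open>For \<alpha> = 0 the delta sits at xi = 0, where a momentum displacement acts
    trivially. Otherwise e2 = 0, and since xi = \<alpha> x / \<beta> the shift of ri by \<alpha> /
    \<beta> creates the phase (b2 + b4 \<alpha> / \<beta>) xi, which the second component
    cancels.\<close>
  define v :: "real^2" where "v = (if \<alpha> = 0 then vector [0, 1] else vector [\<alpha> / \<beta>, b2 + b4 * \<alpha> / \<beta>])"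
  show ?thesis
  proof (rule not_invertible_of_kernel[OF q ker sigma_finite_delta_affine, where d = v])
    have "v $ 1 \<noteq> 0 \<or> v $ 2 \<noteq> 0" using b by (simp add: v_def)
    then show "v \<noteq> 0" by (metis zero_index)
    fix x r
    show "AE xi in delta_affine (\<alpha> * x) \<beta>. \<forall>ri. ?J x xi r (ri + v $ 1) * cis (- (v $ 2 * xi)) = ?J x xi r ri"
      using AE_delta_affine[of "\<alpha> * x" \<beta>]
    proof eventually_elim
      case (elim xi)
      show ?case
      proof (cases "\<alpha> = 0")
        case True
        then show ?thesis using elim by (simp add: v_def)
      next
        case False
        then have v: "v $ 1 = \<alpha> / \<beta>" "v $ 2 = b2 + b4 * \<alpha> / \<beta>" and e2: "e2 = 0"
          using e by (simp_all add: v_def)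
        have p: "(b2 * x * (ri + v $ 1) + b3 * r * xi + b1 * r * x + b4 * (ri + v $ 1) * xi + c1 * x + c2 * xi) + - (v $ 2 * xi) =
          b2 * x * ri + b3 * r * xi + b1 * r * x + b4 * ri * xi + c1 * x + c2 * xi" for ri
          using b unfolding elim v by (simp add: field_simps)
        show ?thesis unfolding kernel_two_def * p e2 by simp
      qed
    qed
  qed
qed

section \<open>Singularity of the channel and the two kernel forms\<close>

theorem theorem21:
  fixes \<Phi> :: "opker \<Rightarrow> opker" and T N :: "real^2^2" and \<tau> :: "real^2"
  assumes "gaussian_channel \<Phi>" and "described_by \<Phi> T N \<tau>"
  shows "\<not> invertible T \<longleftrightarrow>
    (\<exists>a1 a2 a3 b1 b3 b4 c1 c2 :: real.
       has_kernel \<Phi> (\<lambda>xf. lborel)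
         (\<lambda>xf xi rf ri. of_real (\<bar>b3\<bar> / (2 * pi)) *
            exp (\<i> * of_real (b1 * xf * rf + b3 * xi * rf + b4 * xi * ri + c1 * xf + c2 * xi)
                 - of_real (a1 * xf\<^sup>2 + a2 * xf * xi + a3 * xi\<^sup>2)))) \<or>
    (\<exists>\<alpha> \<beta> a1 a2 a3 b1 b2 b3 b4 c1 c2 e1 e2 d :: real.
       \<beta> \<noteq> 0 \<and> e1 > 0 \<and> e2 * \<alpha> = 0 \<and> (\<tau> $ 1 = 0 \<longrightarrow> d = 0) \<and>
       has_kernel \<Phi> (\<lambda>xf. delta_affine (\<alpha> * xf) \<beta>)
         (\<lambda>xf xi rf ri. of_real (\<bar>\<beta>\<bar> * sqrt (e1 / pi)) *
            exp (- of_real (a2 * xf * xi + a1 * xf\<^sup>2 + a3 * xi\<^sup>2)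
                 + \<i> * of_real (b2 * xf * ri + b3 * rf * xi + b1 * rf * xf + b4 * ri * xi
                                + c1 * xf + c2 * xi)
                 - of_real (e1 * (rf - d)\<^sup>2 + e2 * (rf - d) * ri + e2\<^sup>2 * ri\<^sup>2 / (4 * e1)))))"
    (is "_ \<longleftrightarrow> ?one \<or> ?two")
proof
  have q: "quantum_channel \<Phi>" using assms(1) by (simp add: gaussian_channel_def)
  show "?one \<or> ?two" if "\<not> invertible T"
  proof -
    interpret singular_gaussian_channel \<Phi> T N \<tau>
      using that q assms(2) by unfold_locales (auto simp: invertible_det_nz)
    show ?thesis
    proof (cases "T $ 1 $ 2 = 0")
      case True
      from form_two[OF this] show ?thesis unfolding kernel_two_def[abs_def] by (rule disjI2)
    next
      case False
      from form_one[OF this] show ?thesis unfolding kernel_one_def[abs_def] by (rule disjI1)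
    qed
  qed
  show "\<not> invertible T" if "?one \<or> ?two"
    using that
  proof
    assume ?one
    then show ?thesis by (elim exE) (rule form_one_singular[OF q assms(2), unfolded kernel_one_def[abs_def]])
  next
    assume ?two
    then show ?thesis by (elim exE conjE) (rule form_two_singular[OF q assms(2), unfolded kernel_two_def[abs_def]])
  qed
qed

end
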